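(* Let $X_1,\dots,X_n\in\mathbb{R}^d$, $Y_1,\dots,Y_n\in\mathbb{R}$, $c(\sigma)>0$, and let $\psi,\varrho,\mathrm{g}:\mathbb{R}\to\mathbb{R}$ be $C^2$. Define on $\mathbb{R}^{1+d}$ (root variable $\vartheta$, leaf variables $\beta_1,\dots,\beta_d$) $$V_{\rm loc}(\vartheta,\beta)=\mathrm{g}(\vartheta)-w^\top\beta+\sum_{i=1}^n\frac{\psi(X_i^\top\beta)}{c(\sigma)}+\sum_{j=1}^d\varrho(\beta_j-\vartheta),$$ with $w=\bm X^\top\mathbf y/c(\sigma)$, $\bm X=[X_1,\dots,X_n]^\top$, $\mathbf y=(Y_1,\dots,Y_n)^\top$, and $\pi_{\rm loc}\propto e^{-V_{\rm loc}}$. Let $A=\bm X^\top\bm X/c(\sigma)$ and $\mathcal{A}(\beta)=\bm X^\top D(\beta)\bm X/c(\sigma)$ with $D(\beta)=\mathrm{diag}(\psi''(X_1^\top\beta),\dots,\psi''(X_n^\top\beta))$. Assume $b\le\psi''\le B$ for some $B\ge b>0$, $0\le\varrho''\le R$, $A\succeq aI$ for some $a>0$, and $\alpha\le\mathrm{g}''\le L$ with $\ell'_V:=\alpha-\frac{dR^2}{ab}>0$. Let $\pi^\star_{\rm loc}$ be the minimizer of $\mathrm{KL}(\cdot\|\pi_{\rm loc})$ over the star family with root $\vartheta$ (assumed to have a differentiable density). Then $$\mathrm{KL}(\pi^\star_{\rm loc}\|\pi_{\rm loc})\le\frac{dR+L}{a^2b^2\ell'_V}\Big\|\sum_{i=1}^d\sum_{j>i}\mathcal{A}_{ij}^2\Big\|_{L^\infty},$$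 where $\|\cdot\|_{L^\infty}$ is the supremum over $\beta\in\mathbb{R}^d$.
   Context: The star family over variables $(\vartheta,\beta_1,\dots,\beta_d)$ with root $\vartheta$ is the set of probability measures $\mu(\mathrm{d}\vartheta,\mathrm{d}\beta)=\mu_0(\mathrm{d}\vartheta)\prod_{j=1}^d\mu_j(\mathrm{d}\beta_j\mid\vartheta)$ on $\mathbb{R}^{1+d}$. KL is relative entropy. *)

theory Defs
  imports "HOL-Probability.Probability"
begin

text \<open>Relative entropy KL(mu || pi), valued in extended reals; +infinity when mu is not
  absolutely continuous w.r.t. pi or the log-density is not integrable (its negative part is
  always integrable, so the integral is then +infinity).\<close>
definition KL :: "'a measure \<Rightarrow> 'a measure \<Rightarrow> ereal" where
  "KL \<mu> \<pi> =
     (if sets \<mu> = sets \<pi> \<and> absolutely_continuous \<pi> \<mu>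
         \<and> integrable \<mu> (\<lambda>x. ln (enn2real (RN_deriv \<pi> \<mu> x)))
      then ereal (\<integral>x. ln (enn2real (RN_deriv \<pi> \<mu> x)) \<partial>\<mu>)
      else \<infinity>)"

definition star_family :: "(real \<times> (real^'d)) measure set" where
  "star_family = {\<mu> :: (real \<times> (real^'d)) measure. prob_space \<mu> \<and> sets \<mu> = sets borel \<and>
     (\<exists>\<mu>0 K. prob_space \<mu>0 \<and> sets \<mu>0 = sets (borel :: real measure) \<and>
        (\<forall>j. K j \<in> measurable (borel :: real measure) (prob_algebra (borel :: real measure))) \<and>
        \<mu> = Giry_Monad.bind \<mu>0 (\<lambda>\<theta>. distr (PiM UNIV (\<lambda>j. K j \<theta>)) borel (\<lambda>b. (\<theta>, vec_lambda b :: real^'d))))}"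

definition gibbs :: "('a::euclidean_space \<Rightarrow> real) \<Rightarrow> 'a measure" where
  "gibbs V = density lborel
     (\<lambda>x. ennreal (exp (- V x) / (\<integral>y. exp (- V y) \<partial>lborel)))"

text \<open>w = X^T y / c(sigma)\<close>
definition wvec :: "nat \<Rightarrow> (nat \<Rightarrow> real^'d) \<Rightarrow> (nat \<Rightarrow> real) \<Rightarrow> real \<Rightarrow> real^'d" where
  "wvec n X Y c = (1 / c) *\<^sub>R (\<Sum>i<n. Y i *\<^sub>R X i)"

definition V_loc :: "nat \<Rightarrow> (nat \<Rightarrow> real^'d) \<Rightarrow> (nat \<Rightarrow> real) \<Rightarrow> real \<Rightarrow>
    (real \<Rightarrow> real) \<Rightarrow> (real \<Rightarrow> real) \<Rightarrow> (real \<Rightarrow> real) \<Rightarrow> real \<times> (real^'d) \<Rightarrow> real" where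
  "V_loc n X Y c \<psi> \<rho> g = (\<lambda>(\<theta>, \<beta>).
      g \<theta> - wvec n X Y c \<bullet> \<beta> + (\<Sum>i<n. \<psi> (X i \<bullet> \<beta>) / c)
      + (\<Sum>j\<in>UNIV. \<rho> (\<beta> $ j - \<theta>)))"

text \<open>A = X^T X / c(sigma)\<close>
definition Amat :: "nat \<Rightarrow> (nat \<Rightarrow> real^'d) \<Rightarrow> real \<Rightarrow> real^'d^'d" where
  "Amat n X c = (\<chi> k l. (\<Sum>i<n. X i $ k * X i $ l) / c)"

text \<open>calligraphic A(beta) = X^T D(beta) X / c(sigma), D(beta) = diag(psi''(X_i^T beta))\<close>
definition calA :: "nat \<Rightarrow> (nat \<Rightarrow> real^'d) \<Rightarrow> real \<Rightarrow> (real \<Rightarrow> real) \<Rightarrow> real^'d \<Rightarrow> real^'d^'d" where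
  "calA n X c \<psi>2 \<beta> = (\<chi> k l. (\<Sum>i<n. X i $ k * \<psi>2 (X i \<bullet> \<beta>) * X i $ l) / c)"

end

theory Submission
  imports Defs
begin

text \<open>Since the minimizer beats every member of the star family, it suffices to exhibit, for each
  \<open>\<epsilon> > 0\<close>, some \<open>\<nu>\<close> in the family with \<open>KL(\<nu> | \<pi>) \<le> S / (a b)\<^sup>2 + \<epsilon>\<close>, where \<open>S\<close> is the supremum in the
  statement; the factor \<open>(d R + L) / l\<close> is at least \<open>1\<close>. Take the root marginal of \<open>\<pi>\<close> itself, so that
  \<open>KL(\<nu> | \<pi>)\<close> is the average over \<open>\<theta>\<close> of the mean-field error of the conditional law of \<open>\<beta>\<close>, whose
  potential \<open>U\<close> is \<open>\<kappa>\<close>-convex with \<open>\<kappa> = a b\<close>. By continuity in \<open>\<theta>\<close> and Lindelof, countably many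
  product measures serve all \<open>\<theta>\<close>, which makes the kernel measurable.

  For fixed \<open>\<theta>\<close>, let \<open>\<phi>\<close> nearly minimize the mean-field free energy and let \<open>\<psi>\<^sub>i' = E\<^sub>\<phi>[\<partial>\<^sub>i U | x\<^sub>i]\<close>. Then
  \<open>\<phi>\<close> and \<open>\<psi>\<close> are close in relative entropy, and the log-Sobolev inequality followed by the Poincare
  inequality bounds the mean-field error of \<open>\<psi>\<close> by
  \<open>1 / (2 \<kappa>) \<Sum>\<^sub>i E(\<partial>\<^sub>i U - \<psi>\<^sub>i')\<^sup>2 \<le> 1 / (2 \<kappa>\<^sup>2) \<Sum>\<^sub>i \<Sum>\<^sub>j\<^sub>\<noteq>\<^sub>i E(\<partial>\<^sub>i\<^sub>j U)\<^sup>2 + \<epsilon>\<close>.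
  The log-Sobolev inequality is used in the form: if \<open>E(y) \<le> exp(W(x) - \<phi>(x) - \<phi>'(x) (y - x))\<close> for all
  \<open>x\<close>, \<open>y\<close>, then \<open>\<integral>E \<le> exp(\<integral>W e\<^sup>-\<^sup>\<phi>)\<close>. This is proved on the line by monotone transport, and it
  tensorizes coordinate by coordinate without any regularity of the marginals of \<open>E\<close>.\<close>

section \<open>Strongly convex potentials on the line\<close>

text \<open>An exact minimizer of the mean-field free energy would satisfy
  \<open>\<psi> = \<phi>\<close>, but producing one is a compactness question; an approximate one
  only needs an infimum. Replacing the single factor \<open>\<phi> i\<close> by
  \<open>\<psi> i\<close> lowers the free energy by exactly the relative entropy of the old factor
  to the new one, so each of these entropies is at most the slack. The error is estimated at \<psi>,
  not at \<phi>, because log-Sobolev involves derivatives of potentials: near-optimality says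
  nothing about those of \<open>\<phi> i\<close>, while those of \<open>\<psi> i\<close> are
  explicit averages. The price is a mismatch, since these averages are taken under \<phi> and the
  Fisher information under \<psi>; closeness in entropy turns it into a small bias. Poincare is
  applied with coordinate \<open>i\<close> frozen, so only mixed second derivatives survive. The
  double sum counts every pair twice, which turns \<open>1 / (2 \<kappa>\<^sup>2)\<close> into
  \<open>S / \<kappa>\<^sup>2\<close>. The last factor is at least 1 because l \<le> \<alpha> \<le>
  L and R \<ge> 0.\<close>

definition sconv :: "real \<Rightarrow> real \<Rightarrow> (real \<Rightarrow> real) \<Rightarrow> (real \<Rightarrow> real) \<Rightarrow> bool" where
  "sconv \<kappa> M \<phi> \<phi>' \<longleftrightarrow> 0 < \<kappa> \<and> (\<forall>t. (\<phi> has_real_derivative \<phi>' t) (at t)) \<and>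
     (\<forall>s t. s \<le> t \<longrightarrow> \<kappa> * (t - s) \<le> \<phi>' t - \<phi>' s \<and> \<phi>' t - \<phi>' s \<le> M * (t - s))"

text \<open>Normalized, so that exp (- \<phi>) is a probability density. Using \<open>deriv\<close>
  makes a potential a single function, so that the free energy can be minimized over families of
  \<phi> alone.\<close>

definition potential :: "real \<Rightarrow> real \<Rightarrow> (real \<Rightarrow> real) \<Rightarrow> bool" where
  "potential \<kappa> M \<phi> \<longleftrightarrow> sconv \<kappa> M \<phi> (deriv \<phi>) \<and> (\<integral>\<^sup>+t. ennreal (exp (- \<phi> t)) \<partial>lborel) = 1"

definition gibbs1 :: "(real \<Rightarrow> real) \<Rightarrow> real measure" where
  "gibbs1 \<phi> = density lborel (\<lambda>t. ennreal (exp (- \<phi> t)))"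

lemma sconv_DERIV: "sconv \<kappa> M \<phi> \<phi>' \<Longrightarrow> (\<phi> has_real_derivative \<phi>' t) (at t)"
  by (simp add: sconv_def)

lemma sconv_continuous: "sconv \<kappa> M \<phi> \<phi>' \<Longrightarrow> continuous_on S \<phi>"
  by (intro continuous_at_imp_continuous_on ballI DERIV_isCont[OF sconv_DERIV])

lemma sconv_lipschitz:
  assumes "sconv \<kappa> M \<phi> \<phi>'"
  shows "\<bar>\<phi>' t - \<phi>' s\<bar> \<le> M * \<bar>t - s\<bar>"
proof -
  have k: "\<kappa> > 0" and *: "\<And>s t. s \<le> t \<Longrightarrow> \<kappa> * (t - s) \<le> \<phi>' t - \<phi>' s \<and> \<phi>' t - \<phi>' s \<le> M * (t - s)"
    using assms by (auto simp: sconv_def)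
  have **: "\<bar>\<phi>' v - \<phi>' u\<bar> \<le> M * (v - u)" if "u \<le> v" for u v
  proof -
    have "0 \<le> \<kappa> * (v - u)" using k that by simp
    then show ?thesis using *[OF that] by linarith
  qed
  show ?thesis
    using **[of s t] **[of t s] by (cases "s \<le> t") (auto simp: abs_minus_commute)
qed

lemma sconv_M: assumes "sconv \<kappa> M \<phi> \<phi>'" shows "\<kappa> \<le> M"
proof -
  have "\<kappa> * (1 - 0) \<le> \<phi>' 1 - \<phi>' 0 \<and> \<phi>' 1 - \<phi>' 0 \<le> M * (1 - 0)"
    using assms unfolding sconv_def by (meson zero_le_one)
  then show ?thesis by auto
qed

lemma sconv_continuous': 
  assumes "sconv \<kappa> M \<phi> \<phi>'" shows "continuous_on S \<phi>'"
proof -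
  have "M-lipschitz_on UNIV \<phi>'"
    using sconv_lipschitz[OF assms] sconv_M[OF assms] assms
    by (intro lipschitz_onI) (auto simp: dist_real_def sconv_def)
  then show ?thesis
    using lipschitz_on_continuous_on continuous_on_subset by blast
qed

lemma sconv_tangent:
  assumes "sconv \<kappa> M \<phi> \<phi>'"
  shows "\<phi> s + \<phi>' s * (t - s) + \<kappa> / 2 * (t - s)\<^sup>2 \<le> \<phi> t"
proof -
  have k: "\<And>s t. s \<le> t \<Longrightarrow> \<kappa> * (t - s) \<le> \<phi>' t - \<phi>' s"
    using assms by (auto simp: sconv_def)
  \<comment> \<open>The derivative of \<open>h\<close> has the sign of \<open>u - s\<close>, so
    \<open>h\<close> is minimal at \<open>s\<close>.\<close>
  define h where "h u = \<phi> u - \<phi>' s * (u - s) - \<kappa> / 2 * (u - s)\<^sup>2" for u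
  have dh: "(h has_real_derivative (\<phi>' u - \<phi>' s - \<kappa> * (u - s))) (at u)" for u
    unfolding h_def by (auto intro!: derivative_eq_intros sconv_DERIV[OF assms])
  have "h s \<le> h t"
  proof (cases "s \<le> t")
    case True
    then show ?thesis
      by (rule DERIV_nonneg_imp_nondecreasing) (use dh k in force)
  next
    case False
    have "\<phi>' u - \<phi>' s - \<kappa> * (u - s) \<le> 0" if "u \<le> s" for u
      using k[OF that] by (simp add: algebra_simps)
    then show ?thesis
      using DERIV_nonpos_imp_nonincreasing[of t s h] False dh by fastforce
  qed
  then show ?thesis by (simp add: h_def)
qed

lemma sconv_growth':
  assumes "sconv \<kappa> M \<phi> \<phi>'"
  shows "\<bar>\<phi>' t\<bar> \<le> (\<bar>\<phi>' 0\<bar> + M) * (1 + \<bar>t\<bar>)"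
proof -
  have "\<bar>\<phi>' t\<bar> \<le> \<bar>\<phi>' 0\<bar> + M * \<bar>t\<bar>"
    using sconv_lipschitz[OF assms, of t 0] by simp
  moreover have "0 \<le> M" using sconv_M[OF assms] assms by (auto simp: sconv_def)
  moreover have "0 \<le> \<bar>\<phi>' 0\<bar> * \<bar>t\<bar>" by simp
  moreover have "(\<bar>\<phi>' 0\<bar> + M) * (1 + \<bar>t\<bar>) = \<bar>\<phi>' 0\<bar> + M * \<bar>t\<bar> + M + \<bar>\<phi>' 0\<bar> * \<bar>t\<bar>"
    by (simp add: algebra_simps)
  ultimately show ?thesis by linarith
qed

lemma abs_le_one_plus_square: "\<bar>t::real\<bar> \<le> 1 + t\<^sup>2"
  using zero_le_power2[of "\<bar>t\<bar> - 1"] by (simp add: power2_eq_square algebra_simps)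

lemma sconv_growth:
  assumes "sconv \<kappa> M \<phi> \<phi>'"
  shows "\<bar>\<phi> t\<bar> \<le> (\<bar>\<phi> 0\<bar> + 3 * (\<bar>\<phi>' 0\<bar> + M)) * (1 + t\<^sup>2)"
proof -
  let ?P = "\<bar>\<phi>' 0\<bar> + M"
  have k: "0 < \<kappa>" and M: "0 \<le> M" using sconv_M[OF assms] assms by (auto simp: sconv_def)
  have a: "\<bar>t\<bar> \<le> 1 + t\<^sup>2" "\<bar>t\<bar> + t\<^sup>2 \<le> 3 * (1 + t\<^sup>2)"
    using abs_le_one_plus_square[of t] zero_le_power2[of t] by (auto simp: algebra_simps)
  have "0 \<le> \<kappa> / 2 * t\<^sup>2" using k by simp
  \<comment> \<open>The tangent at 0 bounds \<phi> from below; the tangent at \<open>t\<close>,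
    evaluated at 0, bounds it from above.\<close>
  then have "\<phi> 0 + \<phi>' 0 * t \<le> \<phi> t" "\<phi> t \<le> \<phi> 0 + \<phi>' t * t"
    using sconv_tangent[OF assms, of 0 t] sconv_tangent[OF assms, of t 0] by simp_all
  then have "\<bar>\<phi> t\<bar> \<le> \<bar>\<phi> 0\<bar> + max \<bar>\<phi>' 0 * t\<bar> \<bar>\<phi>' t * t\<bar>" by linarith
  also have "\<bar>\<phi>' t * t\<bar> \<le> ?P * (1 + \<bar>t\<bar>) * \<bar>t\<bar>"
    unfolding abs_mult by (intro mult_right_mono sconv_growth'[OF assms]) auto
  also have "\<dots> = ?P * (\<bar>t\<bar> + t\<^sup>2)" by (simp add: algebra_simps power2_eq_square)
  also have "\<dots> \<le> ?P * (3 * (1 + t\<^sup>2))" using a M by (intro mult_left_mono) auto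
  also have "\<bar>\<phi>' 0 * t\<bar> \<le> ?P * (3 * (1 + t\<^sup>2))"
    unfolding abs_mult using M a(1) zero_le_power2[of t] by (intro mult_mono) auto
  also have "\<bar>\<phi> 0\<bar> + max (?P * (3 * (1 + t\<^sup>2))) (?P * (3 * (1 + t\<^sup>2))) \<le> (\<bar>\<phi> 0\<bar> + 3 * ?P) * (1 + t\<^sup>2)"
    by (simp add: algebra_simps)
  finally show ?thesis by simp
qed

lemma sconv_integrable:
  assumes "sconv \<kappa> M \<phi> \<phi>'" and f[measurable]: "f \<in> borel_measurable borel"
    and g: "\<And>t. \<bar>f t\<bar> \<le> C * (1 + t\<^sup>2)"
  shows "integrable lborel (\<lambda>t. exp (- \<phi> t) * f t)"
proof -
  have k: "\<kappa> > 0" using assms by (simp add: sconv_def)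
  have [measurable]: "\<phi> \<in> borel_measurable borel"
    by (intro borel_measurable_continuous_onI sconv_continuous[OF assms(1)])
  have C: "0 \<le> C" using g[of 0] by auto
  \<comment> \<open>Completing the square in the tangent bound at 0 gives a Gaussian of mean \<mu>
    and variance 1 / \<kappa>; \<open>D\<close> collects the remaining constants. Hence exp (-
    \<phi>) has finite second moments.\<close>
  define p where "p = \<phi>' 0"
  define \<mu> where "\<mu> = - p / \<kappa>"
  define \<sigma> where "\<sigma> = 1 / sqrt \<kappa>"
  have s: "\<sigma> > 0" "\<sigma>\<^sup>2 = 1 / \<kappa>" using k by (auto simp: \<sigma>_def power_divide)
  define D where "D = exp (- \<phi> 0 + p\<^sup>2 / (2 * \<kappa>)) * sqrt (2 * pi * \<sigma>\<^sup>2)"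
  have D: "D \<ge> 0" by (simp add: D_def)
  have e: "exp (- \<phi> t) \<le> D * normal_density \<mu> \<sigma> t" for t
  proof -
    have "- \<phi> t \<le> - \<phi> 0 - p * t - \<kappa> / 2 * t\<^sup>2"
      using sconv_tangent[OF assms(1), of 0 t] by (simp add: p_def)
    also have "\<dots> = (- \<phi> 0 + p\<^sup>2 / (2 * \<kappa>)) + (- (t - \<mu>)\<^sup>2 / (2 * \<sigma>\<^sup>2))"
      using k unfolding s(2) by (simp add: \<mu>_def field_simps power2_eq_square)
    finally have "exp (- \<phi> t) \<le> exp (- \<phi> 0 + p\<^sup>2 / (2 * \<kappa>)) * exp (- (t - \<mu>)\<^sup>2 / (2 * \<sigma>\<^sup>2))"
      by (simp flip: exp_add)
    then show ?thesis
      using k s by (simp add: normal_density_def D_def)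
  qed
  show ?thesis
  proof (rule Bochner_Integration.integrable_bound)
    \<comment> \<open>The power \<open>(t - \<mu>)^0\<close> is kept so that both summands are
      instances of the lemma on normal moments.\<close>
    show "integrable lborel (\<lambda>t. (C * D) * ((1 + 2 * \<mu>\<^sup>2) * (normal_density \<mu> \<sigma> t * (t - \<mu>)^0)
        + 2 * (normal_density \<mu> \<sigma> t * (t - \<mu>)\<^sup>2)))"
      using s by (intro integrable_mult_right Bochner_Integration.integrable_add integrable_normal_moment)
    show "AE t in lborel. norm (exp (- \<phi> t) * f t) \<le> norm ((C * D) * ((1 + 2 * \<mu>\<^sup>2) * (normal_density \<mu> \<sigma> t * (t - \<mu>)^0)
        + 2 * (normal_density \<mu> \<sigma> t * (t - \<mu>)\<^sup>2)))"
    proof (rule AE_I2)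
      fix t
      have n: "normal_density \<mu> \<sigma> t \<ge> 0" by simp
      have "norm (exp (- \<phi> t) * f t) \<le> (D * normal_density \<mu> \<sigma> t) * (C * (1 + t\<^sup>2))"
        unfolding norm_mult using e[of t] g[of t] C D n by (intro mult_mono) auto
      also have "\<dots> = (C * D * normal_density \<mu> \<sigma> t) * (1 + t\<^sup>2)" by simp
      also have "1 + t\<^sup>2 \<le> 1 + 2 * \<mu>\<^sup>2 + 2 * (t - \<mu>)\<^sup>2"
        using zero_le_power2[of "t - 2 * \<mu>"] by (simp add: power2_eq_square algebra_simps)
      then have "(C * D * normal_density \<mu> \<sigma> t) * (1 + t\<^sup>2) \<le> (C * D * normal_density \<mu> \<sigma> t) * (1 + 2 * \<mu>\<^sup>2 + 2 * (t - \<mu>)\<^sup>2)"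
        using C D n by (intro mult_left_mono) auto
      also have "\<dots> = (C * D) * ((1 + 2 * \<mu>\<^sup>2) * (normal_density \<mu> \<sigma> t * (t - \<mu>)^0)
        + 2 * (normal_density \<mu> \<sigma> t * (t - \<mu>)\<^sup>2))" by (simp add: algebra_simps)
      finally show "norm (exp (- \<phi> t) * f t) \<le> norm ((C * D) * ((1 + 2 * \<mu>\<^sup>2) * (normal_density \<mu> \<sigma> t * (t - \<mu>)^0)
        + 2 * (normal_density \<mu> \<sigma> t * (t - \<mu>)\<^sup>2)))"
        by (metis abs_ge_self dual_order.trans real_norm_def)
    qed
  qed measurable
qed

section \<open>Normalized potentials and their probability measures\<close>

lemma potential_sconv: "potential \<kappa> M \<phi> \<Longrightarrow> sconv \<kappa> M \<phi> (deriv \<phi>)"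
  by (simp add: potential_def)

lemma potential_pos: "potential \<kappa> M \<phi> \<Longrightarrow> 0 < \<kappa>"
  by (simp add: potential_def sconv_def)

lemma potential_measurable: "potential \<kappa> M \<phi> \<Longrightarrow> \<phi> \<in> borel_measurable borel"
  by (intro borel_measurable_continuous_onI sconv_continuous[OF potential_sconv])

lemma potential_measurable': "potential \<kappa> M \<phi> \<Longrightarrow> deriv \<phi> \<in> borel_measurable borel"
  by (intro borel_measurable_continuous_onI sconv_continuous'[OF potential_sconv])

lemma sets_gibbs1[simp, measurable_cong]: "sets (gibbs1 \<phi>) = sets borel"
  by (simp add: gibbs1_def)

lemma space_gibbs1[simp]: "space (gibbs1 \<phi>) = UNIV"
  by (simp add: gibbs1_def)

lemma prob_space_gibbs1:
  assumes "potential \<kappa> M \<phi>" shows "prob_space (gibbs1 \<phi>)"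
proof
  have [measurable]: "\<phi> \<in> borel_measurable borel" using potential_measurable[OF assms] .
  show "emeasure (gibbs1 \<phi>) (space (gibbs1 \<phi>)) = 1"
    using assms by (simp add: gibbs1_def emeasure_density potential_def)
qed

lemma integral_gibbs1:
  assumes "potential \<kappa> M \<phi>" and [measurable]: "f \<in> borel_measurable borel"
  shows "(\<integral>x. f x \<partial>gibbs1 \<phi>) = (\<integral>x. exp (- \<phi> x) * f x \<partial>lborel)"
    and "integrable (gibbs1 \<phi>) f \<longleftrightarrow> integrable lborel (\<lambda>x. exp (- \<phi> x) * f x)"
proof -
  have [measurable]: "\<phi> \<in> borel_measurable borel" using potential_measurable[OF assms(1)] .
  show "(\<integral>x. f x \<partial>gibbs1 \<phi>) = (\<integral>x. exp (- \<phi> x) * f x \<partial>lborel)"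
    "integrable (gibbs1 \<phi>) f \<longleftrightarrow> integrable lborel (\<lambda>x. exp (- \<phi> x) * f x)"
    by (simp_all add: gibbs1_def integral_real_density integrable_real_density)
qed

lemma potential_integrable:
  assumes "potential \<kappa> M \<phi>" "f \<in> borel_measurable borel" "\<And>t. \<bar>f t\<bar> \<le> C * (1 + t\<^sup>2)"
  shows "integrable (gibbs1 \<phi>) f"
  unfolding integral_gibbs1(2)[OF assms(1,2)]
  using sconv_integrable[OF potential_sconv[OF assms(1)] assms(2,3)] .

text \<open>A bridge from Bochner integrals on the line to gauge integrals on intervals, where the
  fundamental theorem of calculus is applied.\<close>

lemma tendsto_integral_Icc:
  fixes f :: "real \<Rightarrow> real"
  assumes f: "integrable lborel f"
  shows "(\<lambda>n. integral {- real n..real n} f) \<longlonglongrightarrow> (\<integral>x. f x \<partial>lborel)"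
    and "f integrable_on {- real n..real n}"
proof -
  have s: "set_integrable lborel {- real n..real n} f" for n
    unfolding set_integrable_def using f by (intro integrable_mult_indicator) auto
  show "f integrable_on {- real n..real n}" using set_borel_integral_eq_integral(1)[OF s] .
  have "(\<lambda>n. \<integral>x. indicator {- real n..real n} x *\<^sub>R f x \<partial>lborel) \<longlonglongrightarrow> (\<integral>x. f x \<partial>lborel)"
  proof (rule integral_dominated_convergence[where w="\<lambda>x. norm (f x)"])
    show "AE x in lborel. (\<lambda>n. indicator {- real n..real n} x *\<^sub>R f x) \<longlonglongrightarrow> f x"
    proof (rule AE_I2)
      fix x
      obtain N where N: "\<bar>x\<bar> \<le> real N" using real_arch_simple by blast
      have "\<forall>\<^sub>F n in sequentially. indicator {- real n..real n} x *\<^sub>R f x = f x"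
        using eventually_ge_at_top[of N]
      proof eventually_elim
        case (elim n)
        then have "x \<in> {- real n..real n}" using N by auto
        then show ?case by simp
      qed
      then show "(\<lambda>n. indicator {- real n..real n} x *\<^sub>R f x) \<longlonglongrightarrow> f x"
        by (rule tendsto_eventually)
    qed
  qed (use f in \<open>auto simp: indicator_def\<close>)
  moreover have "(\<integral>x. indicator {- real n..real n} x *\<^sub>R f x \<partial>lborel) = integral {- real n..real n} f" for n
    using set_borel_integral_eq_integral(2)[OF s] by (simp add: set_lebesgue_integral_def)
  ultimately show "(\<lambda>n. integral {- real n..real n} f) \<longlonglongrightarrow> (\<integral>x. f x \<partial>lborel)" by simp
qed

section \<open>The tangent inequality and the Poincare inequality on the line\<close>

text \<open>Monotone transport on a bounded interval fixes both endpoints, so the integration by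
  parts has no boundary terms and no decay at infinity enters. The mass is at most 1 because exp (-
  \<phi>) will be a truncated probability density.\<close>

lemma transport_interval:
  fixes \<phi> \<phi>' m W :: "real \<Rightarrow> real"
  assumes N: "0 < N" and d\<phi>: "\<And>t. (\<phi> has_real_derivative \<phi>' t) (at t)"
    and m: "continuous_on UNIV m"
    and le: "\<And>x y. \<phi> x + \<phi>' x * (y - x) - W x \<le> m y"
    and mass: "integral {-N..N} (\<lambda>x. exp (- \<phi> x)) \<le> 1"
    and W: "(\<lambda>x. exp (- \<phi> x) * W x) integrable_on {-N..N}"
  shows "ln (integral {-N..N} (\<lambda>y. exp (- m y))) * integral {-N..N} (\<lambda>x. exp (- \<phi> x))
     \<le> integral {-N..N} (\<lambda>x. exp (- \<phi> x) * W x)"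
proof -
  define I where "I = {-N..N}"
  define q where "q x = exp (- \<phi> x)" for x
  define k where "k x = exp (- m x)" for x
  have pos: "q x > 0" "k x > 0" for x by (auto simp: q_def k_def)
  have \<phi>c: "continuous_on S \<phi>" for S
    by (intro continuous_at_imp_continuous_on ballI DERIV_isCont[OF d\<phi>])
  have kc: "continuous_on S k" for S
    unfolding k_def using m by (intro continuous_intros) (auto intro: continuous_on_subset)
  have qc: "continuous_on S q" for S
    unfolding q_def by (intro continuous_intros \<phi>c)
  define G where "G y = integral {-N..y} k" for y
  define Q where "Q y = integral {-N..y} q" for y
  have dG': "(G has_real_derivative k t) (at t within {-N..N})" if "t \<in> {-N..N}" for t
    unfolding G_def by (rule integral_has_real_derivative[OF kc that])
  have dQ': "(Q has_real_derivative q t) (at t within {-N..N})" if "t \<in> {-N..N}" for t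
    unfolding Q_def by (rule integral_has_real_derivative[OF qc that])
  have dG: "(G has_real_derivative k t) (at t)" if "t \<in> {-N<..<N}" for t
    using dG'[of t] that at_within_Icc_at[of "-N" t N] by auto
  have dQ: "(Q has_real_derivative q t) (at t)" if "t \<in> {-N<..<N}" for t
    using dQ'[of t] that at_within_Icc_at[of "-N" t N] by auto
  have Gc: "continuous_on {-N..N} G" using dG' by (rule DERIV_continuous_on)
  have Qc: "continuous_on {-N..N} Q" using dQ' by (rule DERIV_continuous_on)
  have Gmono: "G x < G y" if "-N \<le> x" "x < y" "y \<le> N" for x y
  proof (rule DERIV_pos_imp_increasing_open[OF that(2)])
    show "\<exists>z. (G has_real_derivative z) (at t) \<and> 0 < z" if "x < t" "t < y" for t
      using dG[of t] pos(2)[of t] that \<open>-N \<le> x\<close> \<open>y \<le> N\<close> by auto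
    show "continuous_on {x..y} G" using Gc that by (auto intro: continuous_on_subset)
  qed
  have Qmono: "Q x < Q y" if "-N \<le> x" "x < y" "y \<le> N" for x y
  proof (rule DERIV_pos_imp_increasing_open[OF that(2)])
    show "\<exists>z. (Q has_real_derivative z) (at t) \<and> 0 < z" if "x < t" "t < y" for t
      using dQ[of t] pos(1)[of t] that \<open>-N \<le> x\<close> \<open>y \<le> N\<close> by auto
    show "continuous_on {x..y} Q" using Qc that by (auto intro: continuous_on_subset)
  qed
  define C where "C = G N"
  define c where "c = Q N"
  have G0: "G (-N) = 0" and Q0: "Q (-N) = 0" by (auto simp: G_def Q_def)
  have C: "C > 0" using Gmono[of "-N" N] N G0 by (auto simp: C_def)
  have c: "c > 0" using Qmono[of "-N" N] N Q0 by (auto simp: c_def)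
  have c1: "c \<le> 1" using mass unfolding c_def Q_def q_def[abs_def] .
  have Ginj: "inj_on G {-N..N}"
  proof (rule inj_onI)
    fix x y assume "x \<in> {-N..N}" "y \<in> {-N..N}" "G x = G y"
    then show "x = y" using Gmono[of x y] Gmono[of y x] by (cases x y rule: linorder_cases) auto
  qed
  have Gim: "G ` {-N..N} = {0..C}"
  proof
    show "G ` {-N..N} \<subseteq> {0..C}"
    proof
      fix u assume "u \<in> G ` {-N..N}"
      then obtain x where x: "x \<in> {-N..N}" "u = G x" by auto
      then show "u \<in> {0..C}"
        using Gmono[of "-N" x] Gmono[of x N] G0 C
        by (cases "x = -N"; cases "x = N") (auto simp: C_def)
    qed
    show "{0..C} \<subseteq> G ` {-N..N}"
    proof
      fix u assume "u \<in> {0..C}"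
      then have "\<exists>x\<ge>-N. x \<le> N \<and> G x = u"
        using N Gc G0 by (intro IVT') (auto simp: C_def)
      then show "u \<in> G ` {-N..N}" by auto
    qed
  qed
  define g where "g = inv_into {-N..N} G"
  have gG: "g (G x) = x" if "x \<in> {-N..N}" for x
    using Ginj that by (simp add: g_def)
  have Gg: "G (g u) = u" if "u \<in> {0..C}" for u
    using that Gim by (auto simp: g_def f_inv_into_f)
  have gin: "g u \<in> {-N..N}" if "u \<in> {0..C}" for u
    using that Gim unfolding g_def by (metis inv_into_into)
  have gc: "continuous_on {0..C} g"
    using continuous_on_inv[OF Gc compact_Icc, of g] gG Gim by auto
  have gin': "g u \<in> {-N<..<N}" if "u \<in> {0<..<C}" for u
  proof -
    have "g u \<noteq> -N" "g u \<noteq> N" using Gg[of u] that G0 by (auto simp: C_def)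
    then show ?thesis using gin[of u] that by auto
  qed
  have dg: "(g has_real_derivative inverse (k (g u))) (at u)" if "u \<in> {0<..<C}" for u
  proof (rule DERIV_inverse_function[where f=G and a=0 and b=C])
    show "(G has_real_derivative k (g u)) (at (g u))" using dG gin'[OF that] by auto
    show "k (g u) \<noteq> 0" using pos(2)[of "g u"] by simp
    show "isCont g u" using continuous_on_interior[OF gc, of u] that by auto
  qed (use that Gg in auto)
  \<comment> \<open>\<open>T\<close> transports the density \<open>q / c\<close> on \<open>{-N..N}\<close> to \<open>k / C\<close>. It fixes both endpoints, so \<open>((T x - x) q x)'\<close>
    integrates to \<open>0\<close>.\<close>
  define T where "T x = g (C / c * Q x)" for x
  have Qin: "C / c * Q x \<in> {0..C}" if "x \<in> {-N..N}" for x
  proof -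
    have "0 \<le> Q x \<and> Q x \<le> c"
      using Qmono[of "-N" x] Qmono[of x N] Q0 c that
      by (cases "x = -N"; cases "x = N") (auto simp: c_def)
    then show ?thesis using C c by (auto simp: field_simps)
  qed
  have Qin': "C / c * Q x \<in> {0<..<C}" if "x \<in> {-N<..<N}" for x
  proof -
    have "0 < Q x \<and> Q x < c"
      using Qmono[of "-N" x] Qmono[of x N] Q0 c that by (auto simp: c_def)
    then show ?thesis using C c by (auto simp: field_simps)
  qed
  have Tc: "continuous_on {-N..N} T"
    unfolding T_def
    by (rule continuous_on_compose2[OF gc]) (use Qin c in \<open>auto intro!: continuous_intros Qc simp del: atLeastAtMost_iff\<close>)
  define T' where "T' x = inverse (k (T x)) * (C / c * q x)" for x
  have dT: "(T has_real_derivative T' x) (at x)" if "x \<in> {-N<..<N}" for x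
    unfolding T_def T'_def
    by (rule DERIV_chain2[where f=g and g="\<lambda>x. C / c * Q x", OF dg[OF Qin'[OF that]]])
       (use dQ[OF that] c in \<open>auto intro!: derivative_eq_intros\<close>)
  have TN: "T N = N" "T (-N) = -N"
    using gG[of N] gG[of "-N"] N c Q0 G0 by (auto simp: T_def C_def c_def)
  define \<Psi> where "\<Psi> x = (T x - x) * q x" for x
  define \<Psi>' where "\<Psi>' x = (T' x - 1) * q x - (T x - x) * \<phi>' x * q x" for x
  have dq: "(q has_real_derivative - \<phi>' x * q x) (at x)" for x
    unfolding q_def by (auto intro!: derivative_eq_intros d\<phi>)
  have "(\<Psi>' has_integral \<Psi> N - \<Psi> (-N)) {-N..N}"
  proof (rule fundamental_theorem_of_calculus_interior)
    show "-N \<le> N" using N by simp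
    show "continuous_on {-N..N} \<Psi>" unfolding \<Psi>_def by (intro continuous_intros Tc qc)
    show "(\<Psi> has_vector_derivative \<Psi>' x) (at x)" if "x \<in> {-N<..<N}" for x
      unfolding has_real_derivative_iff_has_vector_derivative[symmetric] \<Psi>_def \<Psi>'_def
      by (auto intro!: derivative_eq_intros dT[OF that] dq simp: algebra_simps)
  qed
  then have I\<Psi>: "(\<Psi>' has_integral 0) {-N..N}" by (simp add: \<Psi>_def TN)
  have Iq: "(q has_integral c) {-N..N}"
    unfolding c_def Q_def by (intro integrable_integral integrable_continuous_real qc)
  have IW: "((\<lambda>x. q x * W x) has_integral integral {-N..N} (\<lambda>x. q x * W x)) {-N..N}"
    using W unfolding q_def by (rule integrable_integral)
  \<comment> \<open>Take logarithms in \<open>T' x * k (T x) = C / c * q x\<close>, insert the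
    hypothesis at \<open>y = T x\<close> and use ln z \<le> z - 1. Since \<open>c \<le> 1\<close>,
    the term \<open>ln c\<close> has the sign that lets it be dropped.\<close>
  have pw: "ln C * q x - q x * W x \<le> \<Psi>' x" for x
  proof -
    have p: "T' x > 0" using pos C c by (simp add: T'_def)
    have "ln (T' x) = m (T x) + (ln C - ln c - \<phi> x)"
      using C c by (simp add: T'_def k_def q_def ln_mult ln_div ln_inverse flip: exp_minus)
    moreover have "ln c \<le> 0" using c c1 by simp
    moreover have "ln (T' x) \<le> T' x - 1" using ln_le_minus_one[OF p] .
    ultimately have "ln C - W x \<le> T' x - 1 - (T x - x) * \<phi>' x"
      using le[of x "T x"] by (simp add: algebra_simps)
    from mult_right_mono[OF this, of "q x"] pos(1)[of x] show ?thesis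
      by (simp add: \<Psi>'_def algebra_simps)
  qed
  have "ln C * c - integral {-N..N} (\<lambda>x. q x * W x) \<le> 0"
    by (rule has_integral_le[OF has_integral_diff[OF has_integral_mult_right[OF Iq] IW] I\<Psi>]) (rule pw)
  then show ?thesis unfolding C_def c_def G_def Q_def q_def[abs_def] k_def[abs_def] by simp
qed

text \<open>Sharp for \<open>E y = exp (- \<phi> y)\<close> and \<open>W = 0\<close>: the hypothesis
  is then convexity of \<phi> and both sides equal 1.\<close>

lemma tangent_1d:
  assumes pot: "potential \<kappa> M \<phi>" and W: "integrable (gibbs1 \<phi>) W"
    and E: "\<And>y. 0 < E y"
    and le: "\<And>x y. E y \<le> exp (W x - \<phi> x - deriv \<phi> x * (y - x))"
  shows "(\<integral>\<^sup>+y. ennreal (E y) \<partial>lborel) \<le> ennreal (exp (\<integral>x. W x \<partial>gibbs1 \<phi>))"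
proof -
  note sc = potential_sconv[OF pot]
  have Wm: "W \<in> borel_measurable borel" 
    using borel_measurable_integrable[OF W] by (simp cong: measurable_cong_sets)
  have \<phi>c: "continuous_on S \<phi>" for S by (rule sconv_continuous[OF sc])
  define F where "F x y = \<phi> x + deriv \<phi> x * (y - x) - W x" for x y
  have Fle: "F x y \<le> - ln (E y)" for x y
  proof -
    have "ln (E y) \<le> ln (exp (W x - \<phi> x - deriv \<phi> x * (y - x)))"
      using le E by (subst ln_le_cancel_iff) auto
    then show ?thesis by (simp add: F_def)
  qed
  \<comment> \<open>The largest function allowed by the hypothesis is exp (- m). As a supremum of
    affine functions of \<open>y\<close>, \<open>m\<close> is convex and therefore continuous, which
    supplies the regularity that \<open>E\<close> itself may lack.\<close>
  define m where "m y = (SUP x. F x y)" for y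
  have bdd: "bdd_above (range (\<lambda>x. F x y))" for y using Fle by (auto intro!: bdd_aboveI)
  have Fm: "F x y \<le> m y" for x y unfolding m_def by (rule cSUP_upper[OF _ bdd]) simp
  have mE: "m y \<le> - ln (E y)" for y unfolding m_def by (rule cSUP_least) (use Fle in auto)
  have "convex_on UNIV m"
  proof (rule convex_onI)
    fix t x y :: real assume t: "0 < t" "t < 1"
    show "m ((1 - t) *\<^sub>R x + t *\<^sub>R y) \<le> (1 - t) * m x + t * m y"
      unfolding m_def[of "(1 - t) *\<^sub>R x + t *\<^sub>R y"]
    proof (rule cSUP_least)
      fix s
      have "F s ((1 - t) *\<^sub>R x + t *\<^sub>R y) = (1 - t) * F s x + t * F s y"
        by (simp add: F_def algebra_simps)
      also have "\<dots> \<le> (1 - t) * m x + t * m y"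
        using t Fm by (intro add_mono mult_left_mono) auto
      finally show "F s ((1 - t) *\<^sub>R x + t *\<^sub>R y) \<le> (1 - t) * m x + t * m y" .
    qed simp
  qed simp
  then have mc: "continuous_on UNIV m" using convex_on_continuous by blast
  then have [measurable]: "m \<in> borel_measurable borel" by (rule borel_measurable_continuous_onI)
  define C where "C n = integral {-real n..real n} (\<lambda>y. exp (- m y))" for n
  define c where "c n = integral {-real n..real n} (\<lambda>y. exp (- \<phi> y))" for n
  define w where "w n = integral {-real n..real n} (\<lambda>y. exp (- \<phi> y) * W y)" for n
  have Wi: "integrable lborel (\<lambda>x. exp (- \<phi> x) * W x)"
    using W integral_gibbs1(2)[OF pot Wm] by simp
  have wlim: "w \<longlonglongrightarrow> (\<integral>x. W x \<partial>gibbs1 \<phi>)"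
    using tendsto_integral_Icc(1)[OF Wi] integral_gibbs1(1)[OF pot Wm] by (simp add: w_def[abs_def])
  have qi: "integrable lborel (\<lambda>x. exp (- \<phi> x))"
    using sconv_integrable[OF sc, of "\<lambda>_. 1" 1] by simp
  have q1: "(\<integral>x. exp (- \<phi> x) \<partial>lborel) = 1"
  proof -
    have "ennreal (\<integral>x. exp (- \<phi> x) \<partial>lborel) = 1"
      using nn_integral_eq_integral[OF qi] pot by (simp add: potential_def)
    then show ?thesis by simp
  qed
  have clim: "c \<longlonglongrightarrow> 1"
    using tendsto_integral_Icc(1)[OF qi] q1 by (simp add: c_def[abs_def])
  have c1: "c n \<le> 1" for n
  proof -
    have s: "set_integrable lborel {-real n..real n} (\<lambda>x. exp (- \<phi> x))"
      unfolding set_integrable_def using qi by (intro integrable_mult_indicator) auto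
    have "c n = (\<integral>x. indicator {-real n..real n} x *\<^sub>R exp (- \<phi> x) \<partial>lborel)"
      using set_borel_integral_eq_integral(2)[OF s] by (simp add: c_def set_lebesgue_integral_def)
    also have "\<dots> \<le> (\<integral>x. exp (- \<phi> x) \<partial>lborel)"
      using s qi by (intro integral_mono) (auto simp: set_integrable_def indicator_def)
    finally show ?thesis using q1 by simp
  qed
  have key: "ln (C n) * c n \<le> w n" if "n > 0" for n
    unfolding C_def c_def w_def
    using that c1[of n] Fm tendsto_integral_Icc(2)[OF Wi]
    by (intro transport_interval[where \<phi>'="deriv \<phi>"] sconv_DERIV[OF sc] mc) (auto simp: c_def F_def)
  have mi: "set_integrable lborel {-real n..real n} (\<lambda>y. exp (- m y))" for n
    by (intro borel_integrable_atLeastAtMost' continuous_intros continuous_on_subset[OF mc]) auto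
  have nnC: "(\<integral>\<^sup>+y. ennreal (exp (- m y)) * indicator {-real n..real n} y \<partial>lborel) = ennreal (C n)" for n
  proof -
    have "(\<integral>\<^sup>+y. ennreal (exp (- m y)) * indicator {-real n..real n} y \<partial>lborel)
       = (\<integral>\<^sup>+y. ennreal (indicator {-real n..real n} y *\<^sub>R exp (- m y)) \<partial>lborel)"
      by (intro nn_integral_cong) (auto simp: indicator_def)
    also have "\<dots> = ennreal (C n)"
      using mi[of n] set_borel_integral_eq_integral(2)[OF mi[of n]]
      by (subst nn_integral_eq_integral) (auto simp: set_integrable_def C_def set_lebesgue_integral_def)
    finally show ?thesis .
  qed
  have Clim: "(\<lambda>n. ennreal (C n)) \<longlonglongrightarrow> (\<integral>\<^sup>+y. ennreal (exp (- m y)) \<partial>lborel)"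
    unfolding nnC[symmetric]
  proof (rule nn_integral_LIMSEQ)
    show "incseq (\<lambda>n y. ennreal (exp (- m y)) * indicator {-real n..real n} y)"
      by (auto simp: incseq_def le_fun_def indicator_def)
    fix y
    obtain K where K: "\<bar>y\<bar> \<le> real K" using real_arch_simple by blast
    show "(\<lambda>n. ennreal (exp (- m y)) * indicator {-real n..real n} y) \<longlonglongrightarrow> ennreal (exp (- m y))"
    proof (rule tendsto_eventually)
      show "\<forall>\<^sub>F n in sequentially. ennreal (exp (- m y)) * indicator {-real n..real n} y = ennreal (exp (- m y))"
        using eventually_ge_at_top[of K]
      proof eventually_elim
        case (elim n)
        then have "y \<in> {- real n..real n}" using K by auto
        then show ?case by simp
      qed
    qed
  qed measurable
  have blim: "(\<lambda>n. ennreal (exp (w n / c n))) \<longlonglongrightarrow> ennreal (exp ((\<integral>x. W x \<partial>gibbs1 \<phi>) / 1))"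
    by (intro tendsto_ennrealI tendsto_exp tendsto_divide wlim clim) simp
  have "(\<integral>\<^sup>+y. ennreal (exp (- m y)) \<partial>lborel) \<le> ennreal (exp ((\<integral>x. W x \<partial>gibbs1 \<phi>) / 1))"
  proof (rule tendsto_le[OF _ blim Clim])
    have "\<forall>\<^sub>F n in sequentially. c n > 0" using clim by (rule order_tendstoD) simp
    then show "\<forall>\<^sub>F n in sequentially. ennreal (C n) \<le> ennreal (exp (w n / c n))"
      using eventually_gt_at_top[of 0]
    proof eventually_elim
      case (elim n)
      have "C n \<le> exp (w n / c n)"
      proof (cases "C n > 0")
        case True
        have "ln (C n) \<le> w n / c n" using key[of n] elim by (simp add: field_simps)
        then show ?thesis using True by (metis exp_le_cancel_iff exp_ln)
      next
        case False
        then show ?thesis using exp_ge_zero[of "w n / c n"] by linarith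
      qed
      then show ?case by (rule ennreal_leI)
    qed
  qed simp
  moreover have "(\<integral>\<^sup>+y. ennreal (E y) \<partial>lborel) \<le> (\<integral>\<^sup>+y. ennreal (exp (- m y)) \<partial>lborel)"
  proof (intro nn_integral_mono ennreal_leI)
    fix y
    have "E y = exp (ln (E y))" using E by simp
    also have "\<dots> \<le> exp (- m y)" using mE[of y] by simp
    finally show "E y \<le> exp (- m y)" .
  qed
  ultimately show ?thesis by simp
qed

section \<open>The Poincare inequality on the line\<close>

lemma potential_critical_point:
  assumes "potential \<kappa> M \<phi>"
  shows "\<exists>m. deriv \<phi> m = 0"
proof -
  note sc = potential_sconv[OF assms]
  have k: "\<kappa> > 0" using potential_pos[OF assms] .
  \<comment> \<open>The derivative of \<phi> grows at rate at least \<kappa>, so it changes sign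
    between \<open>- r\<close> and \<open>r\<close>.\<close>
  define r where "r = \<bar>deriv \<phi> 0\<bar> / \<kappa>"
  have r: "r \<ge> 0" "\<kappa> * r = \<bar>deriv \<phi> 0\<bar>" using k by (auto simp: r_def)
  have "\<kappa> * (r - 0) \<le> deriv \<phi> r - deriv \<phi> 0" "\<kappa> * (0 - (- r)) \<le> deriv \<phi> 0 - deriv \<phi> (- r)"
    using sc r(1) unfolding sconv_def by (meson neg_le_0_iff_le)+
  then have "deriv \<phi> (- r) \<le> 0" "0 \<le> deriv \<phi> r" using r by auto
  then show ?thesis
    using IVT'[of "deriv \<phi>" "- r" 0 r] r sconv_continuous'[OF sc] by force
qed

text \<open>A Hardy-type argument around the mode \<open>m\<close> of the density: there
  \<open>deriv \<phi> x * (x - m)\<close> is at least \<open>\<kappa> * (x - m)\<^sup>2\<close>. It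
  bounds the second moment of \<open>f - f m\<close>, which dominates the variance because the mean
  is the best constant. The bound on \<open>f'\<close> makes \<open>f\<close> grow at most linearly
  and hence square integrable.\<close>

lemma poincare_1d:
  assumes pot: "potential \<kappa> M \<phi>"
    and f: "\<And>t. (f has_real_derivative f' t) (at t)" and f'c: "continuous_on UNIV f'"
    and L: "\<And>t. \<bar>f' t\<bar> \<le> L"
  shows "(\<integral>x. (f x)\<^sup>2 \<partial>gibbs1 \<phi>) \<le> (\<integral>x. f x \<partial>gibbs1 \<phi>)\<^sup>2 + (1 / \<kappa>) * (\<integral>x. (f' x)\<^sup>2 \<partial>gibbs1 \<phi>)"
proof -
  note sc = potential_sconv[OF pot]
  have k: "\<kappa> > 0" using potential_pos[OF pot] .
  obtain m where m: "deriv \<phi> m = 0" using potential_critical_point[OF pot] by blast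
  have fc: "continuous_on S f" for S
    by (intro continuous_at_imp_continuous_on ballI DERIV_isCont[OF f])
  have [measurable]: "f \<in> borel_measurable borel" "f' \<in> borel_measurable borel"
    using fc f'c by (auto intro: borel_measurable_continuous_onI)
  have L0: "L \<ge> 0" using L[of 0] by linarith
  have lip: "\<bar>f x - f y\<bar> \<le> L * \<bar>x - y\<bar>" for x y
    using field_differentiable_bound[of UNIV f f' L x y] f L by auto
  have fg: "\<bar>f t\<bar> \<le> (\<bar>f 0\<bar> + L) * (1 + \<bar>t\<bar>)" for t
  proof -
    have "\<bar>f t\<bar> \<le> \<bar>f 0\<bar> + L * \<bar>t\<bar>" using lip[of t 0] by simp
    moreover have "0 \<le> \<bar>f 0\<bar> * \<bar>t\<bar>" by simp
    moreover have "(\<bar>f 0\<bar> + L) * (1 + \<bar>t\<bar>) = \<bar>f 0\<bar> + L * \<bar>t\<bar> + L + \<bar>f 0\<bar> * \<bar>t\<bar>"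
      by (simp add: algebra_simps)
    ultimately show ?thesis using L0 by linarith
  qed
  have sq: "(1 + \<bar>t\<bar>)\<^sup>2 \<le> 2 * (1 + t\<^sup>2)" for t :: real
    using zero_le_power2[of "1 - \<bar>t\<bar>"] by (simp add: power2_eq_square algebra_simps)
  have fg2: "\<bar>(f t)\<^sup>2\<bar> \<le> (2 * (\<bar>f 0\<bar> + L)\<^sup>2) * (1 + t\<^sup>2)" for t
  proof -
    have "\<bar>(f t)\<^sup>2\<bar> = \<bar>f t\<bar>\<^sup>2" by simp
    also have "\<dots> \<le> ((\<bar>f 0\<bar> + L) * (1 + \<bar>t\<bar>))\<^sup>2" using fg by (intro power_mono) auto
    also have "\<dots> = (\<bar>f 0\<bar> + L)\<^sup>2 * (1 + \<bar>t\<bar>)\<^sup>2" by (simp add: power_mult_distrib)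
    also have "\<dots> \<le> (\<bar>f 0\<bar> + L)\<^sup>2 * (2 * (1 + t\<^sup>2))" by (intro mult_left_mono sq) auto
    finally show ?thesis by (simp only: mult.assoc mult.left_commute[of _ 2])
  qed
  have fi2: "integrable (gibbs1 \<phi>) (\<lambda>x. (f x)\<^sup>2)"
    by (rule potential_integrable[OF pot _ fg2]) measurable
  interpret prob_space "gibbs1 \<phi>" by (rule prob_space_gibbs1[OF pot])
  have fi: "integrable (gibbs1 \<phi>) f"
    by (rule square_integrable_imp_integrable[OF _ fi2]) measurable
  have f'i: "integrable (gibbs1 \<phi>) (\<lambda>x. (f' x)\<^sup>2)"
  proof (rule potential_integrable[OF pot, of _ "L\<^sup>2"])
    fix t
    have "\<bar>(f' t)\<^sup>2\<bar> = \<bar>f' t\<bar>\<^sup>2" by simp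
    also have "\<dots> \<le> L\<^sup>2" using L by (intro power_mono) auto
    also have "\<dots> \<le> L\<^sup>2 * (1 + t\<^sup>2)" by (simp add: algebra_simps)
    finally show "\<bar>(f' t)\<^sup>2\<bar> \<le> L\<^sup>2 * (1 + t\<^sup>2)" .
  qed measurable
  define h where "h x = f x - f m" for x
  have hi: "integrable (gibbs1 \<phi>) (\<lambda>x. (h x)\<^sup>2)"
    unfolding h_def power2_diff using fi fi2 by (intro Bochner_Integration.integrable_add Bochner_Integration.integrable_diff) auto
  define q where "q x = exp (- \<phi> x)" for x
  have qc: "continuous_on S q" for S
    unfolding q_def by (intro continuous_intros sconv_continuous[OF sc])
  have q0: "q x > 0" for x by (simp add: q_def)
  have dq: "(q has_real_derivative - deriv \<phi> x * q x) (at x)" for x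
    unfolding q_def by (auto intro!: derivative_eq_intros sconv_DERIV[OF sc])
  define D where "D x = \<kappa> * (h x)\<^sup>2 - (f' x)\<^sup>2" for x
  have Di: "integrable (gibbs1 \<phi>) D" unfolding D_def using hi f'i by auto
  have [measurable]: "D \<in> borel_measurable borel" unfolding D_def h_def by measurable
  have Di': "integrable lborel (\<lambda>x. q x * D x)"
    using Di integral_gibbs1(2)[OF pot, of D] by (simp add: q_def)
  \<comment> \<open>\<open>\<Psi>\<close> is continuous at \<open>m\<close> with value \<open>0\<close> (by \<open>x / 0 = 0\<close>), \<open>\<Psi>' \<ge> q D\<close>, and \<open>\<Psi>\<close> changes sign at \<open>m\<close>, so its
    increment over an interval around \<open>m\<close> is at most \<open>0\<close>.\<close>
  define \<Psi> where "\<Psi> x = - ((h x)\<^sup>2 / (x - m)) * q x" for x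
  \<comment> \<open>The value at \<open>m\<close> is chosen so that
    \<open>q x * D x \<le> \<Psi>' x\<close> also holds there; the fundamental theorem of calculus
    is applied with \<open>m\<close> as an exceptional point.\<close>
  define \<Psi>' where "\<Psi>' x = (if x = m then q x * D x else
     (- (2 * h x * f' x / (x - m)) + (h x)\<^sup>2 / (x - m)\<^sup>2 + (h x)\<^sup>2 / (x - m) * deriv \<phi> x) * q x)" for x
  have pw: "q x * D x \<le> \<Psi>' x" for x
  proof (cases "x = m")
    case False
    have s: "\<kappa> * (x - m)\<^sup>2 \<le> deriv \<phi> x * (x - m)"
    proof (cases "m \<le> x")
      case True
      then have "\<kappa> * (x - m) \<le> deriv \<phi> x" using sc m unfolding sconv_def by fastforce
      from mult_right_mono[OF this, of "x - m"] True show ?thesis by (simp add: power2_eq_square mult.assoc)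
    next
      case False
      then have "\<kappa> * (m - x) \<le> - deriv \<phi> x" using sc m unfolding sconv_def
        by (metis diff_0 linorder_le_cases)
      from mult_right_mono[OF this, of "m - x"] False show ?thesis by (simp add: power2_eq_square algebra_simps)
    qed
    define r where "r = h x / (x - m)"
    have hr: "h x = r * (x - m)" using False by (simp add: r_def)
    have "\<kappa> * (h x)\<^sup>2 \<le> (h x)\<^sup>2 / (x - m) * deriv \<phi> x"
    proof -
      have "r\<^sup>2 * (\<kappa> * (x - m)\<^sup>2) \<le> r\<^sup>2 * (deriv \<phi> x * (x - m))" by (intro mult_left_mono s) auto
      moreover have "(h x)\<^sup>2 / (x - m) = r\<^sup>2 * (x - m)" using False by (simp add: hr power2_eq_square)
      ultimately show ?thesis by (simp add: hr power_mult_distrib mult_ac)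
    qed
    moreover have "- (f' x)\<^sup>2 \<le> - (2 * h x * f' x / (x - m)) + (h x)\<^sup>2 / (x - m)\<^sup>2"
    proof -
      have "0 \<le> (r - f' x)\<^sup>2" by simp
      moreover have "(h x)\<^sup>2 / (x - m)\<^sup>2 = r\<^sup>2" "2 * h x * f' x / (x - m) = 2 * r * f' x"
      using False by (simp_all add: hr power_mult_distrib)
      ultimately show ?thesis unfolding power2_diff by linarith
    qed
    ultimately have "D x \<le> - (2 * h x * f' x / (x - m)) + (h x)\<^sup>2 / (x - m)\<^sup>2 + (h x)\<^sup>2 / (x - m) * deriv \<phi> x"
      by (simp add: D_def)
    from mult_right_mono[OF this, of "q x"] q0[of x] show ?thesis using False by (simp add: \<Psi>'_def mult.commute)
  qed (simp add: \<Psi>'_def)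
  have d\<Psi>: "(\<Psi> has_real_derivative \<Psi>' x) (at x)" if "x \<noteq> m" for x
  proof -
    have dh: "(h has_real_derivative f' x) (at x)"
      unfolding h_def by (auto intro!: derivative_eq_intros f)
    have "((\<lambda>x. (h x)\<^sup>2 / (x - m)) has_real_derivative
        (2 * h x * f' x * (x - m) - (h x)\<^sup>2) / ((x - m) * (x - m))) (at x)"
      using that by (auto intro!: derivative_eq_intros dh)
    also have "(2 * h x * f' x * (x - m) - (h x)\<^sup>2) / ((x - m) * (x - m))
       = 2 * h x * f' x / (x - m) - (h x)\<^sup>2 / (x - m)\<^sup>2"
      using that by (simp add: diff_divide_distrib power2_eq_square)
    finally have du: "((\<lambda>x. (h x)\<^sup>2 / (x - m)) has_real_derivative
        2 * h x * f' x / (x - m) - (h x)\<^sup>2 / (x - m)\<^sup>2) (at x)" .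
    show ?thesis
      unfolding \<Psi>_def using that DERIV_mult[OF DERIV_minus[OF du] dq[of x]]
      by (simp add: \<Psi>'_def algebra_simps)
  qed
  have cm: "isCont \<Psi> m"
  proof -
    have "((\<lambda>x. L\<^sup>2 * \<bar>x - m\<bar> * q x) \<longlongrightarrow> L\<^sup>2 * \<bar>m - m\<bar> * q m) (at m)"
      using qc[of UNIV] by (intro tendsto_intros) (auto simp: continuous_on_eq_continuous_at isCont_def)
    then have l: "((\<lambda>x. L\<^sup>2 * \<bar>x - m\<bar> * q x) \<longlongrightarrow> 0) (at m)" by simp
    have "(\<Psi> \<longlongrightarrow> 0) (at m)"
    proof (rule Lim_null_comparison[OF _ l], rule always_eventually, rule allI)
      fix x
      have "\<bar>h x\<bar>\<^sup>2 \<le> (L * \<bar>x - m\<bar>)\<^sup>2" unfolding h_def by (intro power_mono lip) auto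
      then have *: "(h x)\<^sup>2 \<le> L\<^sup>2 * \<bar>x - m\<bar> * \<bar>x - m\<bar>" by (simp add: power2_eq_square algebra_simps)
      have "norm (\<Psi> x) = (h x)\<^sup>2 / \<bar>x - m\<bar> * q x" using q0[of x] by (simp add: \<Psi>_def abs_mult)
      also have "\<dots> \<le> L\<^sup>2 * \<bar>x - m\<bar> * q x"
        using q0[of x] * by (intro mult_right_mono) (auto simp: divide_le_eq)
      finally show "norm (\<Psi> x) \<le> L\<^sup>2 * \<bar>x - m\<bar> * q x" .
    qed
    then show ?thesis by (simp add: isCont_def \<Psi>_def)
  qed
  have \<Psi>c: "continuous_on S \<Psi>" for S
  proof (rule continuous_at_imp_continuous_on, rule ballI)
    fix x show "isCont \<Psi> x" using cm DERIV_isCont[OF d\<Psi>[of x]] by (cases "x = m") auto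
  qed
  have le0: "integral {- real n..real n} (\<lambda>x. q x * D x) \<le> 0" if n: "\<bar>m\<bar> \<le> real n" for n
  proof -
    have 1: "(\<Psi>' has_integral \<Psi> (real n) - \<Psi> (- real n)) {- real n..real n}"
    proof (rule fundamental_theorem_of_calculus_strong[where S="{m}"])
      show "(\<Psi> has_vector_derivative \<Psi>' x) (at x)" if "x \<in> {- real n..real n} - {m}" for x
        using d\<Psi>[of x] that by (simp add: has_real_derivative_iff_has_vector_derivative)
    qed (use \<Psi>c in auto)
    have "\<Psi> (real n) \<le> 0" "0 \<le> \<Psi> (- real n)"
      using n q0[of "real n"] q0[of "- real n"]
      by (auto simp: \<Psi>_def mult_nonneg_nonpos2 mult_nonneg_nonneg divide_nonneg_nonpos abs_le_iff mult_nonpos_nonneg)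
    moreover have "integral {- real n..real n} (\<lambda>x. q x * D x) \<le> \<Psi> (real n) - \<Psi> (- real n)"
      using has_integral_le[OF integrable_integral[OF tendsto_integral_Icc(2)[OF Di']] 1] pw by auto
    ultimately show ?thesis by linarith
  qed
  have "(\<integral>x. q x * D x \<partial>lborel) \<le> 0"
  proof (rule LIMSEQ_le_const2[OF tendsto_integral_Icc(1)[OF Di']])
    obtain K where "\<bar>m\<bar> \<le> real K" using real_arch_simple by blast
    then show "\<exists>N. \<forall>n\<ge>N. integral {- real n..real n} (\<lambda>x. q x * D x) \<le> 0"
      using le0 by (metis of_nat_mono order_trans)
  qed
  then have "(\<integral>x. D x \<partial>gibbs1 \<phi>) \<le> 0"
    using integral_gibbs1(1)[OF pot, of D] by (simp add: q_def)
  then have "\<kappa> * (\<integral>x. (h x)\<^sup>2 \<partial>gibbs1 \<phi>) \<le> (\<integral>x. (f' x)\<^sup>2 \<partial>gibbs1 \<phi>)"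
    unfolding D_def using hi f'i by simp
  then have *: "(\<integral>x. (h x)\<^sup>2 \<partial>gibbs1 \<phi>) \<le> (1 / \<kappa>) * (\<integral>x. (f' x)\<^sup>2 \<partial>gibbs1 \<phi>)"
    using k by (simp add: field_simps)
  have "(\<integral>x. (h x)\<^sup>2 \<partial>gibbs1 \<phi>) = (\<integral>x. (f x)\<^sup>2 \<partial>gibbs1 \<phi>) + (f m)\<^sup>2 - 2 * f m * (\<integral>x. f x \<partial>gibbs1 \<phi>)"
    unfolding h_def power2_diff using fi fi2 by (simp add: prob_space[simplified] algebra_simps)
  also have "\<dots> \<ge> (\<integral>x. (f x)\<^sup>2 \<partial>gibbs1 \<phi>) - (\<integral>x. f x \<partial>gibbs1 \<phi>)\<^sup>2"
    using zero_le_power2[of "f m - (\<integral>x. f x \<partial>gibbs1 \<phi>)"] by (simp add: power2_diff algebra_simps)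
  finally show ?thesis using * by linarith
qed

section \<open>Tensorization\<close>

abbreviation gibbsP :: "('i \<Rightarrow> real \<Rightarrow> real) \<Rightarrow> 'i set \<Rightarrow> ('i \<Rightarrow> real) measure" where
  "gibbsP \<phi> I \<equiv> PiM I (\<lambda>i. gibbs1 (\<phi> i))"

text \<open>Functions of quadratic growth are integrable against every finite product of potentials,
  and the class survives integrating out a coordinate; products of two functions of linear growth
  belong to it. The bound is required only on extensional functions, which are the points of the
  product space.\<close>

definition qgrow :: "'i set \<Rightarrow> (('i \<Rightarrow> real) \<Rightarrow> real) \<Rightarrow> bool" where
  "qgrow I f \<longleftrightarrow> f \<in> borel_measurable (PiM I (\<lambda>_. borel)) \<and>
     (\<exists>C. \<forall>x\<in>extensional I. \<bar>f x\<bar> \<le> C * (1 + (\<Sum>i\<in>I. (x i)\<^sup>2)))"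

definition lgrow :: "'i set \<Rightarrow> (('i \<Rightarrow> real) \<Rightarrow> real) \<Rightarrow> bool" where
  "lgrow I f \<longleftrightarrow> f \<in> borel_measurable (PiM I (\<lambda>_. borel)) \<and>
     (\<exists>C. \<forall>x\<in>extensional I. \<bar>f x\<bar> \<le> C * (1 + (\<Sum>i\<in>I. \<bar>x i\<bar>)))"

lemma sets_gibbsP[measurable_cong, simp]: "sets (gibbsP \<phi> I) = sets (PiM I (\<lambda>_. borel))"
  by (rule sets_PiM_cong) auto

lemma sets_PiM_lborel[measurable_cong, simp]:
  "sets (PiM I (\<lambda>_. lborel :: real measure)) = sets (PiM I (\<lambda>_. borel))"
  by (rule sets_PiM_cong) auto

lemma space_gibbsP[simp]: "space (gibbsP \<phi> I) = extensional I"
  by (simp add: space_PiM PiE_def)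

lemma prob_space_gibbsP:
  assumes "\<And>i. potential \<kappa> M (\<phi> i)" shows "prob_space (gibbsP \<phi> I)"
proof -
  interpret prob_space "gibbs1 (\<phi> i)" for i using assms by (rule prob_space_gibbs1)
  show ?thesis by (rule prob_space_PiM) unfold_locales
qed

lemma product_prob_space_gibbs1:
  assumes "\<And>i. potential \<kappa> M (\<phi> i)" shows "product_prob_space (\<lambda>i. gibbs1 (\<phi> i))"
proof -
  interpret prob_space "gibbs1 (\<phi> i)" for i using assms by (rule prob_space_gibbs1)
  show ?thesis by unfold_locales
qed

lemma product_sigma_finite_gibbs1:
  assumes "\<And>i. potential \<kappa> M (\<phi> i)" shows "product_sigma_finite (\<lambda>i. gibbs1 (\<phi> i))"
  using product_prob_space_gibbs1[of \<kappa> M \<phi>, OF assms] by (simp add: product_prob_space_def)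

lemma qgrow_measurable: "qgrow I f \<Longrightarrow> f \<in> borel_measurable (PiM I (\<lambda>_. borel))"
  by (simp add: qgrow_def)

lemma lgrow_measurable: "lgrow I f \<Longrightarrow> f \<in> borel_measurable (PiM I (\<lambda>_. borel))"
  by (simp add: lgrow_def)

lemma qgrow_bound:
  assumes "qgrow I f"
  shows "\<exists>C\<ge>0. \<forall>x\<in>extensional I. \<bar>f x\<bar> \<le> C * (1 + (\<Sum>i\<in>I. (x i)\<^sup>2))"
proof -
  obtain C where C: "\<forall>x\<in>extensional I. \<bar>f x\<bar> \<le> C * (1 + (\<Sum>i\<in>I. (x i)\<^sup>2))"
    using assms by (auto simp: qgrow_def)
  moreover have "0 \<le> C"
    using C[rule_format, of "\<lambda>i\<in>I. 0"] by simp
  ultimately show ?thesis by blast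
qed

lemma lgrow_bound:
  assumes "lgrow I f"
  shows "\<exists>C\<ge>0. \<forall>x\<in>extensional I. \<bar>f x\<bar> \<le> C * (1 + (\<Sum>i\<in>I. \<bar>x i\<bar>))"
proof -
  obtain C where C: "\<forall>x\<in>extensional I. \<bar>f x\<bar> \<le> C * (1 + (\<Sum>i\<in>I. \<bar>x i\<bar>))"
    using assms by (auto simp: lgrow_def)
  moreover have "0 \<le> C"
    using C[rule_format, of "\<lambda>i\<in>I. 0"] by simp
  ultimately show ?thesis by blast
qed

lemma qgrow_const[intro]: "qgrow I (\<lambda>_. c)"
  unfolding qgrow_def
  by (auto intro!: exI[of _ "\<bar>c\<bar>"] sum_nonneg simp: mult_le_cancel_left1)

lemma qgrow_add[intro]:
  assumes "qgrow I f" "qgrow I g" shows "qgrow I (\<lambda>x. f x + g x)"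
proof -
  note [measurable] = qgrow_measurable[OF assms(1)] qgrow_measurable[OF assms(2)]
  obtain C D where C: "\<And>x. x \<in> extensional I \<Longrightarrow> \<bar>f x\<bar> \<le> C * (1 + (\<Sum>i\<in>I. (x i)\<^sup>2))"
    and D: "\<And>x. x \<in> extensional I \<Longrightarrow> \<bar>g x\<bar> \<le> D * (1 + (\<Sum>i\<in>I. (x i)\<^sup>2))"
    using assms unfolding qgrow_def by blast
  have "\<bar>f x + g x\<bar> \<le> (C + D) * (1 + (\<Sum>i\<in>I. (x i)\<^sup>2))" if "x \<in> extensional I" for x
    using C[OF that] D[OF that] unfolding distrib_right by linarith
  then show ?thesis unfolding qgrow_def by auto
qed

lemma qgrow_cmult[intro]:
  assumes "qgrow I f" shows "qgrow I (\<lambda>x. c * f x)"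
proof -
  note [measurable] = qgrow_measurable[OF assms(1)]
  obtain C where "\<And>x. x \<in> extensional I \<Longrightarrow> \<bar>f x\<bar> \<le> C * (1 + (\<Sum>i\<in>I. (x i)\<^sup>2))"
    using assms unfolding qgrow_def by blast
  then have "\<bar>c * f x\<bar> \<le> (\<bar>c\<bar> * C) * (1 + (\<Sum>i\<in>I. (x i)\<^sup>2))" if "x \<in> extensional I" for x
    using mult_left_mono[of "\<bar>f x\<bar>" _ "\<bar>c\<bar>"] that by (simp add: abs_mult mult.assoc)
  then show ?thesis unfolding qgrow_def by auto
qed

lemma qgrow_diff[intro]:
  assumes "qgrow I f" "qgrow I g" shows "qgrow I (\<lambda>x. f x - g x)"
  using qgrow_add[OF assms(1) qgrow_cmult[OF assms(2), of "-1"]] by simp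

lemma qgrow_sum[intro]:
  assumes "\<And>j. j \<in> J \<Longrightarrow> qgrow I (f j)" shows "qgrow I (\<lambda>x. \<Sum>j\<in>J. f j x)"
  using assms by (induction J rule: infinite_finite_induct) auto

lemma lgrow_const[intro]: "lgrow I (\<lambda>_. c)"
  unfolding lgrow_def
  by (auto intro!: exI[of _ "\<bar>c\<bar>"] sum_nonneg simp: mult_le_cancel_left1)

lemma lgrow_diff[intro]:
  assumes "lgrow I f" "lgrow I g" shows "lgrow I (\<lambda>x. f x - g x)"
proof -
  note [measurable] = lgrow_measurable[OF assms(1)] lgrow_measurable[OF assms(2)]
  obtain C D where C: "\<And>x. x \<in> extensional I \<Longrightarrow> \<bar>f x\<bar> \<le> C * (1 + (\<Sum>i\<in>I. \<bar>x i\<bar>))"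
    and D: "\<And>x. x \<in> extensional I \<Longrightarrow> \<bar>g x\<bar> \<le> D * (1 + (\<Sum>i\<in>I. \<bar>x i\<bar>))"
    using assms unfolding lgrow_def by blast
  have "\<bar>f x - g x\<bar> \<le> (C + D) * (1 + (\<Sum>i\<in>I. \<bar>x i\<bar>))" if "x \<in> extensional I" for x
    using C[OF that] D[OF that] unfolding distrib_right by linarith
  then show ?thesis unfolding lgrow_def by auto
qed

lemma lgrow_mult:
  assumes "finite I" "lgrow I f" "lgrow I g" shows "qgrow I (\<lambda>x. f x * g x)"
proof -
  note [measurable] = lgrow_measurable[OF assms(2)] lgrow_measurable[OF assms(3)]
  obtain C where C: "0 \<le> C" "\<And>x. x \<in> extensional I \<Longrightarrow> \<bar>f x\<bar> \<le> C * (1 + (\<Sum>i\<in>I. \<bar>x i\<bar>))"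
    using lgrow_bound[OF assms(2)] by blast
  obtain D where D: "0 \<le> D" "\<And>x. x \<in> extensional I \<Longrightarrow> \<bar>g x\<bar> \<le> D * (1 + (\<Sum>i\<in>I. \<bar>x i\<bar>))"
    using lgrow_bound[OF assms(3)] by blast
  have "\<bar>f x * g x\<bar> \<le> (C * D * (2 + 2 * card I)) * (1 + (\<Sum>i\<in>I. (x i)\<^sup>2))" if "x \<in> extensional I" for x
  proof -
    let ?s = "\<Sum>i\<in>I. \<bar>x i\<bar>" and ?q = "\<Sum>i\<in>I. (x i)\<^sup>2"
    have q: "0 \<le> ?q" "0 \<le> ?s" by (auto intro: sum_nonneg)
    have "?s\<^sup>2 \<le> (\<Sum>i\<in>I. \<bar>x i\<bar>\<^sup>2) * card I"
      using sum_squared_le_sum_of_squares[of "\<lambda>i. \<bar>x i\<bar>"] by (simp add: mult.commute)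
    then have s: "?s\<^sup>2 \<le> ?q * card I" by simp
    have "0 \<le> (1 - ?s)\<^sup>2" by simp
    then have "(1 + ?s)\<^sup>2 \<le> 2 + 2 * ?s\<^sup>2" by (simp add: power2_eq_square algebra_simps)
    also have "\<dots> \<le> 2 + 2 * (?q * card I)" using s by simp
    also have "\<dots> \<le> (2 + 2 * card I) * (1 + ?q)" using q by (simp add: algebra_simps)
    finally have *: "(1 + ?s)\<^sup>2 \<le> (2 + 2 * card I) * (1 + ?q)" .
    have "\<bar>f x * g x\<bar> \<le> (C * (1 + ?s)) * (D * (1 + ?s))"
      unfolding abs_mult using C D that q by (intro mult_mono) auto
    also have "\<dots> = (C * D) * (1 + ?s)\<^sup>2" by (simp add: power2_eq_square)
    also have "\<dots> \<le> (C * D) * ((2 + 2 * card I) * (1 + ?q))" using C D by (intro mult_left_mono *) auto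
    finally show ?thesis by (simp only: mult.assoc)
  qed
  then show ?thesis unfolding qgrow_def by auto
qed

lemma lgrow_imp_qgrow: assumes "finite I" "lgrow I f" shows "qgrow I f"
  using lgrow_mult[OF assms(1) assms(2) lgrow_const[of I 1]] by simp

lemma lgrow_lipschitz:
  assumes "f \<in> borel_measurable (PiM I (\<lambda>_. borel))"
    and L: "\<And>x y. x \<in> extensional I \<Longrightarrow> y \<in> extensional I \<Longrightarrow> \<bar>f x - f y\<bar> \<le> L * (\<Sum>i\<in>I. \<bar>x i - y i\<bar>)"
  shows "lgrow I f"
proof -
  let ?z = "\<lambda>i\<in>I. 0"
  have "\<bar>f x\<bar> \<le> (\<bar>f ?z\<bar> + \<bar>L\<bar>) * (1 + (\<Sum>i\<in>I. \<bar>x i\<bar>))" if "x \<in> extensional I" for x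
  proof -
    have s: "0 \<le> (\<Sum>i\<in>I. \<bar>x i\<bar>)" by (auto intro: sum_nonneg)
    have "\<bar>f x - f ?z\<bar> \<le> L * (\<Sum>i\<in>I. \<bar>x i - ?z i\<bar>)" using that by (intro L) auto
    then have "\<bar>f x - f ?z\<bar> \<le> L * (\<Sum>i\<in>I. \<bar>x i\<bar>)" by simp
    also have "\<dots> \<le> \<bar>L\<bar> * (\<Sum>i\<in>I. \<bar>x i\<bar>)" using s by (intro mult_right_mono) auto
    finally have 1: "\<bar>f x\<bar> \<le> \<bar>f ?z\<bar> + \<bar>L\<bar> * (\<Sum>i\<in>I. \<bar>x i\<bar>)" by linarith
    have "0 \<le> \<bar>f ?z\<bar> * (\<Sum>i\<in>I. \<bar>x i\<bar>)" "0 \<le> \<bar>L\<bar>" using s by auto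
    then show ?thesis using 1 by (simp only: distrib_left distrib_right mult_1_right)
  qed
  with assms(1) show ?thesis unfolding lgrow_def by blast
qed

lemma qgrow_component:
  assumes "finite I" "i \<in> I" "h \<in> borel_measurable borel" "\<And>t. \<bar>h t\<bar> \<le> C * (1 + t\<^sup>2)"
  shows "qgrow I (\<lambda>x. h (x i))"
proof -
  have C: "0 \<le> C" using assms(4)[of 0] by simp
  have "\<bar>h (x i)\<bar> \<le> C * (1 + (\<Sum>i\<in>I. (x i)\<^sup>2))" for x :: "'a \<Rightarrow> real"
  proof -
    have "\<bar>h (x i)\<bar> \<le> C * (1 + (x i)\<^sup>2)" by (rule assms)
    also have "\<dots> \<le> C * (1 + (\<Sum>i\<in>I. (x i)\<^sup>2))"
      using member_le_sum[OF assms(2), of "\<lambda>i. (x i)\<^sup>2"] assms C by (intro mult_left_mono) auto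
    finally show ?thesis .
  qed
  moreover have "(\<lambda>x. h (x i)) \<in> borel_measurable (PiM I (\<lambda>_. borel))"
    using assms by measurable
  ultimately show ?thesis unfolding qgrow_def by blast
qed

lemma lgrow_component:
  assumes "finite I" "i \<in> I" "h \<in> borel_measurable borel" "\<And>t. \<bar>h t\<bar> \<le> C * (1 + \<bar>t\<bar>)"
  shows "lgrow I (\<lambda>x. h (x i))"
proof -
  have C: "0 \<le> C" using assms(4)[of 0] by simp
  have "\<bar>h (x i)\<bar> \<le> C * (1 + (\<Sum>i\<in>I. \<bar>x i\<bar>))" for x :: "'a \<Rightarrow> real"
  proof -
    have "\<bar>h (x i)\<bar> \<le> C * (1 + \<bar>x i\<bar>)" by (rule assms)
    also have "\<dots> \<le> C * (1 + (\<Sum>i\<in>I. \<bar>x i\<bar>))"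
      using member_le_sum[OF assms(2), of "\<lambda>i. \<bar>x i\<bar>"] assms C by (intro mult_left_mono) auto
    finally show ?thesis .
  qed
  moreover have "(\<lambda>x. h (x i)) \<in> borel_measurable (PiM I (\<lambda>_. borel))"
    using assms by measurable
  ultimately show ?thesis unfolding lgrow_def by blast
qed

lemma gibbsP_component:
  fixes h :: "real \<Rightarrow> real"
  assumes pot: "\<And>i. potential \<kappa> M (\<phi> i)" and "i \<in> I" and h[measurable]: "h \<in> borel_measurable borel"
  shows "(\<integral>x. h (x i) \<partial>gibbsP \<phi> I) = (\<integral>t. h t \<partial>gibbs1 (\<phi> i))"
    and "integrable (gibbsP \<phi> I) (\<lambda>x. h (x i)) \<longleftrightarrow> integrable (gibbs1 (\<phi> i)) h"
proof -
  interpret product_prob_space "\<lambda>i. gibbs1 (\<phi> i)" I by (rule product_prob_space_gibbs1[where \<phi>=\<phi>, OF pot])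
  have d: "distr (gibbsP \<phi> I) (gibbs1 (\<phi> i)) (\<lambda>x. x i) = gibbs1 (\<phi> i)" by (rule PiM_component) fact
  have m: "(\<lambda>x. x i) \<in> measurable (gibbsP \<phi> I) (gibbs1 (\<phi> i))" using assms(2) by measurable
  have hm: "h \<in> borel_measurable (gibbs1 (\<phi> i))" by measurable
  show "(\<integral>x. h (x i) \<partial>gibbsP \<phi> I) = (\<integral>t. h t \<partial>gibbs1 (\<phi> i))"
    using integral_distr[OF m hm] d by simp
  show "integrable (gibbsP \<phi> I) (\<lambda>x. h (x i)) \<longleftrightarrow> integrable (gibbs1 (\<phi> i)) h"
    using integrable_distr_eq[OF m hm] d by simp
qed

lemma qgrow_integrable:
  assumes pot: "\<And>i. potential \<kappa> M (\<phi> i)" and fin: "finite I" and f: "qgrow I f"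
  shows "integrable (gibbsP \<phi> I) f"
proof -
  note [measurable] = qgrow_measurable[OF f]
  obtain C where C: "\<And>x. x \<in> extensional I \<Longrightarrow> \<bar>f x\<bar> \<le> C * (1 + (\<Sum>i\<in>I. (x i)\<^sup>2))"
    using qgrow_bound[OF f] by blast
  interpret prob_space "gibbsP \<phi> I" by (rule prob_space_gibbsP[where \<phi>=\<phi>, OF pot])
  show ?thesis
  proof (rule Bochner_Integration.integrable_bound)
    have "integrable (gibbsP \<phi> I) (\<lambda>x. (x i)\<^sup>2)" if "i \<in> I" for i
    proof -
      have "integrable (gibbs1 (\<phi> i)) (\<lambda>t. t\<^sup>2)"
        by (rule potential_integrable[OF pot, of _ 1]) auto
      then show ?thesis using gibbsP_component(2)[where \<phi>=\<phi>, OF pot that, of "\<lambda>t. t\<^sup>2"] by simp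
    qed
    then show "integrable (gibbsP \<phi> I) (\<lambda>x. C * (1 + (\<Sum>i\<in>I. (x i)\<^sup>2)))"
      by (intro integrable_mult_right Bochner_Integration.integrable_add integrable_const Bochner_Integration.integrable_sum)
    show "AE x in gibbsP \<phi> I. norm (f x) \<le> norm (C * (1 + (\<Sum>i\<in>I. (x i)\<^sup>2)))"
      using C by (intro AE_I2) (auto intro: order_trans[OF _ abs_ge_self])
  qed measurable
qed

lemma extensional_upd: "x \<in> extensional I \<Longrightarrow> x(i := t) \<in> extensional (insert i I)"
  by (auto simp: extensional_def)

text \<open>What an induction over the coordinates needs in order to split off coordinate
  \<open>i\<close>: slices are measurable and integrable, the partial average stays in the growth
  class because \<open>gibbs1 (\<phi> i)\<close> has a finite second moment, and Fubini
  holds.\<close>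

lemma qgrow_slice:
  assumes pot: "\<And>i. potential \<kappa> M (\<phi> i)" and fin: "finite I" "i \<notin> I" and f: "qgrow (insert i I) f"
  shows "x \<in> extensional I \<Longrightarrow> (\<lambda>t. f (x(i := t))) \<in> borel_measurable borel"
    and "x \<in> extensional I \<Longrightarrow> integrable (gibbs1 (\<phi> i)) (\<lambda>t. f (x(i := t)))"
    and "qgrow I (\<lambda>x. \<integral>t. f (x(i := t)) \<partial>gibbs1 (\<phi> i))"
    and "(\<integral>x. \<integral>t. f (x(i := t)) \<partial>gibbs1 (\<phi> i) \<partial>gibbsP \<phi> I) = (\<integral>x. f x \<partial>gibbsP \<phi> (insert i I))"
proof -
  note [measurable] = qgrow_measurable[OF f]
  interpret prob_space "gibbs1 (\<phi> i)" by (rule prob_space_gibbs1[OF pot])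
  interpret P: product_sigma_finite "\<lambda>i. gibbs1 (\<phi> i)" by (rule product_sigma_finite_gibbs1[where \<phi>=\<phi>, OF pot])
  obtain C where C0: "0 \<le> C" and C: "\<And>x. x \<in> extensional (insert i I) \<Longrightarrow> \<bar>f x\<bar> \<le> C * (1 + (\<Sum>i\<in>insert i I. (x i)\<^sup>2))"
    using qgrow_bound[OF f] by blast
  have b: "\<bar>f (x(i := t))\<bar> \<le> C * (1 + (\<Sum>i\<in>I. (x i)\<^sup>2)) + C * t\<^sup>2" if "x \<in> extensional I" for x t
  proof -
    have "(\<Sum>j\<in>I. ((x(i := t)) j)\<^sup>2) = (\<Sum>j\<in>I. (x j)\<^sup>2)" using fin by (intro sum.cong) auto
    then show ?thesis
      using C[OF extensional_upd[OF that, of i t]] fin by (simp add: algebra_simps)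
  qed
  have sm: "(\<lambda>t. f (x(i := t))) \<in> borel_measurable borel" if "x \<in> extensional I" for x
  proof -
    have "x \<in> space (PiM I (\<lambda>_. borel))" using that by (simp add: space_PiM PiE_def)
    from measurable_comp[OF measurable_component_update[OF this fin(2)] qgrow_measurable[OF f]]
    show ?thesis by (simp add: comp_def)
  qed
  have sq: "integrable (gibbs1 (\<phi> i)) (\<lambda>t. t\<^sup>2)"
    by (rule potential_integrable[OF pot, of _ 1]) auto
  have bi: "integrable (gibbs1 (\<phi> i)) (\<lambda>t. C * (1 + (\<Sum>i\<in>I. (x i)\<^sup>2)) + C * t\<^sup>2)" for x
    using sq by (intro Bochner_Integration.integrable_add integrable_mult_right) auto
  have int: "integrable (gibbs1 (\<phi> i)) (\<lambda>t. f (x(i := t)))" if "x \<in> extensional I" for x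
    using b[OF that] sm[OF that]
    by (intro Bochner_Integration.integrable_bound[OF bi[of x]] AE_I2) (auto intro: order_trans[OF _ abs_ge_self])
  show "x \<in> extensional I \<Longrightarrow> (\<lambda>t. f (x(i := t))) \<in> borel_measurable borel" by (rule sm)
  show "x \<in> extensional I \<Longrightarrow> integrable (gibbs1 (\<phi> i)) (\<lambda>t. f (x(i := t)))" by (rule int)
  have m: "(\<lambda>x. \<integral>t. f (x(i := t)) \<partial>gibbs1 (\<phi> i)) \<in> borel_measurable (PiM I (\<lambda>_. borel))"
    by measurable
  define S where "S = (\<integral>t. t\<^sup>2 \<partial>gibbs1 (\<phi> i))"
  have S0: "0 \<le> S" unfolding S_def by simp
  have "\<bar>\<integral>t. f (x(i := t)) \<partial>gibbs1 (\<phi> i)\<bar> \<le> (C * (1 + S)) * (1 + (\<Sum>i\<in>I. (x i)\<^sup>2))"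
    if "x \<in> extensional I" for x
  proof -
    have "\<bar>\<integral>t. f (x(i := t)) \<partial>gibbs1 (\<phi> i)\<bar> \<le> (\<integral>t. \<bar>f (x(i := t))\<bar> \<partial>gibbs1 (\<phi> i))"
      by (rule integral_abs_bound)
    also have "\<dots> \<le> (\<integral>t. C * (1 + (\<Sum>i\<in>I. (x i)\<^sup>2)) + C * t\<^sup>2 \<partial>gibbs1 (\<phi> i))"
      using b[OF that] int[OF that] bi by (intro integral_mono) auto
    also have "\<dots> = C * (1 + (\<Sum>i\<in>I. (x i)\<^sup>2)) + C * S"
      using sq by (simp add: S_def prob_space[simplified])
    also have "\<dots> \<le> (C * (1 + S)) * (1 + (\<Sum>i\<in>I. (x i)\<^sup>2))"
    proof -
      have "0 \<le> (C * S) * (\<Sum>i\<in>I. (x i)\<^sup>2)" using C0 S0 by (intro mult_nonneg_nonneg sum_nonneg) auto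
      then show ?thesis by (simp add: algebra_simps)
    qed
    finally show ?thesis .
  qed
  with m show "qgrow I (\<lambda>x. \<integral>t. f (x(i := t)) \<partial>gibbs1 (\<phi> i))" unfolding qgrow_def by blast
  show "(\<integral>x. \<integral>t. f (x(i := t)) \<partial>gibbs1 (\<phi> i) \<partial>gibbsP \<phi> I) = (\<integral>x. f x \<partial>gibbsP \<phi> (insert i I))"
    using fin f by (intro P.product_integral_insert[symmetric] qgrow_integrable[where \<phi>=\<phi>, OF pot]) auto
qed

text \<open>Induction on the coordinates. With the remaining coordinates of \<open>x\<close> and
  \<open>y\<close> fixed, \<open>l x y\<close> is a constant that the one-dimensional inequality
  absorbs into its \<open>W\<close>. The outcome is the same hypothesis, now for the partial
  integral \<open>F\<close> of \<open>E\<close> and the partial average \<open>V\<close> of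
  \<open>W\<close>; nothing about the dependence of \<open>F\<close> on \<open>y\<close> has to be
  known beyond measurability, finiteness and positivity.\<close>

lemma tangent_PiM:
  fixes \<phi> :: "'i \<Rightarrow> real \<Rightarrow> real"
  assumes pot: "\<And>i. potential \<kappa> M (\<phi> i)" and fin: "finite I"
    and E: "E \<in> borel_measurable (PiM I (\<lambda>_. borel))" "\<And>y. y \<in> extensional I \<Longrightarrow> 0 < E y"
    and W: "qgrow I W"
    and le: "\<And>x y. x \<in> extensional I \<Longrightarrow> y \<in> extensional I \<Longrightarrow>
       E y \<le> exp (W x - (\<Sum>i\<in>I. \<phi> i (x i) + deriv (\<phi> i) (x i) * (y i - x i)))"
  shows "(\<integral>\<^sup>+y. ennreal (E y) \<partial>PiM I (\<lambda>_. lborel)) \<le> ennreal (exp (\<integral>x. W x \<partial>gibbsP \<phi> I))"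
  using fin E W le
proof (induction I arbitrary: E W rule: finite_induct)
  case empty
  interpret product_sigma_finite "\<lambda>_::'i. lborel :: real measure" by unfold_locales
  have "E (\<lambda>_. undefined) \<le> exp (W (\<lambda>_. undefined))" using empty(4)[of "\<lambda>_. undefined" "\<lambda>_. undefined"] by simp
  then show ?case
    by (simp add: nn_integral_empty PiM_empty nn_integral_count_space_finite lebesgue_integral_count_space_finite)
next
  case (insert i I)
  interpret L: product_sigma_finite "\<lambda>_::'i. lborel :: real measure" by unfold_locales
  note [measurable] = insert.prems(1)
  note sl = qgrow_slice[where \<phi>=\<phi>, OF pot insert.hyps(1,2) insert.prems(3)]
  define F where "F y = (\<integral>\<^sup>+t. ennreal (E (y(i := t))) \<partial>lborel)" for y
  define V where "V x = (\<integral>t. W (x(i := t)) \<partial>gibbs1 (\<phi> i))" for x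
  define l where "l x y = (\<Sum>j\<in>I. \<phi> j (x j) + deriv (\<phi> j) (x j) * (y j - x j))" for x y
  interpret prob_space "gibbs1 (\<phi> i)" by (rule prob_space_gibbs1[OF pot])
  have [measurable]: "F \<in> borel_measurable (PiM I (\<lambda>_. borel))"
    unfolding F_def by measurable
  have Fle: "F y \<le> ennreal (exp (V x - l x y))" if xy: "x \<in> extensional I" "y \<in> extensional I" for x y
  proof -
    have "F y \<le> ennreal (exp (\<integral>s. W (x(i := s)) - l x y \<partial>gibbs1 (\<phi> i)))"
      unfolding F_def
    proof (rule tangent_1d[OF pot])
      show "integrable (gibbs1 (\<phi> i)) (\<lambda>s. W (x(i := s)) - l x y)"
        by (intro Bochner_Integration.integrable_diff sl(2) xy(1)) auto
      show "0 < E (y(i := t))" for t using xy by (intro insert.prems extensional_upd)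
      show "E (y(i := t)) \<le> exp (W (x(i := s)) - l x y - \<phi> i s - deriv (\<phi> i) s * (t - s))" for s t
      proof -
        have "(\<Sum>j\<in>I. \<phi> j ((x(i := s)) j) + deriv (\<phi> j) ((x(i := s)) j) * ((y(i := t)) j - (x(i := s)) j)) = l x y"
          unfolding l_def using insert.hyps by (intro sum.cong) auto
        then have "W (x(i := s)) - (\<Sum>j\<in>insert i I. \<phi> j ((x(i := s)) j) + deriv (\<phi> j) ((x(i := s)) j) * ((y(i := t)) j - (x(i := s)) j))
          = W (x(i := s)) - l x y - \<phi> i s - deriv (\<phi> i) s * (t - s)"
          using insert.hyps by (subst sum.insert) auto
        then show ?thesis
          using insert.prems(4)[of "x(i := s)" "y(i := t)", OF extensional_upd[OF xy(1)] extensional_upd[OF xy(2)]]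
          by metis
      qed
    qed
    also have "(\<integral>s. W (x(i := s)) - l x y \<partial>gibbs1 (\<phi> i)) = V x - (\<integral>s. l x y \<partial>gibbs1 (\<phi> i))"
      unfolding V_def by (intro Bochner_Integration.integral_diff sl(2) xy(1)) auto
    also have "(\<integral>s. l x y \<partial>gibbs1 (\<phi> i)) = l x y" by (simp add: prob_space[simplified])
    finally show ?thesis .
  qed
  have ue: "(\<lambda>j. undefined) \<in> extensional I" by (simp add: extensional_def)
  have Ffin: "F y < top" if "y \<in> extensional I" for y
    using Fle[OF ue that] by (rule le_less_trans) simp
  \<comment> \<open>Positivity has to be passed on to the induction hypothesis: a vanishing integral
    would force the positive function \<open>E\<close> to vanish almost everywhere on a
    line.\<close>
  have Fpos: "0 < F y" if "y \<in> extensional I" for y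
  proof (rule ccontr)
    assume "\<not> 0 < F y"
    then have "F y = 0" by simp
    moreover have "(\<lambda>t. E (y(i := t))) \<in> borel_measurable borel"
    proof -
      have "y \<in> space (PiM I (\<lambda>_. borel))" using that by (simp add: space_PiM PiE_def)
      from measurable_comp[OF measurable_component_update[OF this insert.hyps(2)] insert.prems(1)]
      show ?thesis by (simp add: comp_def)
    qed
    ultimately have "AE t in lborel. ennreal (E (y(i := t))) = 0"
      unfolding F_def by (subst (asm) nn_integral_0_iff_AE) auto
    moreover have "ennreal (E (y(i := t))) \<noteq> 0" for t
      by (metis ennreal_eq_0_iff insert.prems(2) extensional_upd that not_le)
    ultimately have "AE t in lborel::real measure. False" by simp
    then show False by (simp add: eventually_False ae_filter_eq_bot_iff)
  qed
  have "(\<integral>\<^sup>+y. ennreal (E y) \<partial>PiM (insert i I) (\<lambda>_. lborel)) = (\<integral>\<^sup>+y. F y \<partial>PiM I (\<lambda>_. lborel))"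
    unfolding F_def using insert.hyps by (intro L.product_nn_integral_insert) auto
  also have "\<dots> = (\<integral>\<^sup>+y. ennreal (enn2real (F y)) \<partial>PiM I (\<lambda>_. lborel))"
    using Ffin by (intro nn_integral_cong) (simp add: space_PiM PiE_def)
  also have "\<dots> \<le> ennreal (exp (\<integral>x. V x \<partial>gibbsP \<phi> I))"
  proof (rule insert.IH)
    show "0 < enn2real (F y)" if "y \<in> extensional I" for y
      using Fpos[OF that] Ffin[OF that] by (simp add: enn2real_positive_iff)
    show "qgrow I V" unfolding V_def by (rule sl(3))
    show "enn2real (F y) \<le> exp (V x - (\<Sum>i\<in>I. \<phi> i (x i) + deriv (\<phi> i) (x i) * (y i - x i)))"
      if "x \<in> extensional I" "y \<in> extensional I" for x y
      using Fle[OF that] unfolding l_def by (intro enn2real_leI) auto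
  qed measurable
  also have "(\<integral>x. V x \<partial>gibbsP \<phi> I) = (\<integral>x. W x \<partial>gibbsP \<phi> (insert i I))"
    unfolding V_def by (rule sl(4))
  finally show ?case .
qed

section \<open>Expectations depending on a parameter, and the Poincare inequality for
  products\<close>

lemma has_real_derivative_expectation:
  fixes f g :: "real \<Rightarrow> 'a \<Rightarrow> real"
  assumes "prob_space M" and f: "\<And>s. integrable M (f s)"
    and g[measurable]: "\<And>s. g s \<in> borel_measurable M"
    and d: "\<And>s t. t \<in> space M \<Longrightarrow> ((\<lambda>s. f s t) has_real_derivative g s t) (at s)"
    and L: "\<And>s t. t \<in> space M \<Longrightarrow> \<bar>g s t\<bar> \<le> L"
  shows "((\<lambda>s. \<integral>t. f s t \<partial>M) has_real_derivative (\<integral>t. g s t \<partial>M)) (at s)"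
  unfolding DERIV_def tendsto_at_iff_sequentially comp_def
proof (intro allI impI)
  interpret prob_space M by fact
  note [measurable] = borel_measurable_integrable[OF f]
  fix X :: "nat \<Rightarrow> real" assume X: "\<forall>n. X n \<in> UNIV - {0}" "X \<longlonglongrightarrow> 0"
  have "(\<lambda>n. \<integral>t. (f (s + X n) t - f s t) / X n \<partial>M) \<longlonglongrightarrow> (\<integral>t. g s t \<partial>M)"
  proof (rule integral_dominated_convergence[where w="\<lambda>_. L"])
    show "AE t in M. (\<lambda>n. (f (s + X n) t - f s t) / X n) \<longlonglongrightarrow> g s t"
      using d[of _ s] X unfolding DERIV_def tendsto_at_iff_sequentially comp_def by (intro AE_I2) blast
    show "AE t in M. norm ((f (s + X n) t - f s t) / X n) \<le> L" for n
    proof (rule AE_I2)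
      fix t assume t: "t \<in> space M"
      have "\<bar>f (s + X n) t - f s t\<bar> \<le> L * \<bar>X n\<bar>"
        using field_differentiable_bound[of UNIV "\<lambda>s. f s t" "\<lambda>s. g s t" L "s + X n" s] d[OF t] L[OF t] by auto
      then show "norm ((f (s + X n) t - f s t) / X n) \<le> L"
        using X(1) by (simp add: divide_le_eq)
    qed
  qed auto
  moreover have "(\<integral>t. (f (s + X n) t - f s t) / X n \<partial>M) = ((\<integral>t. f (s + X n) t \<partial>M) - (\<integral>t. f s t \<partial>M)) / X n" for n
    using f by simp
  ultimately show "(\<lambda>n. ((\<integral>t. f (s + X n) t \<partial>M) - (\<integral>t. f s t \<partial>M)) / X n) \<longlonglongrightarrow> (\<integral>t. g s t \<partial>M)" by (simp only:)
qed

text \<open>A dominating function for each bounded range of the parameter suffices, since a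
  convergent sequence of parameters is bounded.\<close>

lemma continuous_on_integral_dominated:
  fixes g :: "real \<Rightarrow> 'a \<Rightarrow> real"
  assumes g[measurable]: "\<And>s. g s \<in> borel_measurable M"
    and c: "\<And>t. t \<in> space M \<Longrightarrow> continuous_on UNIV (\<lambda>s. g s t)"
    and dom: "\<And>K. \<exists>w. integrable M w \<and> (\<forall>s t. \<bar>s\<bar> \<le> K \<longrightarrow> t \<in> space M \<longrightarrow> \<bar>g s t\<bar> \<le> w t)"
  shows "continuous_on UNIV (\<lambda>s. \<integral>t. g s t \<partial>M)"
  unfolding continuous_on_sequentially
proof (intro ballI allI impI)
  fix X :: "nat \<Rightarrow> real" and s assume X: "(\<forall>n. X n \<in> UNIV) \<and> X \<longlonglongrightarrow> s"
  then have "Bseq X" by (intro convergent_imp_Bseq convergentI) auto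
  then obtain K where K: "\<And>n. \<bar>X n\<bar> \<le> K" by (auto simp: Bseq_def)
  obtain w where w: "integrable M w" "\<And>s t. \<bar>s\<bar> \<le> K \<Longrightarrow> t \<in> space M \<Longrightarrow> \<bar>g s t\<bar> \<le> w t" using dom by blast
  show "((\<lambda>s. \<integral>t. g s t \<partial>M) \<circ> X) \<longlonglongrightarrow> (\<integral>t. g s t \<partial>M)"
    unfolding comp_def
  proof (rule integral_dominated_convergence[where w=w])
    show "AE t in M. (\<lambda>n. g (X n) t) \<longlonglongrightarrow> g s t"
      using c X by (intro AE_I2) (auto simp: continuous_on_sequentially comp_def)
  qed (use w K in auto)
qed

lemma lgrow_bounded:
  assumes "f \<in> borel_measurable (PiM I (\<lambda>_. borel))" "\<And>x. x \<in> extensional I \<Longrightarrow> \<bar>f x\<bar> \<le> L"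
  shows "lgrow I f"
proof -
  have "\<bar>f x\<bar> \<le> L * (1 + (\<Sum>i\<in>I. \<bar>x i\<bar>))" if "x \<in> extensional I" for x
  proof -
    have "0 \<le> L" using assms(2)[OF that] by linarith
    then have "0 \<le> L * (\<Sum>i\<in>I. \<bar>x i\<bar>)" by (intro mult_nonneg_nonneg sum_nonneg) auto
    then show ?thesis using assms(2)[OF that] unfolding distrib_left by linarith
  qed
  with assms(1) show ?thesis unfolding lgrow_def by blast
qed

lemma square_integral_le:
  fixes f :: "'a \<Rightarrow> real"
  assumes "prob_space M" "integrable M f" "integrable M (\<lambda>x. (f x)\<^sup>2)"
  shows "(\<integral>x. f x \<partial>M)\<^sup>2 \<le> (\<integral>x. (f x)\<^sup>2 \<partial>M)"
proof -
  interpret prob_space M by fact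
  show ?thesis using variance_positive[of f] variance_eq[OF assms(2,3)] by simp
qed

text \<open>Induction on the coordinates. The inequality on the line handles the new coordinate
  \<open>i\<close> and leaves the partial average \<open>F\<close>, to which the induction
  hypothesis applies: its derivatives are the averages \<open>H j\<close>, with the same constant
  \<open>L\<close>, and Jensen bounds the integral of \<open>(H j x)\<^sup>2\<close> by that of
  \<open>(G j x)\<^sup>2\<close>.\<close>

lemma poincare_PiM:
  fixes \<phi> :: "'i \<Rightarrow> real \<Rightarrow> real"
  assumes pot: "\<And>i. potential \<kappa> M (\<phi> i)" and fin: "finite I"
    and f: "f \<in> borel_measurable (PiM I (\<lambda>_. borel))"
    and lip: "\<And>x y. x \<in> extensional I \<Longrightarrow> y \<in> extensional I \<Longrightarrow> \<bar>f x - f y\<bar> \<le> L * (\<Sum>i\<in>I. \<bar>x i - y i\<bar>)"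
    and G: "\<And>i. i \<in> I \<Longrightarrow> G i \<in> borel_measurable (PiM I (\<lambda>_. borel))"
    and d: "\<And>i x t. i \<in> I \<Longrightarrow> x \<in> extensional I \<Longrightarrow>
        ((\<lambda>t. f (x(i := t))) has_real_derivative G i (x(i := t))) (at t)"
    and c: "\<And>i x. i \<in> I \<Longrightarrow> x \<in> extensional I \<Longrightarrow> continuous_on UNIV (\<lambda>t. G i (x(i := t)))"
    and b: "\<And>i x. i \<in> I \<Longrightarrow> x \<in> extensional I \<Longrightarrow> \<bar>G i x\<bar> \<le> L"
  shows "(\<integral>x. (f x)\<^sup>2 \<partial>gibbsP \<phi> I) \<le> (\<integral>x. f x \<partial>gibbsP \<phi> I)\<^sup>2 + (1 / \<kappa>) * (\<Sum>i\<in>I. \<integral>x. (G i x)\<^sup>2 \<partial>gibbsP \<phi> I)"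
  using fin f lip G d c b
proof (induction I arbitrary: f G rule: finite_induct)
  case empty
  then show ?case
    by (simp add: PiM_empty lebesgue_integral_count_space_finite)
next
  case (insert i I)
  note fm = insert.prems(1) and Gm = insert.prems(3)
  note lipf = insert.prems(2) and df = insert.prems(4) and cf = insert.prems(5) and bf = insert.prems(6)
  have k: "0 < \<kappa>" using potential_pos[OF pot] by blast
  have fin: "finite (insert i I)" using insert.hyps by simp
  interpret prob_space "gibbs1 (\<phi> i)" by (rule prob_space_gibbs1[OF pot])
  interpret P: prob_space "gibbsP \<phi> I" by (rule prob_space_gibbsP[where \<phi>=\<phi>, OF pot])
  have ext: "x \<in> extensional (insert i I)" if "x \<in> extensional I" for x :: "'i \<Rightarrow> real"
    using that by (auto simp: extensional_def)
  have extj: "x(j := s) \<in> extensional I" if "x \<in> extensional I" "j \<in> I" for x :: "'i \<Rightarrow> real" and j s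
    using that by (auto simp: extensional_def)
  have lf: "lgrow (insert i I) f" by (rule lgrow_lipschitz[OF fm lipf])
  have lG: "lgrow (insert i I) (G j)" if "j \<in> insert i I" for j
    by (rule lgrow_bounded[OF Gm[OF that] bf[OF that]])
  note slf = qgrow_slice[where \<phi>=\<phi>, OF pot insert.hyps lgrow_imp_qgrow[OF fin lf]]
  note slf2 = qgrow_slice[where \<phi>=\<phi>, OF pot insert.hyps lgrow_mult[OF fin lf lf]]
  note slG = qgrow_slice[where \<phi>=\<phi>, OF pot insert.hyps lgrow_imp_qgrow[OF fin lG]]
  note slG2 = qgrow_slice[where \<phi>=\<phi>, OF pot insert.hyps lgrow_mult[OF fin lG lG]]
  define F where "F x = (\<integral>t. f (x(i := t)) \<partial>gibbs1 (\<phi> i))" for x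
  define H where "H j x = (\<integral>t. G j (x(i := t)) \<partial>gibbs1 (\<phi> i))" for j x
  have Fm: "F \<in> borel_measurable (PiM I (\<lambda>_. borel))"
    unfolding F_def by (rule qgrow_measurable[OF slf(3)])
  have Hm: "H j \<in> borel_measurable (PiM I (\<lambda>_. borel))" if "j \<in> I" for j
    unfolding H_def using that by (intro qgrow_measurable[OF slG(3)]) auto
  have Flip: "\<bar>F x - F y\<bar> \<le> L * (\<Sum>j\<in>I. \<bar>x j - y j\<bar>)" if xy: "x \<in> extensional I" "y \<in> extensional I" for x y
  proof -
    have "F x - F y = (\<integral>t. f (x(i := t)) - f (y(i := t)) \<partial>gibbs1 (\<phi> i))"
      unfolding F_def by (rule Bochner_Integration.integral_diff[symmetric]) (intro slf(2) xy)+
    also have "\<bar>\<dots>\<bar> \<le> (\<integral>t. \<bar>f (x(i := t)) - f (y(i := t))\<bar> \<partial>gibbs1 (\<phi> i))"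
      by (rule integral_abs_bound)
    also have "\<dots> \<le> (\<integral>t. L * (\<Sum>j\<in>I. \<bar>x j - y j\<bar>) \<partial>gibbs1 (\<phi> i))"
    proof (rule integral_mono)
      show "integrable (gibbs1 (\<phi> i)) (\<lambda>t. \<bar>f (x(i := t)) - f (y(i := t))\<bar>)"
        by (intro integrable_abs Bochner_Integration.integrable_diff slf(2) xy)
      fix t
      have "(\<Sum>j\<in>insert i I. \<bar>(x(i := t)) j - (y(i := t)) j\<bar>) = (\<Sum>j\<in>I. \<bar>x j - y j\<bar>)"
        using insert.hyps by (simp, intro sum.cong) auto
      then show "\<bar>f (x(i := t)) - f (y(i := t))\<bar> \<le> L * (\<Sum>j\<in>I. \<bar>x j - y j\<bar>)"
        using lipf[of "x(i := t)" "y(i := t)", OF extensional_upd[OF xy(1)] extensional_upd[OF xy(2)]] by metis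
    qed auto
    also have "\<dots> = L * (\<Sum>j\<in>I. \<bar>x j - y j\<bar>)" by (simp add: prob_space[simplified])
    finally show ?thesis .
  qed
  have tw: "(x(j := s))(i := t) = (x(i := t))(j := s)" if "j \<in> I" for x :: "'i \<Rightarrow> real" and j s t
    using that insert.hyps by (intro fun_upd_twist) auto
  have dF: "((\<lambda>s. F (x(j := s))) has_real_derivative H j (x(j := s))) (at s)"
    if "j \<in> I" "x \<in> extensional I" for j x s
    unfolding F_def H_def
  proof (rule has_real_derivative_expectation[OF prob_space_axioms, where L=L])
    show "integrable (gibbs1 (\<phi> i)) (\<lambda>t. f (x(j := s, i := t)))" for s
      using that by (intro slf(2) extj)
    show "(\<lambda>t. G j (x(j := s, i := t))) \<in> borel_measurable (gibbs1 (\<phi> i))" for s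
      using slG(1)[of j "x(j := s)"] that extj by (simp add: measurable_def)
    show "((\<lambda>s. f (x(j := s, i := t))) has_real_derivative G j (x(j := s, i := t))) (at s)" for s t
      unfolding tw[OF that(1)] using that by (intro df extensional_upd) auto
    show "\<bar>G j (x(j := s, i := t))\<bar> \<le> L" for s t
      using that by (intro bf extensional_upd extj) auto
  qed
  have cF: "continuous_on UNIV (\<lambda>s. H j (x(j := s)))" if "j \<in> I" "x \<in> extensional I" for j x
    unfolding H_def
  proof (rule continuous_on_integral_dominated)
    show "(\<lambda>t. G j (x(j := s, i := t))) \<in> borel_measurable (gibbs1 (\<phi> i))" for s
      using slG(1)[of j "x(j := s)"] that extj by (simp add: measurable_def)
    show "continuous_on UNIV (\<lambda>s. G j (x(j := s, i := t)))" for t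
      unfolding tw[OF that(1)] using that by (intro cf extensional_upd) auto
    have "\<bar>G j (x(j := s, i := t))\<bar> \<le> L" for s t
      using that by (intro bf extensional_upd extj) auto
    then show "\<exists>w. integrable (gibbs1 (\<phi> i)) w \<and>
        (\<forall>s t. \<bar>s\<bar> \<le> K \<longrightarrow> t \<in> space (gibbs1 (\<phi> i)) \<longrightarrow> \<bar>G j (x(j := s, i := t))\<bar> \<le> w t)" for K
      by (intro exI[of _ "\<lambda>_. L"]) auto
  qed
  have bH: "\<bar>H j x\<bar> \<le> L" if "j \<in> I" "x \<in> extensional I" for j x
  proof -
    have "\<bar>H j x\<bar> \<le> (\<integral>t. \<bar>G j (x(i := t))\<bar> \<partial>gibbs1 (\<phi> i))"
      unfolding H_def by (rule integral_abs_bound)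
    also have "\<dots> \<le> (\<integral>t. L \<partial>gibbs1 (\<phi> i))"
      using that by (intro integral_mono integrable_abs slG(2) bf extensional_upd) auto
    finally show ?thesis by (simp add: prob_space[simplified])
  qed
  have lF: "lgrow I F" by (rule lgrow_lipschitz[OF Fm Flip])
  have lH: "lgrow I (H j)" if "j \<in> I" for j by (rule lgrow_bounded[OF Hm bH]) (use that in auto)
  have IH: "(\<integral>x. (F x)\<^sup>2 \<partial>gibbsP \<phi> I) \<le> (\<integral>x. F x \<partial>gibbsP \<phi> I)\<^sup>2 + (1 / \<kappa>) * (\<Sum>j\<in>I. \<integral>x. (H j x)\<^sup>2 \<partial>gibbsP \<phi> I)"
    by (rule insert.IH[OF Fm Flip Hm dF cF bH])
  have Fint: "(\<integral>x. F x \<partial>gibbsP \<phi> I) = (\<integral>x. f x \<partial>gibbsP \<phi> (insert i I))"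
    unfolding F_def by (rule slf(4))
  have Hint: "(\<integral>x. (H j x)\<^sup>2 \<partial>gibbsP \<phi> I) \<le> (\<integral>x. (G j x)\<^sup>2 \<partial>gibbsP \<phi> (insert i I))" if j: "j \<in> I" for j
  proof -
    have j': "j \<in> insert i I" using j by simp
    have "(\<integral>x. (H j x)\<^sup>2 \<partial>gibbsP \<phi> I) \<le> (\<integral>x. \<integral>t. G j (x(i := t)) * G j (x(i := t)) \<partial>gibbs1 (\<phi> i) \<partial>gibbsP \<phi> I)"
    proof (rule integral_mono)
      show "integrable (gibbsP \<phi> I) (\<lambda>x. (H j x)\<^sup>2)"
        using qgrow_integrable[where \<phi>=\<phi>, OF pot insert.hyps(1) lgrow_mult[OF insert.hyps(1) lH[OF j] lH[OF j]]]
        by (simp add: power2_eq_square)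
      show "integrable (gibbsP \<phi> I) (\<lambda>x. \<integral>t. G j (x(i := t)) * G j (x(i := t)) \<partial>gibbs1 (\<phi> i))"
        by (rule qgrow_integrable[where \<phi>=\<phi>, OF pot insert.hyps(1) slG2(3)[OF j' j']])
      show "(H j x)\<^sup>2 \<le> (\<integral>t. G j (x(i := t)) * G j (x(i := t)) \<partial>gibbs1 (\<phi> i))"
        if "x \<in> space (gibbsP \<phi> I)" for x
        using square_integral_le[OF prob_space_axioms, of "\<lambda>t. G j (x(i := t))"]
          slG(2)[OF j', of x] slG2(2)[OF j' j', of x] that
        unfolding H_def power2_eq_square by simp
    qed
    also have "\<dots> = (\<integral>x. (G j x)\<^sup>2 \<partial>gibbsP \<phi> (insert i I))"
      using slG2(4)[OF j' j'] by (simp add: power2_eq_square)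
    finally show ?thesis .
  qed
  have ii: "i \<in> insert i I" by simp
  have "(\<integral>x. (f x)\<^sup>2 \<partial>gibbsP \<phi> (insert i I)) = (\<integral>x. \<integral>t. f (x(i := t)) * f (x(i := t)) \<partial>gibbs1 (\<phi> i) \<partial>gibbsP \<phi> I)"
    using slf2(4) by (simp add: power2_eq_square)
  also have "\<dots> \<le> (\<integral>x. (F x)\<^sup>2 + (1 / \<kappa>) * (\<integral>t. G i (x(i := t)) * G i (x(i := t)) \<partial>gibbs1 (\<phi> i)) \<partial>gibbsP \<phi> I)"
  proof (rule integral_mono)
    show "integrable (gibbsP \<phi> I) (\<lambda>x. \<integral>t. f (x(i := t)) * f (x(i := t)) \<partial>gibbs1 (\<phi> i))"
      by (rule qgrow_integrable[where \<phi>=\<phi>, OF pot insert.hyps(1) slf2(3)])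
    show "integrable (gibbsP \<phi> I) (\<lambda>x. (F x)\<^sup>2 + (1 / \<kappa>) * (\<integral>t. G i (x(i := t)) * G i (x(i := t)) \<partial>gibbs1 (\<phi> i)))"
      using qgrow_integrable[where \<phi>=\<phi>, OF pot insert.hyps(1) lgrow_mult[OF insert.hyps(1) lF lF]]
        qgrow_integrable[where \<phi>=\<phi>, OF pot insert.hyps(1) slG2(3)[OF ii ii]]
      by (intro Bochner_Integration.integrable_add integrable_mult_right) (simp_all add: power2_eq_square)
    show "(\<integral>t. f (x(i := t)) * f (x(i := t)) \<partial>gibbs1 (\<phi> i))
      \<le> (F x)\<^sup>2 + (1 / \<kappa>) * (\<integral>t. G i (x(i := t)) * G i (x(i := t)) \<partial>gibbs1 (\<phi> i))"
      if x: "x \<in> space (gibbsP \<phi> I)" for x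
    proof -
      have x: "x \<in> extensional I" using x by simp
      have "(\<integral>t. (f (x(i := t)))\<^sup>2 \<partial>gibbs1 (\<phi> i)) \<le> (\<integral>t. f (x(i := t)) \<partial>gibbs1 (\<phi> i))\<^sup>2
          + (1 / \<kappa>) * (\<integral>t. (G i (x(i := t)))\<^sup>2 \<partial>gibbs1 (\<phi> i))"
        by (rule poincare_1d[OF pot, where L=L]) (intro df cf bf ii ext[OF x] extensional_upd[OF x])+
      then show ?thesis by (simp add: F_def power2_eq_square)
    qed
  qed
  also have "\<dots> = (\<integral>x. (F x)\<^sup>2 \<partial>gibbsP \<phi> I) + (1 / \<kappa>) * (\<integral>x. \<integral>t. G i (x(i := t)) * G i (x(i := t)) \<partial>gibbs1 (\<phi> i) \<partial>gibbsP \<phi> I)"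
    using qgrow_integrable[where \<phi>=\<phi>, OF pot insert.hyps(1) lgrow_mult[OF insert.hyps(1) lF lF]]
        qgrow_integrable[where \<phi>=\<phi>, OF pot insert.hyps(1) slG2(3)[OF ii ii]]
    by (subst Bochner_Integration.integral_add) (simp_all add: power2_eq_square)
  also have "(\<integral>x. \<integral>t. G i (x(i := t)) * G i (x(i := t)) \<partial>gibbs1 (\<phi> i) \<partial>gibbsP \<phi> I) = (\<integral>x. (G i x)\<^sup>2 \<partial>gibbsP \<phi> (insert i I))"
    using slG2(4)[OF ii ii] by (simp add: power2_eq_square)
  also have "(\<integral>x. (F x)\<^sup>2 \<partial>gibbsP \<phi> I) \<le> (\<integral>x. F x \<partial>gibbsP \<phi> I)\<^sup>2 + (1 / \<kappa>) * (\<Sum>j\<in>I. \<integral>x. (G j x)\<^sup>2 \<partial>gibbsP \<phi> (insert i I))"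
    using sum_mono[of I "\<lambda>j. \<integral>x. (H j x)\<^sup>2 \<partial>gibbsP \<phi> I", OF Hint] k
    by (intro order_trans[OF IH] add_left_mono mult_left_mono) auto
  finally show ?case
    using insert.hyps by (simp add: Fint algebra_simps)
qed

section \<open>Product measures and mean-field approximation\<close>

lemma DERIV_quadratic_error:
  fixes f :: "real \<Rightarrow> real"
  assumes "\<And>t. \<bar>f t - f s - d * (t - s)\<bar> \<le> C * (t - s)\<^sup>2"
  shows "(f has_real_derivative d) (at s)"
  unfolding has_field_derivative_iff
proof (rule LIM_zero_cancel, rule Lim_null_comparison)
  show "\<forall>\<^sub>F t in at s. norm ((f t - f s) / (t - s) - d) \<le> C * \<bar>t - s\<bar>"
    unfolding eventually_at_filter
  proof (intro always_eventually allI impI)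
    fix t assume t: "t \<noteq> s"
    have "\<bar>(f t - f s) / (t - s) - d\<bar> * \<bar>t - s\<bar> = \<bar>f t - f s - d * (t - s)\<bar>"
      using t by (simp add: field_simps flip: abs_mult)
    also have "\<dots> \<le> C * \<bar>t - s\<bar> * \<bar>t - s\<bar>"
      using assms[of t] by (simp add: power2_eq_square mult.assoc flip: abs_mult)
    finally show "norm ((f t - f s) / (t - s) - d) \<le> C * \<bar>t - s\<bar>"
      using t by simp
  qed
  have "((\<lambda>t. C * \<bar>t - s\<bar>) \<longlongrightarrow> C * \<bar>s - s\<bar>) (at s)" by (intro tendsto_intros)
  then show "((\<lambda>t. C * \<bar>t - s\<bar>) \<longlongrightarrow> 0) (at s)" by simp
qed

text \<open>Here \<open>u'\<close> is not assumed to be the derivative. The convexity inequality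
  from \<open>s\<close> to \<open>t\<close> and the one from \<open>t\<close> to \<open>s\<close>
  trap \<open>u t - u s - u' s * (t - s)\<close> between 0 and
  \<open>(u' t - u' s) * (t - s)\<close>, which the Lipschitz bound makes quadratic in
  \<open>t - s\<close>. All hypotheses are inequalities that survive averaging.\<close>

lemma sconvI:
  assumes k: "0 < \<kappa>"
    and conv: "\<And>s t. u s + u' s * (t - s) + \<kappa> / 2 * (t - s)\<^sup>2 \<le> u t"
    and lip: "\<And>s t. \<bar>u' t - u' s\<bar> \<le> M * \<bar>t - s\<bar>"
  shows "sconv \<kappa> M u u'"
  unfolding sconv_def
proof (intro conjI allI impI k)
  fix s
  show "(u has_real_derivative u' s) (at s)"
  proof (rule DERIV_quadratic_error)
    fix t
    have 0: "0 \<le> \<kappa> / 2 * (t - s)\<^sup>2" using k by simp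
    have 1: "0 \<le> u t - u s - u' s * (t - s)"
      using conv[of s t] 0 by linarith
    have "u t - u s - u' s * (t - s) \<le> (u' t - u' s) * (t - s)"
      using conv[of t s] 0 by (simp add: algebra_simps power2_commute)
    also have "\<dots> \<le> \<bar>u' t - u' s\<bar> * \<bar>t - s\<bar>" by (simp flip: abs_mult)
    also have "\<dots> \<le> M * \<bar>t - s\<bar> * \<bar>t - s\<bar>" by (intro mult_right_mono lip) auto
    also have "\<dots> = M * (t - s)\<^sup>2" by (simp add: power2_eq_square mult.assoc flip: abs_mult)
    finally show "\<bar>u t - u s - u' s * (t - s)\<bar> \<le> M * (t - s)\<^sup>2" using 1 by simp
  qed
next
  fix s t :: real assume st: "s \<le> t"
  show "u' t - u' s \<le> M * (t - s)" using lip[of t s] st by simp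
  show "\<kappa> * (t - s) \<le> u' t - u' s"
  proof (cases "s = t")
    case False
    have "\<kappa> * (t - s)\<^sup>2 \<le> (u' t - u' s) * (t - s)"
      using conv[of s t] conv[of t s] by (simp add: algebra_simps power2_commute)
    then have "\<kappa> * (t - s) * (t - s) \<le> (u' t - u' s) * (t - s)" by (simp add: power2_eq_square mult.assoc)
    then show ?thesis using st False by (simp add: mult_le_cancel_right)
  qed simp
qed

lemma sconv_normalize:
  assumes "sconv \<kappa> M u u'"
  obtains c where "potential \<kappa> M (\<lambda>t. u t + c)" "deriv (\<lambda>t. u t + c) = u'"
proof
  have k: "\<kappa> > 0" using assms by (simp add: sconv_def)
  have um: "u \<in> borel_measurable borel"
    by (intro borel_measurable_continuous_onI sconv_continuous[OF assms])
  have i: "integrable lborel (\<lambda>t. exp (- u t))"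
    using sconv_integrable[OF assms, of "\<lambda>_. 1" 1] by simp
  define Z where "Z = (\<integral>t. exp (- u t) \<partial>lborel)"
  have "0 < Z"
  proof -
    have "(\<integral>\<^sup>+t. ennreal (exp (- u t)) \<partial>lborel) \<noteq> 0"
    proof
      assume "(\<integral>\<^sup>+t. ennreal (exp (- u t)) \<partial>lborel) = 0"
      then have "AE t in lborel. ennreal (exp (- u t)) = 0"
        using um by (subst (asm) nn_integral_0_iff_AE) auto
      then have "AE t in lborel::real measure. False" by simp
      then show False by (simp add: eventually_False ae_filter_eq_bot_iff)
    qed
    then have "ennreal Z \<noteq> 0" using nn_integral_eq_integral[OF i] by (simp add: Z_def)
    then show ?thesis by (simp add: ennreal_eq_0_iff not_le)
  qed
  have d: "((\<lambda>t. u t + ln Z) has_real_derivative u' t) (at t)" for t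
    by (auto intro!: derivative_eq_intros sconv_DERIV[OF assms])
  show dd: "deriv (\<lambda>t. u t + ln Z) = u'" using DERIV_imp_deriv[OF d] by auto
  have "(\<integral>\<^sup>+t. ennreal (exp (- (u t + ln Z))) \<partial>lborel) = (\<integral>\<^sup>+t. ennreal (inverse Z) * ennreal (exp (- u t)) \<partial>lborel)"
    using \<open>0 < Z\<close> by (intro nn_integral_cong) (simp add: exp_diff exp_minus field_simps flip: ennreal_mult')
  also have "\<dots> = ennreal (inverse Z) * ennreal Z"
    using um nn_integral_eq_integral[OF i] by (simp add: nn_integral_cmult Z_def)
  also have "\<dots> = 1" using \<open>0 < Z\<close> by (simp flip: ennreal_mult')
  finally show "potential \<kappa> M (\<lambda>t. u t + ln Z)"
    using assms d dd by (simp add: potential_def sconv_def)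
qed

lemma measurable_upd_UNIV[measurable]:
  assumes "f \<in> measurable N (PiM UNIV (\<lambda>_. borel))" "h \<in> borel_measurable N"
  shows "(\<lambda>x. (f x)(i := h x)) \<in> measurable N (PiM UNIV (\<lambda>_. borel))"
  using assms by (intro measurable_fun_upd[where J=UNIV]) auto

lemma qgrow_upd:
  fixes f :: "('i::finite \<Rightarrow> real) \<Rightarrow> real"
  assumes "qgrow UNIV f" shows "qgrow UNIV (\<lambda>x. f (x(i := s)))"
proof -
  note [measurable] = qgrow_measurable[OF assms]
  obtain C where C: "0 \<le> C" "\<And>x. \<bar>f x\<bar> \<le> C * (1 + (\<Sum>i\<in>UNIV. (x i)\<^sup>2))"
    using qgrow_bound[OF assms] by auto
  have "\<bar>f (x(i := s))\<bar> \<le> (C * (1 + s\<^sup>2)) * (1 + (\<Sum>i\<in>UNIV. (x i)\<^sup>2))" for x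
  proof -
    have q: "0 \<le> (\<Sum>i\<in>UNIV. (x i)\<^sup>2)" by (intro sum_nonneg) auto
    have "(\<Sum>j\<in>UNIV. ((x(i := s)) j)\<^sup>2) = s\<^sup>2 + (\<Sum>j\<in>UNIV - {i}. (x j)\<^sup>2)"
      by (subst sum.remove[of UNIV i]) (auto intro!: sum.cong)
    also have "\<dots> \<le> s\<^sup>2 + (\<Sum>j\<in>UNIV. (x j)\<^sup>2)" by (intro add_left_mono sum_mono2) auto
    finally have "\<bar>f (x(i := s))\<bar> \<le> C * (1 + (s\<^sup>2 + (\<Sum>j\<in>UNIV. (x j)\<^sup>2)))"
      using C(1) by (intro order_trans[OF C(2)] mult_left_mono) auto
    also have "\<dots> \<le> C * ((1 + s\<^sup>2) * (1 + (\<Sum>i\<in>UNIV. (x i)\<^sup>2)))"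
      using C(1) q by (intro mult_left_mono) (auto simp: algebra_simps)
    finally show ?thesis by (simp only: mult.assoc)
  qed
  moreover have "(\<lambda>x. f (x(i := s))) \<in> borel_measurable (PiM UNIV (\<lambda>_. borel))" by measurable
  ultimately show ?thesis unfolding qgrow_def by blast
qed

lemma qgrow_between:
  assumes [measurable]: "f \<in> borel_measurable (PiM I (\<lambda>_. borel))" and "qgrow I g" "qgrow I h"
    and le: "\<And>x. x \<in> extensional I \<Longrightarrow> g x \<le> f x" "\<And>x. x \<in> extensional I \<Longrightarrow> f x \<le> h x"
  shows "qgrow I f"
proof -
  obtain C D where C: "\<And>x. x \<in> extensional I \<Longrightarrow> \<bar>g x\<bar> \<le> C * (1 + (\<Sum>i\<in>I. (x i)\<^sup>2))" "0 \<le> C"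
    and D: "\<And>x. x \<in> extensional I \<Longrightarrow> \<bar>h x\<bar> \<le> D * (1 + (\<Sum>i\<in>I. (x i)\<^sup>2))" "0 \<le> D"
    using assms(2,3)[THEN qgrow_bound] by blast
  have "\<bar>f x\<bar> \<le> (C + D) * (1 + (\<Sum>i\<in>I. (x i)\<^sup>2))" if x: "x \<in> extensional I" for x
  proof -
    have "0 \<le> 1 + (\<Sum>i\<in>I. (x i)\<^sup>2)" by (intro add_nonneg_nonneg sum_nonneg) auto
    then have "0 \<le> C * (1 + (\<Sum>i\<in>I. (x i)\<^sup>2))" "0 \<le> D * (1 + (\<Sum>i\<in>I. (x i)\<^sup>2))" 
      using C D by auto
    then show ?thesis using C(1)[OF x] D(1)[OF x] le[OF x] unfolding distrib_right by linarith
  qed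
  then show ?thesis using assms(1) unfolding qgrow_def by blast
qed

abbreviation prod_pot :: "('i \<Rightarrow> real \<Rightarrow> real) \<Rightarrow> ('i::finite \<Rightarrow> real) \<Rightarrow> real" where
  "prod_pot \<phi> x \<equiv> \<Sum>i\<in>UNIV. \<phi> i (x i)"

lemma qgrow_potential:
  fixes \<phi> :: "'i::finite \<Rightarrow> real \<Rightarrow> real"
  assumes pot: "potential \<kappa> M h"
  shows "qgrow UNIV (\<lambda>x::'i \<Rightarrow> real. h (x i))" "lgrow UNIV (\<lambda>x::'i \<Rightarrow> real. deriv h (x i))"
  using sconv_growth[OF potential_sconv[OF pot]] sconv_growth'[OF potential_sconv[OF pot]]
    potential_measurable[OF pot] potential_measurable'[OF pot]
  by (auto intro!: qgrow_component lgrow_component)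

lemma qgrow_prod_pot:
  fixes \<phi> :: "'i::finite \<Rightarrow> real \<Rightarrow> real"
  assumes pot: "\<And>i. potential \<kappa> M (\<phi> i)"
  shows "qgrow UNIV (prod_pot \<phi>)"
  by (intro qgrow_sum qgrow_potential[OF pot])

section \<open>Resampling one coordinate, and densities of product measures\<close>

lemma distr_resample:
  fixes \<phi> :: "'i::finite \<Rightarrow> real \<Rightarrow> real"
  assumes pot: "\<And>i. potential \<kappa> M (\<phi> i)" and \<xi>: "potential \<kappa> M \<xi>"
  shows "distr (gibbsP \<phi> UNIV \<Otimes>\<^sub>M gibbs1 \<xi>) (PiM UNIV (\<lambda>_. borel)) (\<lambda>(x, t). x(i := t))
     = gibbsP (\<phi>(i := \<xi>)) UNIV"
proof -
  have pot': "potential \<kappa> M ((\<phi>(i := \<xi>)) j)" for j using pot \<xi> by simp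
  interpret P: product_sigma_finite "\<lambda>j. gibbs1 ((\<phi>(i := \<xi>)) j)"
    by (rule product_sigma_finite_gibbs1[where \<phi>="\<phi>(i := \<xi>)", OF pot'])
  interpret Q: product_sigma_finite "\<lambda>j. gibbs1 (\<phi> j)"
    by (rule product_sigma_finite_gibbs1[where \<phi>=\<phi>, OF pot])
  interpret \<xi>: prob_space "gibbs1 \<xi>" by (rule prob_space_gibbs1[OF \<xi>])
  interpret N: prob_space "gibbsP \<phi> UNIV" by (rule prob_space_gibbsP[where \<phi>=\<phi>, OF pot])
  interpret NX: pair_prob_space "gibbsP \<phi> UNIV" "gibbs1 \<xi>" ..
  show ?thesis
  proof (rule P.PiM_eqI)
    fix A assume "\<And>j. j \<in> UNIV \<Longrightarrow> A j \<in> sets (gibbs1 ((\<phi>(i := \<xi>)) j))"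
    then have A[measurable]: "A j \<in> sets borel" for j by simp
    \<comment> \<open>The old value of coordinate \<open>i\<close> is overwritten by the update, so
      the preimage of the box leaves it unconstrained.\<close>
    let ?B = "PiE UNIV (A(i := UNIV))"
    have B: "?B \<in> sets (gibbsP \<phi> UNIV)" by (intro sets_PiM_I_finite) auto
    have A': "Pi\<^sub>E UNIV A \<in> sets (PiM UNIV (\<lambda>_. borel :: real measure))" by (intro sets_PiM_I_finite) auto
    have v: "(\<lambda>(x, t). x(i := t)) -` Pi\<^sub>E UNIV A \<inter> space (gibbsP \<phi> UNIV \<Otimes>\<^sub>M gibbs1 \<xi>) = ?B \<times> A i"
      by (auto simp: space_pair_measure PiE_def Pi_def split: if_splits)
    have "emeasure (distr (gibbsP \<phi> UNIV \<Otimes>\<^sub>M gibbs1 \<xi>) (PiM UNIV (\<lambda>_. borel)) (\<lambda>(x, t). x(i := t))) (Pi\<^sub>E UNIV A)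
      = emeasure (gibbsP \<phi> UNIV \<Otimes>\<^sub>M gibbs1 \<xi>) (?B \<times> A i)"
      using A' by (subst emeasure_distr) (auto simp: v)
    also have "\<dots> = emeasure (gibbsP \<phi> UNIV) ?B * emeasure (gibbs1 \<xi>) (A i)"
      using B by (intro \<xi>.emeasure_pair_measure_Times) auto
    also have "emeasure (gibbsP \<phi> UNIV) ?B = (\<Prod>j\<in>UNIV. emeasure (gibbs1 (\<phi> j)) ((A(i := UNIV)) j))"
      by (intro Q.emeasure_PiM) auto
    also have "\<dots> = (\<Prod>j\<in>UNIV - {i}. emeasure (gibbs1 (\<phi> j)) (A j))"
      using prob_space.emeasure_space_1[OF prob_space_gibbs1[OF pot]]
      by (subst prod.remove[of UNIV i]) (auto intro!: prod.cong)
    also have "\<dots> * emeasure (gibbs1 \<xi>) (A i) = (\<Prod>j\<in>UNIV. emeasure (gibbs1 ((\<phi>(i := \<xi>)) j)) (A j))"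
      by (subst prod.remove[of UNIV i "\<lambda>j. emeasure (gibbs1 ((\<phi>(i := \<xi>)) j)) (A j)"])
         (auto intro!: prod.cong simp: mult.commute)
    finally show "emeasure (distr (gibbsP \<phi> UNIV \<Otimes>\<^sub>M gibbs1 \<xi>) (PiM UNIV (\<lambda>_. borel)) (\<lambda>(x, t). x(i := t))) (Pi\<^sub>E UNIV A)
      = (\<Prod>j\<in>UNIV. emeasure (gibbs1 ((\<phi>(i := \<xi>)) j)) (A j))" .
  qed simp_all
qed

text \<open>Used in two ways: with a new potential, to see how the free energy depends on one
  factor, and with \<open>\<xi> = \<phi> i\<close>, where it is the tower property of conditioning
  on coordinate \<open>i\<close>.\<close>

lemma integral_resample:
  fixes \<phi> :: "'i::finite \<Rightarrow> real \<Rightarrow> real"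
  assumes pot: "\<And>i. potential \<kappa> M (\<phi> i)" and \<xi>: "potential \<kappa> M \<xi>" and f: "qgrow UNIV f"
  shows "integrable (gibbs1 \<xi>) (\<lambda>t. \<integral>x. f (x(i := t)) \<partial>gibbsP \<phi> UNIV)"
    and "(\<integral>t. \<integral>x. f (x(i := t)) \<partial>gibbsP \<phi> UNIV \<partial>gibbs1 \<xi>) = (\<integral>x. f x \<partial>gibbsP (\<phi>(i := \<xi>)) UNIV)"
proof -
  have pot': "potential \<kappa> M ((\<phi>(i := \<xi>)) j)" for j using pot \<xi> by simp
  note [measurable] = qgrow_measurable[OF f]
  interpret \<xi>: prob_space "gibbs1 \<xi>" by (rule prob_space_gibbs1[OF \<xi>])
  interpret N: prob_space "gibbsP \<phi> UNIV" by (rule prob_space_gibbsP[where \<phi>=\<phi>, OF pot])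
  interpret NX: pair_prob_space "gibbsP \<phi> UNIV" "gibbs1 \<xi>" ..
  note d = distr_resample[where \<phi>=\<phi>, OF pot \<xi>, of i]
  have m: "(\<lambda>(x, t). x(i := t)) \<in> measurable (gibbsP \<phi> UNIV \<Otimes>\<^sub>M gibbs1 \<xi>) (PiM UNIV (\<lambda>_. borel))"
    by measurable
  have fm: "f \<in> borel_measurable (PiM UNIV (\<lambda>_. borel))" by measurable
  have "integrable (distr (gibbsP \<phi> UNIV \<Otimes>\<^sub>M gibbs1 \<xi>) (PiM UNIV (\<lambda>_. borel)) (\<lambda>(x, t). x(i := t))) f"
    unfolding d by (rule qgrow_integrable[where \<phi>="\<phi>(i := \<xi>)", OF pot' _ f]) simp
  then have i: "integrable (gibbsP \<phi> UNIV \<Otimes>\<^sub>M gibbs1 \<xi>) (\<lambda>(x, t). f (x(i := t)))"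
    using integrable_distr_eq[OF m fm] by (simp add: case_prod_beta')
  show "integrable (gibbs1 \<xi>) (\<lambda>t. \<integral>x. f (x(i := t)) \<partial>gibbsP \<phi> UNIV)"
    by (rule NX.integrable_snd[OF i])
  have "(\<integral>t. \<integral>x. f (x(i := t)) \<partial>gibbsP \<phi> UNIV \<partial>gibbs1 \<xi>) = (\<integral>(x, t). f (x(i := t)) \<partial>(gibbsP \<phi> UNIV \<Otimes>\<^sub>M gibbs1 \<xi>))"
    by (rule NX.integral_snd[OF i])
  also have "\<dots> = (\<integral>x. f x \<partial>distr (gibbsP \<phi> UNIV \<Otimes>\<^sub>M gibbs1 \<xi>) (PiM UNIV (\<lambda>_. borel)) (\<lambda>(x, t). x(i := t)))"
    using integral_distr[OF m fm] by (simp add: case_prod_beta')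
  finally show "(\<integral>t. \<integral>x. f (x(i := t)) \<partial>gibbsP \<phi> UNIV \<partial>gibbs1 \<xi>) = (\<integral>x. f x \<partial>gibbsP (\<phi>(i := \<xi>)) UNIV)"
    unfolding d .
qed

lemma gibbsP_density:
  fixes \<phi> :: "'i::finite \<Rightarrow> real \<Rightarrow> real"
  assumes pot: "\<And>i. potential \<kappa> M (\<phi> i)"
  shows "gibbsP \<phi> UNIV = density (PiM UNIV (\<lambda>_. lborel)) (\<lambda>x. ennreal (exp (- prod_pot \<phi> x)))"
proof -
  interpret P: product_sigma_finite "\<lambda>j. gibbs1 (\<phi> j)"
    by (rule product_sigma_finite_gibbs1[where \<phi>=\<phi>, OF pot])
  interpret L: product_sigma_finite "\<lambda>_::'i. lborel :: real measure" by unfold_locales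
  note [measurable] = potential_measurable[OF pot]
  show ?thesis
  proof (rule P.PiM_eqI[symmetric])
    fix A assume "\<And>j. j \<in> UNIV \<Longrightarrow> A j \<in> sets (gibbs1 (\<phi> j))"
    then have A[measurable]: "A j \<in> sets borel" for j by simp
    have A': "Pi\<^sub>E UNIV A \<in> sets (PiM UNIV (\<lambda>_. borel :: real measure))" by (intro sets_PiM_I_finite) auto
    have "emeasure (density (PiM UNIV (\<lambda>_. lborel)) (\<lambda>x. ennreal (exp (- prod_pot \<phi> x)))) (Pi\<^sub>E UNIV A)
       = (\<integral>\<^sup>+x. ennreal (exp (- prod_pot \<phi> x)) * indicator (Pi\<^sub>E UNIV A) x \<partial>PiM UNIV (\<lambda>_. lborel))"
      using A' by (intro emeasure_density) auto
    also have "\<dots> = (\<integral>\<^sup>+x. (\<Prod>j\<in>UNIV. ennreal (exp (- \<phi> j (x j))) * indicator (A j) (x j)) \<partial>PiM UNIV (\<lambda>_. lborel))"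
    proof (intro nn_integral_cong)
      fix x :: "'i \<Rightarrow> real"
      have "indicator (Pi\<^sub>E UNIV A) x = (\<Prod>j\<in>UNIV. indicator (A j) (x j) :: ennreal)"
        by (auto simp: indicator_def PiE_def Pi_def)
      then show "ennreal (exp (- prod_pot \<phi> x)) * indicator (Pi\<^sub>E UNIV A) x
          = (\<Prod>j\<in>UNIV. ennreal (exp (- \<phi> j (x j))) * indicator (A j) (x j))"
        by (simp add: prod.distrib prod_ennreal exp_sum flip: sum_negf)
    qed
    also have "\<dots> = (\<Prod>j\<in>UNIV. \<integral>\<^sup>+t. ennreal (exp (- \<phi> j t)) * indicator (A j) t \<partial>lborel)"
      by (intro L.product_nn_integral_prod) auto
    also have "\<dots> = (\<Prod>j\<in>UNIV. emeasure (gibbs1 (\<phi> j)) (A j))"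
      unfolding gibbs1_def by (intro prod.cong refl emeasure_density[symmetric]) auto
    finally show "emeasure (density (PiM UNIV (\<lambda>_. lborel)) (\<lambda>x. ennreal (exp (- prod_pot \<phi> x)))) (Pi\<^sub>E UNIV A)
       = (\<Prod>j\<in>UNIV. emeasure (gibbs1 (\<phi> j)) (A j))" .
  qed simp_all
qed

lemma integral_gibbsP:
  fixes \<phi> :: "'i::finite \<Rightarrow> real \<Rightarrow> real"
  assumes pot: "\<And>i. potential \<kappa> M (\<phi> i)" and f: "qgrow UNIV f"
  shows "(\<integral>x. f x \<partial>gibbsP \<phi> UNIV) = (\<integral>x. exp (- prod_pot \<phi> x) * f x \<partial>PiM UNIV (\<lambda>_. lborel))"
    and "integrable (PiM UNIV (\<lambda>_. lborel)) (\<lambda>x. exp (- prod_pot \<phi> x) * f x)"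
proof -
  have i: "integrable (gibbsP \<phi> UNIV) f"
    by (rule qgrow_integrable[where \<phi>=\<phi>, OF pot _ f]) simp
  have m[measurable]: "f \<in> borel_measurable (PiM UNIV (\<lambda>_. lborel))" "prod_pot \<phi> \<in> borel_measurable (PiM UNIV (\<lambda>_. lborel))"
    using qgrow_measurable[OF f] qgrow_measurable[OF qgrow_prod_pot[where \<phi>=\<phi>, OF pot]] by simp_all
  show "(\<integral>x. f x \<partial>gibbsP \<phi> UNIV) = (\<integral>x. exp (- prod_pot \<phi> x) * f x \<partial>PiM UNIV (\<lambda>_. lborel))"
    unfolding gibbsP_density[where \<phi>=\<phi>, OF pot] by (subst integral_real_density) auto
  show "integrable (PiM UNIV (\<lambda>_. lborel)) (\<lambda>x. exp (- prod_pot \<phi> x) * f x)"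
    using i unfolding gibbsP_density[where \<phi>=\<phi>, OF pot] by (subst (asm) integrable_real_density) auto
qed

text \<open>With densities \<open>p\<close>, \<open>r\<close>, Young's inequality splits \<open>(f - c) (r - p)\<close> into a variance term and the squared
  Hellinger distance, and the latter is at most the relative entropy.\<close>

lemma expectation_diff_le:
  fixes \<phi> \<psi> :: "'i::finite \<Rightarrow> real \<Rightarrow> real"
  assumes pot: "\<And>i. potential \<kappa> M (\<phi> i)" and pot': "\<And>i. potential \<kappa> M (\<psi> i)"
    and KL: "(\<integral>x. prod_pot \<psi> x - prod_pot \<phi> x \<partial>gibbsP \<phi> UNIV) \<le> \<delta>\<^sup>2"
    and \<delta>: "0 < \<delta>" "\<delta> \<le> 1 / 3"
    and f: "lgrow UNIV f"
    and V\<phi>: "(\<integral>x. (f x)\<^sup>2 \<partial>gibbsP \<phi> UNIV) \<le> (\<integral>x. f x \<partial>gibbsP \<phi> UNIV)\<^sup>2 + V"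
    and V\<psi>: "(\<integral>x. (f x)\<^sup>2 \<partial>gibbsP \<psi> UNIV) \<le> (\<integral>x. f x \<partial>gibbsP \<psi> UNIV)\<^sup>2 + V"
  shows "((\<integral>x. f x \<partial>gibbsP \<psi> UNIV) - (\<integral>x. f x \<partial>gibbsP \<phi> UNIV))\<^sup>2 \<le> 4 * V * \<delta>"
proof -
  interpret N: prob_space "gibbsP \<phi> UNIV" by (rule prob_space_gibbsP[where \<phi>=\<phi>, OF pot])
  interpret N': prob_space "gibbsP \<psi> UNIV" by (rule prob_space_gibbsP[where \<phi>=\<psi>, OF pot'])
  define L where "L = PiM (UNIV :: 'i set) (\<lambda>_. lborel :: real measure)"
  define p where "p x = exp (- prod_pot \<phi> x)" for x
  define r where "r x = exp (- prod_pot \<psi> x)" for x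
  note Ip = integral_gibbsP[where \<phi>=\<phi>, OF pot, folded L_def p_def]
  note Ir = integral_gibbsP[where \<phi>=\<psi>, OF pot', folded L_def r_def]
  define c where "c = (\<integral>x. f x \<partial>gibbsP \<phi> UNIV)"
  define D where "D = (\<integral>x. f x \<partial>gibbsP \<psi> UNIV) - c"
  have qf: "qgrow UNIV f" by (rule lgrow_imp_qgrow[OF _ f]) simp
  have qf2: "qgrow UNIV (\<lambda>x. (f x)\<^sup>2)" using lgrow_mult[OF _ f f] by (simp add: power2_eq_square)
  have q1: "qgrow UNIV (\<lambda>x. f x - c)" by (intro qgrow_diff qf qgrow_const)
  have q2: "qgrow UNIV (\<lambda>x. (f x - c)\<^sup>2)"
    using lgrow_mult[OF _ lgrow_diff[OF f lgrow_const[of UNIV c]] lgrow_diff[OF f lgrow_const[of UNIV c]]]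
    by (simp add: power2_eq_square)
  have q3: "qgrow UNIV (\<lambda>x. prod_pot \<psi> x - prod_pot \<phi> x)"
    using qgrow_prod_pot[where \<phi>=\<phi>, OF pot] qgrow_prod_pot[where \<phi>=\<psi>, OF pot'] by (rule qgrow_diff[rotated])
  have q4: "qgrow UNIV (\<lambda>x::'i \<Rightarrow> real. 1)" by (rule qgrow_const)
  have if\<phi>: "integrable (gibbsP \<phi> UNIV) f" "integrable (gibbsP \<phi> UNIV) (\<lambda>x. (f x)\<^sup>2)"
    by (rule qgrow_integrable[where \<phi>=\<phi>, OF pot _ qf] qgrow_integrable[where \<phi>=\<phi>, OF pot _ qf2], simp)+
  have if\<psi>: "integrable (gibbsP \<psi> UNIV) f" "integrable (gibbsP \<psi> UNIV) (\<lambda>x. (f x)\<^sup>2)"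
    by (rule qgrow_integrable[where \<phi>=\<psi>, OF pot' _ qf] qgrow_integrable[where \<phi>=\<psi>, OF pot' _ qf2], simp)+
  have v1: "(\<integral>x. (f x - c)\<^sup>2 \<partial>gibbsP \<phi> UNIV) \<le> V"
    using V\<phi> N.variance_eq[OF if\<phi>] by (simp add: c_def)
  have v2: "(\<integral>x. (f x - c)\<^sup>2 \<partial>gibbsP \<psi> UNIV) \<le> V + D\<^sup>2"
  proof -
    have "(\<integral>x. (f x - c)\<^sup>2 \<partial>gibbsP \<psi> UNIV) = (\<integral>x. (f x)\<^sup>2 \<partial>gibbsP \<psi> UNIV) + c\<^sup>2 - 2 * (\<integral>x. f x \<partial>gibbsP \<psi> UNIV) * c"
      unfolding power2_diff using if\<psi> N'.prob_space by simp
    then show ?thesis using V\<psi> by (simp add: D_def power2_diff)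
  qed
  have main: "\<bar>D\<bar> \<le> s * (2 * V + D\<^sup>2) + \<delta>\<^sup>2 / (2 * s)" if s: "0 < s" for s
  proof -
    \<comment> \<open>The pointwise majorant obtained from Young's inequality with weight
      \<open>s\<close>. The terms \<open>p x * 1\<close> and \<open>r x * 1\<close> cancel after
      integration, because both are probability densities; pointwise they complete the entropy
      integrand to one that dominates the Hellinger integrand.\<close>
    define R where "R x = s * (p x * (f x - c)\<^sup>2) + s * (r x * (f x - c)\<^sup>2)
       + 1 / (2 * s) * (p x * (prod_pot \<psi> x - prod_pot \<phi> x) - p x * 1 + r x * 1)" for x
    have iR: "integrable L R"
      unfolding R_def using Ip(2)[OF q2] Ir(2)[OF q2] Ip(2)[OF q3] Ip(2)[OF q4] Ir(2)[OF q4]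
      by (intro Bochner_Integration.integrable_add Bochner_Integration.integrable_diff integrable_mult_right)
    have pw: "\<bar>r x * (f x - c) - p x * (f x - c)\<bar> \<le> R x" for x
    proof -
      \<comment> \<open>The square roots of the densities \<open>p\<close> and \<open>r\<close>.
        Then \<open>prod_pot \<psi> x - prod_pot \<phi> x = 2 * ln (a / b)\<close>, and ln z \<le> z
        - 1 at z = b / a gives the comparison with \<open>(b - a)\<^sup>2\<close>.\<close>
      define a where "a = exp (- prod_pot \<phi> x / 2)"
      define b where "b = exp (- prod_pot \<psi> x / 2)"
      have ab: "a > 0" "b > 0" "p x = a\<^sup>2" "r x = b\<^sup>2"
        by (simp_all add: a_def b_def p_def r_def power2_eq_square flip: exp_add)
      have "prod_pot \<psi> x - prod_pot \<phi> x = 2 * ln (a / b)"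
        using ab by (simp add: ln_div) (simp add: a_def b_def)
      moreover have "1 - b / a \<le> ln (a / b)"
        using ln_le_minus_one[of "b / a"] ab by (simp add: ln_div)
      ultimately have "2 * (1 - b / a) \<le> prod_pot \<psi> x - prod_pot \<phi> x" by simp
      then have "a\<^sup>2 * (2 * (1 - b / a)) \<le> a\<^sup>2 * (prod_pot \<psi> x - prod_pot \<phi> x)" by (intro mult_left_mono) auto
      moreover have "a\<^sup>2 * (2 * (1 - b / a)) - a\<^sup>2 + b\<^sup>2 = (b - a)\<^sup>2"
        using ab by (simp add: power2_eq_square field_simps)
      ultimately have h: "(b - a)\<^sup>2 \<le> p x * (prod_pot \<psi> x - prod_pot \<phi> x) - p x * 1 + r x * 1"
        unfolding ab(3,4) by linarith
      define y where "y = \<bar>f x - c\<bar>"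
      have y: "y \<ge> 0" "y\<^sup>2 = (f x - c)\<^sup>2" by (auto simp: y_def)
      have "\<bar>r x * (f x - c) - p x * (f x - c)\<bar> = \<bar>(b\<^sup>2 - a\<^sup>2) * (f x - c)\<bar>"
        using ab by (simp add: algebra_simps)
      also have "b\<^sup>2 - a\<^sup>2 = (b - a) * (b + a)" by (simp add: power2_eq_square algebra_simps)
      also have "\<bar>(b - a) * (b + a) * (f x - c)\<bar> = \<bar>b - a\<bar> * ((b + a) * y)"
        using ab by (simp add: abs_mult y_def)
      also have "\<dots> \<le> 1 / (2 * s) * (b - a)\<^sup>2 + s / 2 * ((b + a) * y)\<^sup>2"
      proof -
        have "0 \<le> (\<bar>b - a\<bar> - s * ((b + a) * y))\<^sup>2" by simp
        then have "2 * s * (\<bar>b - a\<bar> * ((b + a) * y)) \<le> (b - a)\<^sup>2 + s\<^sup>2 * ((b + a) * y)\<^sup>2"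
          by (simp add: power2_diff power_mult_distrib mult_ac)
        then show ?thesis using s by (simp add: field_simps power2_eq_square)
      qed
      also have "((b + a) * y)\<^sup>2 \<le> 2 * (p x + r x) * (f x - c)\<^sup>2"
      proof -
        have "(b + a)\<^sup>2 \<le> 2 * (p x + r x)"
          using ab zero_le_power2[of "b - a"] by (simp add: power2_diff power2_sum)
        then show ?thesis unfolding power_mult_distrib y(2) by (intro mult_right_mono) auto
      qed
      then have "1 / (2 * s) * (b - a)\<^sup>2 + s / 2 * ((b + a) * y)\<^sup>2 \<le> R x"
        unfolding R_def using s h
        by (intro order_trans[OF add_mono[OF mult_left_mono[OF h] mult_left_mono]]) (auto simp: algebra_simps)
      finally show ?thesis .
    qed
    have "\<bar>D\<bar> = \<bar>\<integral>x. r x * (f x - c) - p x * (f x - c) \<partial>L\<bar>"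
    proof -
      have "(\<integral>x. r x * (f x - c) - p x * (f x - c) \<partial>L) = (\<integral>x. f x - c \<partial>gibbsP \<psi> UNIV) - (\<integral>x. f x - c \<partial>gibbsP \<phi> UNIV)"
        using Ip[OF q1] Ir[OF q1] by simp
      also have "\<dots> = D" using if\<phi> if\<psi> N.prob_space N'.prob_space by (simp add: D_def c_def)
      finally show ?thesis by simp
    qed
    also have "\<dots> \<le> (\<integral>x. \<bar>r x * (f x - c) - p x * (f x - c)\<bar> \<partial>L)" by (rule integral_abs_bound)
    also have "\<dots> \<le> (\<integral>x. R x \<partial>L)"
      using Ip(2)[OF q1] Ir(2)[OF q1] pw by (intro integral_mono integrable_abs iR) auto
    also have "\<dots> = s * (\<integral>x. (f x - c)\<^sup>2 \<partial>gibbsP \<phi> UNIV) + s * (\<integral>x. (f x - c)\<^sup>2 \<partial>gibbsP \<psi> UNIV)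
       + 1 / (2 * s) * ((\<integral>x. prod_pot \<psi> x - prod_pot \<phi> x \<partial>gibbsP \<phi> UNIV) - (\<integral>x. 1 \<partial>gibbsP \<phi> UNIV) + (\<integral>x. 1 \<partial>gibbsP \<psi> UNIV))"
      unfolding R_def Ip(1)[OF q2] Ir(1)[OF q2] Ip(1)[OF q3] Ip(1)[OF q4] Ir(1)[OF q4]
      using Ip(2)[OF q2] Ir(2)[OF q2] Ip(2)[OF q3] Ip(2)[OF q4] Ir(2)[OF q4]
      by (simp only: Bochner_Integration.integral_add Bochner_Integration.integral_diff
          Bochner_Integration.integrable_add Bochner_Integration.integrable_diff integrable_mult_right integral_mult_right_zero)
    also have "\<dots> \<le> s * V + s * (V + D\<^sup>2) + 1 / (2 * s) * \<delta>\<^sup>2"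
      using v1 v2 KL s N.prob_space N'.prob_space by (intro add_mono mult_left_mono) auto
    finally show ?thesis by (simp add: algebra_simps)
  qed
  have "0 \<le> (\<integral>x. (f x - c)\<^sup>2 \<partial>gibbsP \<phi> UNIV)" by simp
  then have V0: "0 \<le> V" using v1 by linarith
  have "D\<^sup>2 \<le> 4 * V * \<delta>"
  proof (cases "D = 0")
    case True then show ?thesis using V0 \<delta> by simp
  next
    case False
    define e where "e = \<bar>D\<bar>"
    have e: "e > 0" "D\<^sup>2 = e\<^sup>2" using False by (auto simp: e_def)
    \<comment> \<open>The weight \<open>\<delta> / e\<close> makes both the \<open>D\<^sup>2\<close>
      term and the entropy term multiples of \<open>\<delta> * e\<^sup>2\<close> after
      multiplication by \<open>e\<close>. Together they are
      \<open>3 / 2 * \<delta> * e\<^sup>2\<close>, which \<delta> \<le> 1 / 3 allows to be absorbed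
      into half of the left-hand side.\<close>
    have "e \<le> \<delta> / e * (2 * V + e\<^sup>2) + \<delta>\<^sup>2 / (2 * (\<delta> / e))"
      using main[of "\<delta> / e", unfolded e(2) e_def[symmetric]] e(1) \<delta>(1) by simp
    then have "e * e \<le> (\<delta> / e * (2 * V + e\<^sup>2) + \<delta>\<^sup>2 / (2 * (\<delta> / e))) * e"
      using e by (intro mult_right_mono) auto
    also have "\<dots> = 2 * V * \<delta> + 3 / 2 * \<delta> * e\<^sup>2"
    proof -
      have "\<delta> / e * (2 * V + e\<^sup>2) * e = \<delta> * (2 * V + e\<^sup>2)" using e by simp
      moreover have "\<delta>\<^sup>2 / (2 * (\<delta> / e)) * e = \<delta> / 2 * e\<^sup>2"
        using e \<delta> by (simp add: power2_eq_square)
      ultimately show ?thesis unfolding distrib_right by (simp add: algebra_simps)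
    qed
    also have "\<dots> \<le> 2 * V * \<delta> + 1 / 2 * e\<^sup>2"
      using \<delta> by (intro add_left_mono mult_right_mono) auto
    finally have "e\<^sup>2 \<le> 2 * V * \<delta> + 1 / 2 * e\<^sup>2" unfolding power2_eq_square[of e] .
    then show ?thesis unfolding e(2) by linarith
  qed
  then show ?thesis by (simp add: D_def c_def)
qed

section \<open>Mean-field approximation for a strongly convex potential\<close>

text \<open>To be applied to the potential of the leaves at a fixed root value. \<open>D\<close> is
  its gradient, a fact that follows from \<open>convex\<close> and \<open>lip\<close> as in
  \<open>sconvI\<close>, and \<open>H\<close> holds the mixed second derivatives; the derivative and
  boundedness conditions concern only \<open>i \<noteq> j\<close>. The factor 2 in
  \<open>offdiag\<close> lets \<open>S\<close> stand for a sum over unordered pairs.\<close>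

locale strongly_convex =
  fixes U :: "('i::finite \<Rightarrow> real) \<Rightarrow> real"
    and D :: "'i \<Rightarrow> ('i \<Rightarrow> real) \<Rightarrow> real"
    and H :: "'i \<Rightarrow> 'i \<Rightarrow> ('i \<Rightarrow> real) \<Rightarrow> real"
    and \<kappa> M S :: real
  assumes kappa_pos: "0 < \<kappa>"
    and convex: "U x + (\<Sum>i\<in>UNIV. D i x * (y i - x i)) + \<kappa> / 2 * (\<Sum>i\<in>UNIV. (y i - x i)\<^sup>2) \<le> U y"
    and lip: "\<bar>D i x - D i y\<bar> \<le> M * (\<Sum>j\<in>UNIV. \<bar>x j - y j\<bar>)"
    and DERIV_H: "i \<noteq> j \<Longrightarrow> ((\<lambda>t. D i (x(j := t))) has_real_derivative H i j (x(j := t))) (at t)"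
    and cont_H: "i \<noteq> j \<Longrightarrow> continuous_on UNIV (\<lambda>t. H i j (x(j := t)))"
    and bound_H: "i \<noteq> j \<Longrightarrow> \<bar>H i j x\<bar> \<le> M"
    and meas_U: "U \<in> borel_measurable (PiM UNIV (\<lambda>_. borel))"
    and meas_D: "D i \<in> borel_measurable (PiM UNIV (\<lambda>_. borel))"
    and meas_H: "H i j \<in> borel_measurable (PiM UNIV (\<lambda>_. borel))"
    and offdiag: "(\<Sum>i\<in>UNIV. \<Sum>j\<in>UNIV - {i}. (H i j x)\<^sup>2) \<le> 2 * S"
begin

lemma M_nonneg: "0 \<le> M"
proof -
  have "0 \<le> \<bar>D undefined (\<lambda>_. 1) - D undefined (\<lambda>_. 0)\<bar>" by simp
  also have "\<dots> \<le> M * (\<Sum>j\<in>(UNIV::'i set). \<bar>1 - 0\<bar>)" by (rule lip)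
  finally show ?thesis by (simp add: zero_le_mult_iff)
qed

lemma upd_diff: "(x(i := t)) j - (x(i := s)) j = (if j = i then t - s else 0)" for x :: "'i \<Rightarrow> real"
  by simp

lemma slice_convex: "U (x(i := s)) + D i (x(i := s)) * (t - s) + \<kappa> / 2 * (t - s)\<^sup>2 \<le> U (x(i := t))"
proof -
  have "(\<Sum>j\<in>UNIV. D j (x(i := s)) * ((x(i := t)) j - (x(i := s)) j)) = D i (x(i := s)) * (t - s)"
    unfolding upd_diff by (simp add: if_distrib sum.delta cong: if_cong)
  moreover have "(\<Sum>j\<in>UNIV. ((x(i := t)) j - (x(i := s)) j)\<^sup>2) = (t - s)\<^sup>2"
    unfolding upd_diff by (simp add: if_distrib[of "\<lambda>z. z\<^sup>2"] sum.delta cong: if_cong)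
  ultimately show ?thesis using convex[of "x(i := s)" "x(i := t)"] by metis
qed

lemma slice_lip: "\<bar>D i (x(i := t)) - D i (x(i := s))\<bar> \<le> M * \<bar>t - s\<bar>"
proof -
  have "(\<Sum>j\<in>UNIV. \<bar>(x(i := t)) j - (x(i := s)) j\<bar>) = \<bar>t - s\<bar>"
    unfolding upd_diff by (simp add: if_distrib[of abs] sum.delta cong: if_cong)
  then show ?thesis using lip[of i "x(i := t)" "x(i := s)"] by metis
qed

lemma lgrow_D: "lgrow UNIV (D i)"
  by (rule lgrow_lipschitz[OF meas_D lip])

lemma lgrow_coord: "lgrow UNIV (\<lambda>x::'i \<Rightarrow> real. x i)"
  by (rule lgrow_component[where h="\<lambda>t. t" and C=1]) auto

text \<open>Convexity from 0 to \<open>x\<close> gives an affine lower bound. Convexity from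
  \<open>x\<close> to 0 gives an upper bound by the products \<open>D i x * x i\<close>, quadratic
  because \<open>D i\<close> grows linearly.\<close>

lemma qgrow_U: "qgrow UNIV U"
proof (rule qgrow_between[OF meas_U])
  let ?z = "\<lambda>_::'i. 0::real"
  show "qgrow UNIV (\<lambda>x. U ?z + (\<Sum>i\<in>UNIV. D i ?z * x i))"
    by (intro qgrow_add qgrow_const qgrow_sum qgrow_cmult lgrow_imp_qgrow lgrow_coord) simp
  show "qgrow UNIV (\<lambda>x. U ?z + (\<Sum>i\<in>UNIV. D i x * x i))"
    by (intro qgrow_add qgrow_const qgrow_sum lgrow_mult lgrow_coord lgrow_D) simp
  fix x :: "'i \<Rightarrow> real"
  have "0 \<le> \<kappa> / 2 * (\<Sum>i\<in>UNIV. (x i)\<^sup>2)" using kappa_pos by (intro mult_nonneg_nonneg sum_nonneg) auto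
  then show "U ?z + (\<Sum>i\<in>UNIV. D i ?z * x i) \<le> U x" "U x \<le> U ?z + (\<Sum>i\<in>UNIV. D i x * x i)"
    using convex[of ?z x] convex[of x ?z] by (simp_all add: sum_negf)
qed

text \<open>The hypotheses of \<open>sconvI\<close> hold for every slice and are preserved by
  averaging. Thus the best response of one coordinate to the others stays in the class of
  potentials, with the same \<kappa> and \<open>M\<close>.\<close>

lemma sconv_average:
  assumes pot: "\<And>i. potential \<kappa> M (\<phi> i)"
  shows "sconv \<kappa> M (\<lambda>t. \<integral>x. U (x(i := t)) \<partial>gibbsP \<phi> UNIV) (\<lambda>t. \<integral>x. D i (x(i := t)) \<partial>gibbsP \<phi> UNIV)"
proof (rule sconvI[OF kappa_pos])
  interpret N: prob_space "gibbsP \<phi> UNIV" by (rule prob_space_gibbsP[where \<phi>=\<phi>, OF pot])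
  have iU: "integrable (gibbsP \<phi> UNIV) (\<lambda>x. U (x(i := t)))" for t
    by (rule qgrow_integrable[where \<phi>=\<phi>, OF pot _ qgrow_upd[OF qgrow_U]]) simp
  have iD: "integrable (gibbsP \<phi> UNIV) (\<lambda>x. D i (x(i := t)))" for t
    by (rule qgrow_integrable[where \<phi>=\<phi>, OF pot _ qgrow_upd[OF lgrow_imp_qgrow[OF _ lgrow_D]]]) simp_all
  fix s t
  have "(\<integral>x. U (x(i := s)) + D i (x(i := s)) * (t - s) + \<kappa> / 2 * (t - s)\<^sup>2 \<partial>gibbsP \<phi> UNIV)
     \<le> (\<integral>x. U (x(i := t)) \<partial>gibbsP \<phi> UNIV)"
    by (intro integral_mono Bochner_Integration.integrable_add integrable_mult_left iU iD slice_convex) auto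
  moreover have "(\<integral>x. U (x(i := s)) + D i (x(i := s)) * (t - s) + \<kappa> / 2 * (t - s)\<^sup>2 \<partial>gibbsP \<phi> UNIV)
     = (\<integral>x. U (x(i := s)) \<partial>gibbsP \<phi> UNIV) + (\<integral>x. D i (x(i := s)) \<partial>gibbsP \<phi> UNIV) * (t - s) + \<kappa> / 2 * (t - s)\<^sup>2"
    using iU[of s] iD[of s] N.prob_space
    by (simp only: Bochner_Integration.integral_add Bochner_Integration.integrable_add integrable_mult_left
        integrable_const integral_mult_left_zero N.integrable_const lebesgue_integral_const) simp
  ultimately show "(\<integral>x. U (x(i := s)) \<partial>gibbsP \<phi> UNIV) + (\<integral>x. D i (x(i := s)) \<partial>gibbsP \<phi> UNIV) * (t - s) + \<kappa> / 2 * (t - s)\<^sup>2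
     \<le> (\<integral>x. U (x(i := t)) \<partial>gibbsP \<phi> UNIV)" by simp
  have "(\<integral>x. D i (x(i := t)) \<partial>gibbsP \<phi> UNIV) - (\<integral>x. D i (x(i := s)) \<partial>gibbsP \<phi> UNIV)
      = (\<integral>x. D i (x(i := t)) - D i (x(i := s)) \<partial>gibbsP \<phi> UNIV)"
    by (rule Bochner_Integration.integral_diff[symmetric]) (rule iD)+
  also have "\<bar>\<dots>\<bar> \<le> (\<integral>x. \<bar>D i (x(i := t)) - D i (x(i := s))\<bar> \<partial>gibbsP \<phi> UNIV)"
    by (rule integral_abs_bound)
  also have "\<dots> \<le> (\<integral>x. M * \<bar>t - s\<bar> \<partial>gibbsP \<phi> UNIV)"
    by (intro integral_mono integrable_abs Bochner_Integration.integrable_diff iD slice_lip) simp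
  also have "\<dots> = M * \<bar>t - s\<bar>" using N.prob_space by simp
  finally show "\<bar>(\<integral>x. D i (x(i := t)) \<partial>gibbsP \<phi> UNIV) - (\<integral>x. D i (x(i := s)) \<partial>gibbsP \<phi> UNIV)\<bar> \<le> M * \<bar>t - s\<bar>" .
qed

text \<open>A one-dimensional slice of \<open>U\<close>, normalized. It shows that the class to be
  minimized over is nonempty and serves as a test potential for the finiteness of the partition
  function.\<close>

lemma exists_potential: "\<exists>h. potential \<kappa> M h"
proof -
  have "sconv \<kappa> M (\<lambda>t. U ((\<lambda>_. 0)(undefined := t))) (\<lambda>t. D undefined ((\<lambda>_. 0)(undefined := t)))"
    by (intro sconvI kappa_pos slice_convex slice_lip)
  from sconv_normalize[OF this] show ?thesis by metis
qed

lemma qgrow_grad_diff: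
  assumes pot: "\<And>i. potential \<kappa> M (\<phi> i)"
  shows "qgrow UNIV (\<lambda>x. (deriv (\<phi> i) (x i) - D i x)\<^sup>2)"
  unfolding power2_eq_square
  by (intro lgrow_mult lgrow_diff qgrow_potential(2)[OF pot] lgrow_D) simp

text \<open>The log-Sobolev inequality for the measure with density proportional to exp (- U): after
  taking logarithms, the relative entropy of the product measure is at most 1 / (2 \<kappa>) times
  its Fisher information. The hypothesis of \<open>tangent_PiM\<close> is the \<kappa>-convexity of
  \<open>U\<close> together with \<open>v * z \<le> v\<^sup>2 / (2 * \<kappa>) + \<kappa> / 2 *
  z\<^sup>2\<close>, where \<open>v\<close> is a component of the gradient mismatch and
  \<open>z\<close> one of the displacement.\<close>

lemma partition_function_le:
  assumes pot: "\<And>i. potential \<kappa> M (\<phi> i)"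
  shows "(\<integral>\<^sup>+x. ennreal (exp (- U x)) \<partial>PiM UNIV (\<lambda>_. lborel))
    \<le> ennreal (exp (\<integral>x. prod_pot \<phi> x - U x + 1 / (2 * \<kappa>) * (\<Sum>i\<in>UNIV. (deriv (\<phi> i) (x i) - D i x)\<^sup>2) \<partial>gibbsP \<phi> UNIV))"
proof (rule tangent_PiM[where \<phi>=\<phi>, OF pot])
  show "(\<lambda>x. exp (- U x)) \<in> borel_measurable (PiM UNIV (\<lambda>_. borel))"
    using meas_U by measurable
  show "qgrow UNIV (\<lambda>x. prod_pot \<phi> x - U x + 1 / (2 * \<kappa>) * (\<Sum>i\<in>UNIV. (deriv (\<phi> i) (x i) - D i x)\<^sup>2))"
    by (intro qgrow_add qgrow_diff qgrow_prod_pot[where \<phi>=\<phi>, OF pot] qgrow_U qgrow_cmult qgrow_sum qgrow_grad_diff[where \<phi>=\<phi>, OF pot])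
  fix x y :: "'i \<Rightarrow> real"
  let ?d = "\<lambda>i. deriv (\<phi> i) (x i)"
  have "- (D i x * (y i - x i)) - \<kappa> / 2 * (y i - x i)\<^sup>2 \<le> 1 / (2 * \<kappa>) * (?d i - D i x)\<^sup>2 - ?d i * (y i - x i)" for i
  proof -
    define v where "v = ?d i - D i x"
    define z where "z = y i - x i"
    have "0 \<le> (v - \<kappa> * z)\<^sup>2 / (2 * \<kappa>)" using kappa_pos by simp
    also have "\<dots> = 1 / (2 * \<kappa>) * v\<^sup>2 - v * z + \<kappa> / 2 * z\<^sup>2"
      using kappa_pos by (simp add: field_simps power2_eq_square)
    finally show ?thesis unfolding v_def[symmetric] z_def[symmetric] by (simp add: v_def z_def algebra_simps)
  qed
  then have "(\<Sum>i\<in>UNIV. - (D i x * (y i - x i)) - \<kappa> / 2 * (y i - x i)\<^sup>2)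
     \<le> (\<Sum>i\<in>UNIV. 1 / (2 * \<kappa>) * (?d i - D i x)\<^sup>2 - ?d i * (y i - x i))" by (rule sum_mono)
  then have "- U y \<le> prod_pot \<phi> x - U x + 1 / (2 * \<kappa>) * (\<Sum>i\<in>UNIV. (?d i - D i x)\<^sup>2)
      - (\<Sum>i\<in>UNIV. \<phi> i (x i) + ?d i * (y i - x i))"
    using convex[of x y] by (simp add: sum.distrib sum_subtractf sum_negf sum_distrib_left)
  then show "exp (- U y) \<le> exp (prod_pot \<phi> x - U x + 1 / (2 * \<kappa>) * (\<Sum>i\<in>UNIV. (?d i - D i x)\<^sup>2)
      - (\<Sum>i\<in>UNIV. \<phi> i (x i) + ?d i * (y i - x i)))" by simp
qed auto

text \<open>The mean-field free energy: the relative entropy of the product measure to the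
  normalized exp (- U), minus the logarithm of the partition function. That logarithm does not
  depend on \<phi>.\<close>

definition J :: "('i \<Rightarrow> real \<Rightarrow> real) \<Rightarrow> real" where
  "J \<phi> = (\<integral>x. U x - prod_pot \<phi> x \<partial>gibbsP \<phi> UNIV)"

lemma integrable_exp_U: "integrable (PiM UNIV (\<lambda>_. lborel)) (\<lambda>x. exp (- U x))"
proof -
  obtain h where h: "potential \<kappa> M h" using exists_potential by blast
  have [measurable]: "U \<in> borel_measurable (PiM UNIV (\<lambda>_. lborel))" using meas_U by simp
  have "(\<integral>\<^sup>+x. ennreal (exp (- U x)) \<partial>PiM UNIV (\<lambda>_. lborel)) < \<infinity>"
    using partition_function_le[of "\<lambda>_. h", OF h] by (rule le_less_trans) simp
  then show ?thesis by (intro integrableI_nonneg) auto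
qed

text \<open>Only boundedness from below matters, so the pointwise inequality 1 - exp u \<le> - u is
  used in place of the sharp lower bound, minus the logarithm of the partition function.\<close>

lemma J_lower_bound:
  assumes pot: "\<And>i. potential \<kappa> M (\<phi> i)"
  shows "1 - (\<integral>x. exp (- U x) \<partial>PiM UNIV (\<lambda>_. lborel)) \<le> J \<phi>"
proof -
  interpret N: prob_space "gibbsP \<phi> UNIV" by (rule prob_space_gibbsP[where \<phi>=\<phi>, OF pot])
  have q: "qgrow UNIV (\<lambda>x. U x - prod_pot \<phi> x)"
    by (intro qgrow_diff qgrow_prod_pot[where \<phi>=\<phi>, OF pot] qgrow_U)
  note I1 = integral_gibbsP[where \<phi>=\<phi>, OF pot q]
  note I2 = integral_gibbsP[where \<phi>=\<phi>, OF pot qgrow_const[of UNIV 1]]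
  have "(\<integral>x. exp (- prod_pot \<phi> x) * 1 - exp (- U x) \<partial>PiM UNIV (\<lambda>_. lborel))
     \<le> (\<integral>x. exp (- prod_pot \<phi> x) * (U x - prod_pot \<phi> x) \<partial>PiM UNIV (\<lambda>_. lborel))"
  proof (intro integral_mono Bochner_Integration.integrable_diff I1 I2 integrable_exp_U)
    fix x
    have "1 - exp (prod_pot \<phi> x - U x) \<le> U x - prod_pot \<phi> x"
      using exp_ge_add_one_self[of "prod_pot \<phi> x - U x"] by linarith
    then have "exp (- prod_pot \<phi> x) * (1 - exp (prod_pot \<phi> x - U x)) \<le> exp (- prod_pot \<phi> x) * (U x - prod_pot \<phi> x)"
      by (intro mult_left_mono) auto
    then show "exp (- prod_pot \<phi> x) * 1 - exp (- U x) \<le> exp (- prod_pot \<phi> x) * (U x - prod_pot \<phi> x)"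
      by (simp add: right_diff_distrib flip: exp_add)
  qed
  then have "(\<integral>x. exp (- prod_pot \<phi> x) * 1 \<partial>PiM UNIV (\<lambda>_. lborel)) - (\<integral>x. exp (- U x) \<partial>PiM UNIV (\<lambda>_. lborel)) \<le> J \<phi>"
    using I2(2) integrable_exp_U by (simp add: J_def I1(1))
  then show ?thesis using I2(1) N.prob_space by simp
qed

text \<open>Isolates the dependence on factor \<open>i\<close>. The first integral is a
  one-dimensional free energy for the averaged potential, so it is smallest when \<xi> is that
  average, normalized.\<close>

lemma J_upd:
  assumes pot: "\<And>i. potential \<kappa> M (\<phi> i)" and \<xi>: "potential \<kappa> M \<xi>"
  shows "J (\<phi>(i := \<xi>)) = (\<integral>t. (\<integral>x. U (x(i := t)) \<partial>gibbsP \<phi> UNIV) - \<xi> t \<partial>gibbs1 \<xi>)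
     - (\<Sum>j\<in>UNIV - {i}. \<integral>t. \<phi> j t \<partial>gibbs1 (\<phi> j))"
proof -
  have pot': "potential \<kappa> M ((\<phi>(i := \<xi>)) j)" for j using pot \<xi> by simp
  have hm: "h \<in> borel_measurable borel" if "potential \<kappa> M h" for h using potential_measurable[OF that] .
  have i1: "integrable (gibbs1 h) h" if "potential \<kappa> M h" for h
    by (rule potential_integrable[OF that hm[OF that] sconv_growth[OF potential_sconv[OF that]]])
  have iU: "integrable (gibbsP (\<phi>(i := \<xi>)) UNIV) U"
    by (rule qgrow_integrable[where \<phi>="\<phi>(i := \<xi>)", OF pot' _ qgrow_U]) simp
  have iP: "integrable (gibbsP (\<phi>(i := \<xi>)) UNIV) (\<lambda>x. (\<phi>(i := \<xi>)) j (x j))" for j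
    by (rule qgrow_integrable[where \<phi>="\<phi>(i := \<xi>)", OF pot' _ qgrow_potential(1)[OF pot']]) simp
  have "J (\<phi>(i := \<xi>)) = (\<integral>x. U x \<partial>gibbsP (\<phi>(i := \<xi>)) UNIV) - (\<Sum>j\<in>UNIV. \<integral>x. (\<phi>(i := \<xi>)) j (x j) \<partial>gibbsP (\<phi>(i := \<xi>)) UNIV)"
    unfolding J_def using iU iP
    by (subst Bochner_Integration.integral_diff) (auto intro!: Bochner_Integration.integrable_sum Bochner_Integration.integral_sum)
  also have "(\<Sum>j\<in>UNIV. \<integral>x. (\<phi>(i := \<xi>)) j (x j) \<partial>gibbsP (\<phi>(i := \<xi>)) UNIV)
     = (\<Sum>j\<in>UNIV. \<integral>t. (\<phi>(i := \<xi>)) j t \<partial>gibbs1 ((\<phi>(i := \<xi>)) j))"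
    by (intro sum.cong refl gibbsP_component(1)[where \<phi>="\<phi>(i := \<xi>)", OF pot'] hm pot') simp
  also have "\<dots> = (\<integral>t. \<xi> t \<partial>gibbs1 \<xi>) + (\<Sum>j\<in>UNIV - {i}. \<integral>t. \<phi> j t \<partial>gibbs1 (\<phi> j))"
    by (subst sum.remove[of UNIV i]) (auto intro!: sum.cong)
  also have "(\<integral>x. U x \<partial>gibbsP (\<phi>(i := \<xi>)) UNIV) = (\<integral>t. \<integral>x. U (x(i := t)) \<partial>gibbsP \<phi> UNIV \<partial>gibbs1 \<xi>)"
    by (rule integral_resample(2)[where \<phi>=\<phi>, OF pot \<xi> qgrow_U, symmetric])
  finally have *: "J (\<phi>(i := \<xi>)) = (\<integral>t. \<integral>x. U (x(i := t)) \<partial>gibbsP \<phi> UNIV \<partial>gibbs1 \<xi>)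
     - ((\<integral>t. \<xi> t \<partial>gibbs1 \<xi>) + (\<Sum>j\<in>UNIV - {i}. \<integral>t. \<phi> j t \<partial>gibbs1 (\<phi> j)))" .
  show ?thesis
    unfolding * Bochner_Integration.integral_diff[OF integral_resample(1)[where \<phi>=\<phi>, OF pot \<xi> qgrow_U] i1[OF \<xi>]]
    by simp
qed

lemma near_minimizer:
  assumes "0 < \<epsilon>"
  obtains \<phi> where "\<And>i. potential \<kappa> M (\<phi> i)"
    and "\<And>\<psi>. (\<And>i. potential \<kappa> M (\<psi> i)) \<Longrightarrow> J \<phi> \<le> J \<psi> + \<epsilon>"
proof -
  define A where "A = J ` {\<phi>. \<forall>i. potential \<kappa> M (\<phi> i)}"
  obtain h where h: "potential \<kappa> M h" using exists_potential by blast
  have ne: "A \<noteq> {}" using h by (auto simp: A_def intro!: exI[of _ "\<lambda>_. h"])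
  have bdd: "bdd_below A"
    using J_lower_bound by (auto simp: A_def intro!: bdd_belowI)
  have "Inf A < Inf A + \<epsilon>" using assms by simp
  then obtain v where "v \<in> A" "v < Inf A + \<epsilon>" using cInf_lessD[OF ne] by blast
  then obtain \<phi> where \<phi>: "\<And>i. potential \<kappa> M (\<phi> i)" "J \<phi> < Inf A + \<epsilon>" by (auto simp: A_def)
  have "J \<phi> \<le> J \<psi> + \<epsilon>" if "\<And>i. potential \<kappa> M (\<psi> i)" for \<psi>
  proof -
    have "Inf A \<le> J \<psi>" using that by (intro cInf_lower bdd) (auto simp: A_def)
    then show ?thesis using \<phi>(2) by simp
  qed
  with \<phi>(1) show thesis by (rule that)
qed

lemma lip_freeze: "\<bar>D i (x(i := t)) - D i (y(i := t))\<bar> \<le> M * (\<Sum>j\<in>UNIV. \<bar>x j - y j\<bar>)"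
proof -
  have "(\<Sum>j\<in>UNIV. \<bar>(x(i := t)) j - (y(i := t)) j\<bar>) \<le> (\<Sum>j\<in>UNIV. \<bar>x j - y j\<bar>)"
    by (intro sum_mono) auto
  then show ?thesis
    using lip[of i "x(i := t)" "y(i := t)"] mult_left_mono[OF _ M_nonneg] by (meson order_trans)
qed

text \<open>The Poincare inequality in all coordinates, for a function in which \<open>x i\<close>
  has been frozen. Its derivative in direction \<open>i\<close> is 0, which is the first case of
  \<open>G\<close>, so no diagonal second derivative appears.\<close>

lemma variance_slice_le:
  assumes pot: "\<And>i. potential \<kappa> M (\<phi> i)"
  shows "(\<integral>x. (D i (x(i := t)))\<^sup>2 \<partial>gibbsP \<phi> UNIV) \<le> (\<integral>x. D i (x(i := t)) \<partial>gibbsP \<phi> UNIV)\<^sup>2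
      + (1 / \<kappa>) * (\<Sum>j\<in>UNIV - {i}. \<integral>x. (H i j (x(i := t)))\<^sup>2 \<partial>gibbsP \<phi> UNIV)"
proof -
  note [measurable] = meas_D meas_H
  define G where "G j x = (if j = i then 0 else H i j (x(i := t)))" for j and x :: "'i \<Rightarrow> real"
  have tw: "x(j := s, i := t) = x(i := t, j := s)" if "j \<noteq> i" for x :: "'i \<Rightarrow> real" and j s
    using that by (intro fun_upd_twist) auto
  have "(\<integral>x. (D i (x(i := t)))\<^sup>2 \<partial>gibbsP \<phi> UNIV) \<le> (\<integral>x. D i (x(i := t)) \<partial>gibbsP \<phi> UNIV)\<^sup>2
      + (1 / \<kappa>) * (\<Sum>j\<in>UNIV. \<integral>x. (G j x)\<^sup>2 \<partial>gibbsP \<phi> UNIV)"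
  proof (rule poincare_PiM[where \<phi>=\<phi>, OF pot, where L=M])
    show "(\<lambda>x. D i (x(i := t))) \<in> borel_measurable (PiM UNIV (\<lambda>_. borel))" by measurable
    show "G j \<in> borel_measurable (PiM UNIV (\<lambda>_. borel))" for j
      unfolding G_def by (cases "j = i") (simp_all, measurable)
    show "\<bar>D i (x(i := t)) - D i (y(i := t))\<bar> \<le> M * (\<Sum>j\<in>UNIV. \<bar>x j - y j\<bar>)" for x y
      by (rule lip_freeze)
    show "((\<lambda>s. D i (x(j := s, i := t))) has_real_derivative G j (x(j := s))) (at s)" for j x s
    proof (cases "j = i")
      case False
      then show ?thesis unfolding G_def using DERIV_H[of i j "x(i := t)" s] by (simp only: tw if_False) (auto simp: tw)
    qed (simp add: G_def)
    show "continuous_on UNIV (\<lambda>s. G j (x(j := s)))" for j x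
    proof (cases "j = i")
      case False
      then show ?thesis unfolding G_def using cont_H[of i j "x(i := t)"] by (simp add: tw)
    qed (simp add: G_def)
    show "\<bar>G j x\<bar> \<le> M" for j x
      using bound_H[of i j "x(i := t)"] M_nonneg by (auto simp: G_def)
  qed simp
  also have "(\<Sum>j\<in>UNIV. \<integral>x. (G j x)\<^sup>2 \<partial>gibbsP \<phi> UNIV) = (\<Sum>j\<in>UNIV - {i}. \<integral>x. (H i j (x(i := t)))\<^sup>2 \<partial>gibbsP \<phi> UNIV)"
    by (subst sum.remove[of UNIV i]) (auto intro!: sum.cong simp: G_def)
  finally show ?thesis .
qed

lemma lgrow_slice: "lgrow UNIV (\<lambda>x. D i (x(i := t)))"
proof (rule lgrow_lipschitz)
  note [measurable] = meas_D
  show "(\<lambda>x. D i (x(i := t))) \<in> borel_measurable (PiM UNIV (\<lambda>_. borel))" by measurable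
  show "\<bar>D i (x(i := t)) - D i (y(i := t))\<bar> \<le> M * (\<Sum>j\<in>UNIV. \<bar>x j - y j\<bar>)" for x y
    by (rule lip_freeze)
qed

lemma lgrow_H: "i \<noteq> j \<Longrightarrow> lgrow UNIV (H i j)"
  by (rule lgrow_bounded[OF meas_H bound_H])

text \<open>In exponential form, the statement that the relative entropy of the product measure to
  the normalized exp (- U) is at most \<open>S / \<kappa>\<^sup>2 + \<epsilon>\<close>. The witness
  is the family \<psi> of best responses constructed below, not the near minimizer.\<close>

theorem mean_field_bound:
  assumes \<epsilon>: "0 < \<epsilon>"
  obtains \<phi> where "\<And>i. potential \<kappa> M (\<phi> i)"
    and "(\<integral>\<^sup>+x. ennreal (exp (- U x)) \<partial>PiM UNIV (\<lambda>_. lborel))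
      \<le> ennreal (exp ((\<integral>x. prod_pot \<phi> x - U x \<partial>gibbsP \<phi> UNIV) + S / \<kappa>\<^sup>2 + \<epsilon>))"
proof -
  note k = kappa_pos
  define m where "m = real CARD('i)"
  have m: "m > 0" by (simp add: m_def)
  define V where "V = m * M\<^sup>2 / \<kappa>"
  have V: "0 \<le> V" using m k by (simp add: V_def)
  \<comment> \<open>Each coordinate has a squared bias of at most \<open>4 * V * \<delta>\<close>;
    summing over \<open>m\<close> coordinates and multiplying by the log-Sobolev factor
    \<open>1 / (2 * \<kappa>)\<close> gives \<open>2 * m * V * \<delta> / \<kappa>\<close>, to be
    kept below \<epsilon>. The cap \<open>1 / 3\<close> is the one in
    \<open>expectation_diff_le\<close>, and the added 1 makes the denominator positive.\<close>
  define \<delta> where "\<delta> = min (1 / 3) (\<epsilon> * \<kappa> / (2 * m * V + 1))"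
  have den: "0 < 2 * m * V + 1" using m V by (simp add: add_nonneg_pos)
  have \<delta>: "0 < \<delta>" "\<delta> \<le> 1 / 3"
    using \<epsilon> k den by (simp add: \<delta>_def) (unfold \<delta>_def, rule min.cobounded1)
  have \<delta>\<epsilon>: "2 * m * V * \<delta> / \<kappa> \<le> \<epsilon>"
  proof -
    have "(2 * m * V + 1) * \<delta> \<le> \<epsilon> * \<kappa>"
    proof -
      have "\<delta> \<le> \<epsilon> * \<kappa> / (2 * m * V + 1)" unfolding \<delta>_def by (rule min.cobounded2)
      then show ?thesis using den by (simp add: pos_le_divide_eq mult.commute)
    qed
    then have "2 * m * V * \<delta> \<le> \<epsilon> * \<kappa>" using \<delta>(1) unfolding distrib_right by linarith
    then show ?thesis using k by (simp add: divide_le_eq)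
  qed
  obtain \<phi> where pot: "\<And>i. potential \<kappa> M (\<phi> i)"
    \<comment> \<open>With slack \<open>\<delta>\<^sup>2 / m\<close> for each coordinate, the
      \<open>m\<close> relative entropies add up to at most \<open>\<delta>\<^sup>2\<close>.\<close>
    and min: "\<And>\<psi>. (\<And>i. potential \<kappa> M (\<psi> i)) \<Longrightarrow> J \<phi> \<le> J \<psi> + \<delta>\<^sup>2 / m"
    using near_minimizer[of "\<delta>\<^sup>2 / m"] \<delta> m by (metis divide_pos_pos zero_less_power)
  interpret N: prob_space "gibbsP \<phi> UNIV" by (rule prob_space_gibbsP[where \<phi>=\<phi>, OF pot])
  define u where "u i t = (\<integral>x. U (x(i := t)) \<partial>gibbsP \<phi> UNIV)" for i t
  define u' where "u' i t = (\<integral>x. D i (x(i := t)) \<partial>gibbsP \<phi> UNIV)" for i t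
  have "\<exists>c. potential \<kappa> M (\<lambda>t. u i t + c) \<and> deriv (\<lambda>t. u i t + c) = u' i" for i
    using sconv_normalize[OF sconv_average[where \<phi>=\<phi> and i=i, OF pot]] unfolding u_def[abs_def] u'_def[abs_def] by metis
  then obtain c where c: "\<And>i. potential \<kappa> M (\<lambda>t. u i t + c i)" "\<And>i. deriv (\<lambda>t. u i t + c i) = u' i" by metis
  define \<psi> where "\<psi> i t = u i t + c i" for i t
  have pot': "potential \<kappa> M (\<psi> i)" for i using c(1) by (simp add: \<psi>_def[abs_def])
  have d\<psi>: "deriv (\<psi> i) = u' i" for i using c(2) by (simp add: \<psi>_def[abs_def])
  interpret N': prob_space "gibbsP \<psi> UNIV" by (rule prob_space_gibbsP[where \<phi>=\<psi>, OF pot'])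
  have ig: "integrable (gibbs1 h) h'" if "potential \<kappa> M h" "potential \<kappa> M h'" for h h'
    by (rule potential_integrable[OF that(1) potential_measurable[OF that(2)] sconv_growth[OF potential_sconv[OF that(2)]]])
  \<comment> \<open>The left-hand side is the relative entropy of \<open>gibbs1 (\<phi> i)\<close>
    to \<open>gibbs1 (\<psi> i)\<close>. It equals
    \<open>J \<phi> - J (\<phi>(i := \<psi> i))\<close>: the contributions of the other factors
    cancel, and the free energy of the best response is \<open>- c i\<close>.\<close>
  have KLi: "(\<integral>t. \<psi> i t - \<phi> i t \<partial>gibbs1 (\<phi> i)) \<le> \<delta>\<^sup>2 / m" for i
  proof -
    interpret G: prob_space "gibbs1 (\<phi> i)" by (rule prob_space_gibbs1[OF pot])
    interpret G': prob_space "gibbs1 (\<psi> i)" by (rule prob_space_gibbs1[OF pot'])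
    have iu: "integrable (gibbs1 (\<phi> i)) (u i)"
      unfolding u_def[abs_def] by (rule integral_resample(1)[where \<phi>=\<phi>, OF pot pot qgrow_U])
    have "J \<phi> \<le> J (\<phi>(i := \<psi> i)) + \<delta>\<^sup>2 / m" by (rule min) (use pot pot' in auto)
    moreover have "J (\<phi>(i := \<psi> i)) = (\<integral>t. u i t - \<psi> i t \<partial>gibbs1 (\<psi> i)) - (\<Sum>j\<in>UNIV - {i}. \<integral>t. \<phi> j t \<partial>gibbs1 (\<phi> j))"
      unfolding u_def by (rule J_upd[where \<phi>=\<phi>, OF pot pot'])
    moreover have "J (\<phi>(i := \<phi> i)) = (\<integral>t. u i t - \<phi> i t \<partial>gibbs1 (\<phi> i)) - (\<Sum>j\<in>UNIV - {i}. \<integral>t. \<phi> j t \<partial>gibbs1 (\<phi> j))"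
      unfolding u_def by (rule J_upd[where \<phi>=\<phi>, OF pot pot])
    moreover have "(\<integral>t. u i t - \<psi> i t \<partial>gibbs1 (\<psi> i)) = - c i"
      by (simp add: \<psi>_def G'.prob_space[simplified])
    moreover have "(\<integral>t. \<psi> i t - \<phi> i t \<partial>gibbs1 (\<phi> i)) = (\<integral>t. (u i t - \<phi> i t) + c i \<partial>gibbs1 (\<phi> i))"
      by (intro Bochner_Integration.integral_cong) (auto simp: \<psi>_def)
    moreover have "\<dots> = (\<integral>t. u i t - \<phi> i t \<partial>gibbs1 (\<phi> i)) + c i"
      using iu ig[OF pot pot] G.prob_space[simplified]
      by (subst Bochner_Integration.integral_add) auto
    ultimately show ?thesis by simp
  qed
  have KL: "(\<integral>x. prod_pot \<psi> x - prod_pot \<phi> x \<partial>gibbsP \<phi> UNIV) \<le> \<delta>\<^sup>2"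
  proof -
    have i: "integrable (gibbsP \<phi> UNIV) (\<lambda>x. \<psi> i (x i) - \<phi> i (x i))" for i
      by (rule qgrow_integrable[where \<phi>=\<phi>, OF pot _ qgrow_diff[OF qgrow_potential(1)[OF pot'] qgrow_potential(1)[OF pot]]]) simp
    have "(\<integral>x. prod_pot \<psi> x - prod_pot \<phi> x \<partial>gibbsP \<phi> UNIV) = (\<integral>x. (\<Sum>i\<in>UNIV. \<psi> i (x i) - \<phi> i (x i)) \<partial>gibbsP \<phi> UNIV)"
      by (simp add: sum_subtractf)
    also have "\<dots> = (\<Sum>i\<in>UNIV. \<integral>x. \<psi> i (x i) - \<phi> i (x i) \<partial>gibbsP \<phi> UNIV)"
      using i by (intro Bochner_Integration.integral_sum) auto
    also have "\<dots> = (\<Sum>i\<in>UNIV. \<integral>t. \<psi> i t - \<phi> i t \<partial>gibbs1 (\<phi> i))"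
      by (intro sum.cong refl gibbsP_component(1)[where \<phi>=\<phi> and h="\<lambda>t. \<psi> _ t - \<phi> _ t", OF pot] borel_measurable_diff potential_measurable[OF pot] potential_measurable[OF pot']) simp
    also have "\<dots> \<le> (\<Sum>i\<in>(UNIV::'i set). \<delta>\<^sup>2 / m)" by (intro sum_mono KLi)
    also have "\<dots> = \<delta>\<^sup>2" using m by (simp add: m_def)
    finally show ?thesis .
  qed
  define q where "q i x = (deriv (\<psi> i) (x i) - D i x)\<^sup>2" for i x
  have qq: "qgrow UNIV (q i)" for i unfolding q_def[abs_def] by (rule qgrow_grad_diff[where \<phi>=\<psi>, OF pot'])
  have qH: "qgrow UNIV (\<lambda>x. (H i j x)\<^sup>2)" if "i \<noteq> j" for i j
    using lgrow_mult[OF _ lgrow_H[OF that] lgrow_H[OF that]] by (simp add: power2_eq_square)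
  have Hb: "(1 / \<kappa>) * (\<Sum>j\<in>UNIV - {i}. \<integral>x. (H i j (x(i := t)))\<^sup>2 \<partial>gibbsP \<xi> UNIV) \<le> V"
    if "\<And>i. potential \<kappa> M (\<xi> i)" for i t \<xi>
  proof -
    interpret X: prob_space "gibbsP \<xi> UNIV" by (rule prob_space_gibbsP[where \<phi>=\<xi>, OF that])
    have "(\<integral>x. (H i j (x(i := t)))\<^sup>2 \<partial>gibbsP \<xi> UNIV) \<le> M\<^sup>2" if j: "j \<in> UNIV - {i}" for j
    proof -
      have "(\<integral>x. (H i j (x(i := t)))\<^sup>2 \<partial>gibbsP \<xi> UNIV) \<le> (\<integral>x. M\<^sup>2 \<partial>gibbsP \<xi> UNIV)"
      proof (rule integral_mono)
        show "integrable (gibbsP \<xi> UNIV) (\<lambda>x. (H i j (x(i := t)))\<^sup>2)"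
          by (rule qgrow_integrable[where \<phi>=\<xi>, OF \<open>\<And>i. potential \<kappa> M (\<xi> i)\<close> _ qgrow_upd[OF qH]]) (use j in auto)
        show "(H i j (x(i := t)))\<^sup>2 \<le> M\<^sup>2" for x
          using bound_H[of i j "x(i := t)"] j by (intro abs_le_square_iff[THEN iffD1]) (use M_nonneg in auto)
      qed simp
      then show ?thesis using X.prob_space by simp
    qed
    then have "(\<Sum>j\<in>UNIV - {i}. \<integral>x. (H i j (x(i := t)))\<^sup>2 \<partial>gibbsP \<xi> UNIV) \<le> (\<Sum>j\<in>UNIV - {i}. M\<^sup>2)"
      by (intro sum_mono)
    also have "\<dots> \<le> m * M\<^sup>2"
      unfolding m_def by (simp, intro mult_right_mono) (auto intro: card_mono)
    finally show ?thesis using k by (simp add: V_def divide_right_mono)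
  qed
  \<comment> \<open>Bias and variance of \<open>D i\<close> at frozen \<open>x i = t\<close>, under
    \<psi>: the centre \<open>u' i t\<close> is the mean under \<phi>, so the squared bias is
    controlled by the closeness of the two measures and the variance by Poincare.\<close>
  have slice: "(\<integral>x. q i (x(i := t)) \<partial>gibbsP \<psi> UNIV)
      \<le> 4 * V * \<delta> + (1 / \<kappa>) * (\<Sum>j\<in>UNIV - {i}. \<integral>x. (H i j (x(i := t)))\<^sup>2 \<partial>gibbsP \<psi> UNIV)" for i t
  proof -
    define f where "f x = D i (x(i := t))" for x
    define a1 where "a1 = (\<integral>x. f x \<partial>gibbsP \<psi> UNIV)"
    have lf: "lgrow UNIV f" unfolding f_def[abs_def] by (rule lgrow_slice)
    have a0: "u' i t = (\<integral>x. f x \<partial>gibbsP \<phi> UNIV)" by (simp add: u'_def f_def)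
    have v: "(\<integral>x. (f x)\<^sup>2 \<partial>gibbsP \<psi> UNIV) \<le> a1\<^sup>2
      + (1 / \<kappa>) * (\<Sum>j\<in>UNIV - {i}. \<integral>x. (H i j (x(i := t)))\<^sup>2 \<partial>gibbsP \<psi> UNIV)"
      unfolding f_def a1_def by (rule variance_slice_le[where \<phi>=\<psi>, OF pot'])
    have v0: "(\<integral>x. (f x)\<^sup>2 \<partial>gibbsP \<phi> UNIV) \<le> (\<integral>x. f x \<partial>gibbsP \<phi> UNIV)\<^sup>2 + V"
      using variance_slice_le[where \<phi>=\<phi> and i=i and t=t, OF pot] Hb[of \<phi> i t, OF pot] unfolding f_def by linarith
    have v1: "(\<integral>x. (f x)\<^sup>2 \<partial>gibbsP \<psi> UNIV) \<le> (\<integral>x. f x \<partial>gibbsP \<psi> UNIV)\<^sup>2 + V"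
      using v Hb[of \<psi> i t, OF pot'] unfolding a1_def by linarith
    have dif: "(a1 - u' i t)\<^sup>2 \<le> 4 * V * \<delta>"
      unfolding a1_def a0 by (rule expectation_diff_le[where \<phi>=\<phi> and \<psi>=\<psi>, OF pot pot' KL \<delta> lf v0 v1])
    have i1: "integrable (gibbsP \<psi> UNIV) f" "integrable (gibbsP \<psi> UNIV) (\<lambda>x. (f x)\<^sup>2)"
      using qgrow_integrable[where \<phi>=\<psi>, OF pot' _ lgrow_imp_qgrow[OF _ lf]]
        qgrow_integrable[where \<phi>=\<psi>, OF pot' _ lgrow_mult[OF _ lf lf]]
      by (simp_all add: power2_eq_square)
    have "(\<integral>x. q i (x(i := t)) \<partial>gibbsP \<psi> UNIV) = (\<integral>x. (u' i t)\<^sup>2 + (f x)\<^sup>2 - 2 * u' i t * f x \<partial>gibbsP \<psi> UNIV)"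
      by (simp add: q_def d\<psi> f_def power2_diff)
    also have "\<dots> = (u' i t)\<^sup>2 + (\<integral>x. (f x)\<^sup>2 \<partial>gibbsP \<psi> UNIV) - 2 * u' i t * a1"
      using i1 N'.prob_space by (simp add: a1_def)
    also have "\<dots> \<le> (a1 - u' i t)\<^sup>2 + (1 / \<kappa>) * (\<Sum>j\<in>UNIV - {i}. \<integral>x. (H i j (x(i := t)))\<^sup>2 \<partial>gibbsP \<psi> UNIV)"
      using v by (simp add: power2_diff)
    finally show ?thesis using dif by linarith
  qed
  \<comment> \<open>Averaging \<open>slice\<close> over \<open>t\<close> with law
    \<open>gibbs1 (\<psi> i)\<close> restores the full product measure, because resampling
    coordinate \<open>i\<close> from its own factor changes nothing.\<close>
  have Qi: "(\<integral>x. q i x \<partial>gibbsP \<psi> UNIV) \<le> 4 * V * \<delta> + (1 / \<kappa>) * (\<Sum>j\<in>UNIV - {i}. \<integral>x. (H i j x)\<^sup>2 \<partial>gibbsP \<psi> UNIV)" for i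
  proof -
    interpret G': prob_space "gibbs1 (\<psi> i)" by (rule prob_space_gibbs1[OF pot'])
    note rq = integral_resample[where \<phi>=\<psi> and i=i, OF pot' pot'[of i] qq[of i], unfolded fun_upd_triv]
    note rH = integral_resample[where \<phi>=\<psi> and i=i, OF pot' pot'[of i] qH, unfolded fun_upd_triv]
    have "(\<integral>x. q i x \<partial>gibbsP \<psi> UNIV) = (\<integral>t. \<integral>x. q i (x(i := t)) \<partial>gibbsP \<psi> UNIV \<partial>gibbs1 (\<psi> i))"
      by (rule rq(2)[symmetric])
    also have "\<dots> \<le> (\<integral>t. 4 * V * \<delta> + (1 / \<kappa>) * (\<Sum>j\<in>UNIV - {i}. \<integral>x. (H i j (x(i := t)))\<^sup>2 \<partial>gibbsP \<psi> UNIV) \<partial>gibbs1 (\<psi> i))"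
      by (intro integral_mono rq(1) slice Bochner_Integration.integrable_add integrable_mult_right
          Bochner_Integration.integrable_sum rH(1)) auto
    also have "\<dots> = 4 * V * \<delta> + (1 / \<kappa>) * (\<Sum>j\<in>UNIV - {i}. \<integral>t. \<integral>x. (H i j (x(i := t)))\<^sup>2 \<partial>gibbsP \<psi> UNIV \<partial>gibbs1 (\<psi> i))"
    proof -
      have iS: "integrable (gibbs1 (\<psi> i)) (\<lambda>t. \<Sum>j\<in>UNIV - {i}. \<integral>x. (H i j (x(i := t)))\<^sup>2 \<partial>gibbsP \<psi> UNIV)"
        by (intro Bochner_Integration.integrable_sum rH(1)) auto
      have "(\<integral>t. (\<Sum>j\<in>UNIV - {i}. \<integral>x. (H i j (x(i := t)))\<^sup>2 \<partial>gibbsP \<psi> UNIV) \<partial>gibbs1 (\<psi> i))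
         = (\<Sum>j\<in>UNIV - {i}. \<integral>t. \<integral>x. (H i j (x(i := t)))\<^sup>2 \<partial>gibbsP \<psi> UNIV \<partial>gibbs1 (\<psi> i))"
        by (intro Bochner_Integration.integral_sum rH(1)) auto
      then show ?thesis using iS G'.prob_space[simplified] by simp
    qed
    also have "\<dots> = 4 * V * \<delta> + (1 / \<kappa>) * (\<Sum>j\<in>UNIV - {i}. \<integral>x. (H i j x)\<^sup>2 \<partial>gibbsP \<psi> UNIV)"
      using rH(2) by auto
    finally show ?thesis .
  qed
  have "(\<Sum>i\<in>UNIV. \<integral>x. q i x \<partial>gibbsP \<psi> UNIV) \<le> (\<Sum>i\<in>UNIV. 4 * V * \<delta> + (1 / \<kappa>) * (\<Sum>j\<in>UNIV - {i}. \<integral>x. (H i j x)\<^sup>2 \<partial>gibbsP \<psi> UNIV))"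
    by (intro sum_mono Qi)
  also have "\<dots> = 4 * m * V * \<delta> + (1 / \<kappa>) * (\<Sum>i\<in>UNIV. \<Sum>j\<in>UNIV - {i}. \<integral>x. (H i j x)\<^sup>2 \<partial>gibbsP \<psi> UNIV)"
    by (simp add: sum.distrib m_def sum_divide_distrib)
  also have "(\<Sum>i\<in>UNIV. \<Sum>j\<in>UNIV - {i}. \<integral>x. (H i j x)\<^sup>2 \<partial>gibbsP \<psi> UNIV)
      = (\<integral>x. (\<Sum>i\<in>UNIV. \<Sum>j\<in>UNIV - {i}. (H i j x)\<^sup>2) \<partial>gibbsP \<psi> UNIV)"
  proof -
    have iH: "integrable (gibbsP \<psi> UNIV) (\<lambda>x. (H i j x)\<^sup>2)" if "i \<noteq> j" for i j
      by (rule qgrow_integrable[where \<phi>=\<psi>, OF pot' _ qH[OF that]]) simp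
    show ?thesis
      by (subst Bochner_Integration.integral_sum)
         (auto intro!: iH Bochner_Integration.integrable_sum sum.cong Bochner_Integration.integral_sum[symmetric])
  qed
  also have "\<dots> \<le> 2 * S"
  proof -
    have iH: "integrable (gibbsP \<psi> UNIV) (\<lambda>x. (H i j x)\<^sup>2)" if "i \<noteq> j" for i j
      by (rule qgrow_integrable[where \<phi>=\<psi>, OF pot' _ qH[OF that]]) simp
    have "(\<integral>x. (\<Sum>i\<in>UNIV. \<Sum>j\<in>UNIV - {i}. (H i j x)\<^sup>2) \<partial>gibbsP \<psi> UNIV) \<le> (\<integral>x. 2 * S \<partial>gibbsP \<psi> UNIV)"
      by (intro integral_mono offdiag Bochner_Integration.integrable_sum iH) auto
    then show ?thesis using N'.prob_space by simp
  qed
  finally have tot: "(\<Sum>i\<in>UNIV. \<integral>x. q i x \<partial>gibbsP \<psi> UNIV) \<le> 4 * m * V * \<delta> + (1 / \<kappa>) * (2 * S)"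
    using k by (simp add: divide_right_mono)
  have iq: "integrable (gibbsP \<psi> UNIV) (q i)" for i by (rule qgrow_integrable[where \<phi>=\<psi>, OF pot' _ qq]) simp
  have iPU: "integrable (gibbsP \<psi> UNIV) (\<lambda>x. prod_pot \<psi> x - U x)"
    by (rule qgrow_integrable[where \<phi>=\<psi>, OF pot' _ qgrow_diff[OF qgrow_prod_pot[where \<phi>=\<psi>, OF pot'] qgrow_U]]) simp
  have "(\<integral>x. prod_pot \<psi> x - U x + 1 / (2 * \<kappa>) * (\<Sum>i\<in>UNIV. q i x) \<partial>gibbsP \<psi> UNIV)
     = (\<integral>x. prod_pot \<psi> x - U x \<partial>gibbsP \<psi> UNIV) + 1 / (2 * \<kappa>) * (\<Sum>i\<in>UNIV. \<integral>x. q i x \<partial>gibbsP \<psi> UNIV)"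
    using iq iPU
    by (subst Bochner_Integration.integral_add)
       (auto intro!: Bochner_Integration.integrable_sum integrable_mult_right Bochner_Integration.integral_sum simp del: Bochner_Integration.integral_diff)
  also have "\<dots> \<le> (\<integral>x. prod_pot \<psi> x - U x \<partial>gibbsP \<psi> UNIV) + 1 / (2 * \<kappa>) * (4 * m * V * \<delta> + (1 / \<kappa>) * (2 * S))"
    using tot k by (intro add_left_mono mult_left_mono) auto
  also have "1 / (2 * \<kappa>) * (4 * m * V * \<delta> + (1 / \<kappa>) * (2 * S)) = 2 * m * V * \<delta> / \<kappa> + S / \<kappa>\<^sup>2"
    using k by (simp add: field_simps power2_eq_square)
  finally have "(\<integral>x. prod_pot \<psi> x - U x + 1 / (2 * \<kappa>) * (\<Sum>i\<in>UNIV. q i x) \<partial>gibbsP \<psi> UNIV)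
     \<le> (\<integral>x. prod_pot \<psi> x - U x \<partial>gibbsP \<psi> UNIV) + S / \<kappa>\<^sup>2 + \<epsilon>"
    using \<delta>\<epsilon> by linarith
  then have "(\<integral>\<^sup>+x. ennreal (exp (- U x)) \<partial>PiM UNIV (\<lambda>_. lborel))
      \<le> ennreal (exp ((\<integral>x. prod_pot \<psi> x - U x \<partial>gibbsP \<psi> UNIV) + S / \<kappa>\<^sup>2 + \<epsilon>))"
    by (intro order_trans[OF partition_function_le[where \<phi>=\<psi>, OF pot']] ennreal_leI) (simp add: q_def)
  with pot' show thesis by (rule that)
qed

end

section \<open>From mean-field approximation to the star family\<close>

lemma measurable_vec_lambda[measurable]:
  "(vec_lambda :: ('d::finite \<Rightarrow> real) \<Rightarrow> real^'d) \<in> measurable (PiM UNIV (\<lambda>_. borel)) borel"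
  unfolding borel_measurable_euclidean_space[of vec_lambda]
  by (auto simp: Basis_vec_def inner_axis)

lemma lborel_vec:
  "distr (PiM UNIV (\<lambda>_. lborel)) borel vec_lambda = (lborel :: (real^'d::finite) measure)"
proof (rule lborel_eqI[symmetric])
  interpret L: product_sigma_finite "\<lambda>_::'d. lborel :: real measure" by unfold_locales
  fix l u :: "real^'d" assume lu: "\<And>b. b \<in> Basis \<Longrightarrow> l \<bullet> b \<le> u \<bullet> b"
  have lu': "l $ j \<le> u $ j" for j using lu[of "axis j 1"] by (simp add: inner_axis)
  have m: "vec_lambda \<in> measurable (PiM UNIV (\<lambda>_. lborel)) (borel :: (real^'d) measure)" by measurable
  have v: "vec_lambda -` box l u \<inter> space (PiM UNIV (\<lambda>_. lborel)) = (\<Pi>\<^sub>E j\<in>UNIV. {l $ j <..< u $ j})"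
    by (auto simp: mem_box Basis_vec_def inner_axis space_PiM PiE_def Pi_def)
  have "emeasure (distr (PiM UNIV (\<lambda>_. lborel)) borel vec_lambda) (box l u)
      = (\<Prod>j\<in>UNIV. emeasure lborel {l $ j <..< u $ j})"
    by (subst emeasure_distr[OF m]) (auto simp: v intro!: L.emeasure_PiM)
  also have "\<dots> = (\<Prod>j\<in>UNIV. u $ j - l $ j)" using lu' by (simp add: prod_ennreal)
  also have "(\<Prod>j\<in>UNIV. u $ j - l $ j) = (\<Prod>b\<in>(\<lambda>j. axis j 1) ` UNIV. (u - l) \<bullet> b)"
    by (subst prod.reindex) (auto simp: inj_on_def axis_eq_axis inner_axis inner_diff_left)
  also have "(\<lambda>j::'d. axis j (1::real)) ` UNIV = Basis" by (auto simp: Basis_vec_def)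
  finally show "emeasure (distr (PiM UNIV (\<lambda>_. lborel)) borel vec_lambda) (box l u) = (\<Prod>b\<in>Basis. (u - l) \<bullet> b)" .
qed simp

lemma nn_integral_lborel_vec:
  fixes f :: "real^'d::finite \<Rightarrow> ennreal"
  assumes [measurable]: "f \<in> borel_measurable borel"
  shows "(\<integral>\<^sup>+\<beta>. f \<beta> \<partial>lborel) = (\<integral>\<^sup>+x. f (vec_lambda x) \<partial>PiM UNIV (\<lambda>_. lborel))"
proof -
  have m: "vec_lambda \<in> measurable (PiM UNIV (\<lambda>_. lborel)) (borel :: (real^'d) measure)" by measurable
  show ?thesis unfolding lborel_vec[symmetric] by (rule nn_integral_distr[OF m]) measurable
qed

text \<open>The hypothesis compares the positive and negative parts as nonnegative integrals, so it
  can be checked by disintegration, and integrability of the log-density becomes a conclusion. The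
  negative part is always finite, because - p ln (p / r) \<le> r pointwise.\<close>

lemma KL_density_le:
  fixes p r :: "'a::euclidean_space \<Rightarrow> real"
  assumes [measurable]: "p \<in> borel_measurable borel" "r \<in> borel_measurable borel"
    and pos: "\<And>x. 0 < p x" "\<And>x. 0 < r x"
    and r1: "(\<integral>\<^sup>+x. ennreal (r x) \<partial>lborel) = 1" and c: "0 \<le> c"
    and le: "(\<integral>\<^sup>+x. ennreal (ln (p x / r x)) \<partial>density lborel p)
       \<le> ennreal c + (\<integral>\<^sup>+x. ennreal (- ln (p x / r x)) \<partial>density lborel p)"
  shows "KL (density lborel p) (density lborel r) \<le> ereal c"
proof -
  define \<pi> where "\<pi> = density lborel (\<lambda>x. ennreal (r x))"
  define \<nu> where "\<nu> = density lborel (\<lambda>x. ennreal (p x))"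
  define f where "f x = ln (p x / r x)" for x
  have [measurable]: "f \<in> borel_measurable borel" unfolding f_def by measurable
  have sets: "sets \<pi> = sets borel" "sets \<nu> = sets borel" by (auto simp: \<pi>_def \<nu>_def)
  have fm: "f \<in> borel_measurable \<nu>" by (simp add: measurable_cong_sets[OF sets(2)])
  interpret \<pi>: prob_space \<pi>
    by (rule prob_spaceI) (simp add: \<pi>_def emeasure_density r1)
  have nz: "r x \<noteq> 0" for x using pos(2)[of x] by simp
  have d: "density \<pi> (\<lambda>x. ennreal (p x / r x)) = \<nu>"
    unfolding \<pi>_def \<nu>_def
    using pos by (subst density_density_eq) (auto intro!: density_cong simp: less_imp_le nz simp flip: ennreal_mult)
  have qm: "(\<lambda>x. ennreal (p x / r x)) \<in> borel_measurable \<pi>" by (simp add: measurable_cong_sets[OF sets(1)])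
  have ac: "absolutely_continuous \<pi> \<nu>"
    unfolding d[symmetric] by (rule absolutely_continuousI_density[OF qm])
  have "AE x in \<pi>. ennreal (p x / r x) = RN_deriv \<pi> \<nu> x"
    by (rule \<pi>.RN_deriv_unique[OF qm d])
  then have "AE x in \<nu>. ennreal (p x / r x) = RN_deriv \<pi> \<nu> x"
    by (rule absolutely_continuous_AE[rotated 2]) (use ac sets in auto)
  then have ae: "AE x in \<nu>. ln (enn2real (RN_deriv \<pi> \<nu> x)) = f x"
  proof eventually_elim
    case (elim x)
    have "enn2real (RN_deriv \<pi> \<nu> x) = p x / r x"
      using pos[of x] by (simp flip: elim)
    then show ?case by (simp add: f_def)
  qed
  have neg: "(\<integral>\<^sup>+x. ennreal (- f x) \<partial>\<nu>) \<le> 1"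
  proof -
    have "(\<integral>\<^sup>+x. ennreal (- f x) \<partial>\<nu>) = (\<integral>\<^sup>+x. ennreal (p x) * ennreal (- f x) \<partial>lborel)"
      unfolding \<nu>_def by (subst nn_integral_density) auto
    also have "\<dots> \<le> (\<integral>\<^sup>+x. ennreal (r x) \<partial>lborel)"
    proof (intro nn_integral_mono)
      fix x
      have "- f x \<le> r x / p x"
        using ln_le_minus_one[of "r x / p x"] pos[of x] by (simp add: f_def ln_div)
      then have "p x * (- f x) \<le> r x" using pos(1)[of x] by (simp add: field_simps)
      then show "ennreal (p x) * ennreal (- f x) \<le> ennreal (r x)"
        using pos(1)[of x] by (subst ennreal_mult'[symmetric]) (auto intro: ennreal_leI)
    qed
    finally show ?thesis using r1 by simp
  qed
  have le': "(\<integral>\<^sup>+x. ennreal (f x) \<partial>\<nu>) \<le> ennreal c + (\<integral>\<^sup>+x. ennreal (- f x) \<partial>\<nu>)"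
    using le by (simp add: f_def \<nu>_def)
  have fin: "(\<integral>\<^sup>+x. ennreal (- f x) \<partial>\<nu>) < \<infinity>" using neg by (rule le_less_trans) simp
  then have fin': "(\<integral>\<^sup>+x. ennreal (f x) \<partial>\<nu>) < \<infinity>"
    by (intro le_less_trans[OF le']) (simp add: ennreal_add_less_top)
  have fi: "integrable \<nu> f" using fin fin' fm by (simp add: real_integrable_def less_top)
  have RNb: "RN_deriv \<pi> \<nu> \<in> borel_measurable borel"
    using borel_measurable_RN_deriv[of \<pi> \<nu>] by (simp add: measurable_cong_sets[OF sets(1)])
  have RNm: "(\<lambda>x. ln (enn2real (RN_deriv \<pi> \<nu> x))) \<in> borel_measurable \<nu>"
    using RNb by (simp add: measurable_cong_sets[OF sets(2)])
  from fi have i: "integrable \<nu> (\<lambda>x. ln (enn2real (RN_deriv \<pi> \<nu> x)))"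
    by (subst integrable_cong_AE[OF RNm fm ae])
  have "(\<integral>x. ln (enn2real (RN_deriv \<pi> \<nu> x)) \<partial>\<nu>) = (\<integral>x. f x \<partial>\<nu>)"
    using borel_measurable_integrable[OF i] by (intro integral_cong_AE fm ae)
  also have "\<dots> = enn2real (\<integral>\<^sup>+x. ennreal (f x) \<partial>\<nu>) - enn2real (\<integral>\<^sup>+x. ennreal (- f x) \<partial>\<nu>)"
    by (rule real_lebesgue_integral_def[OF fi])
  also have "\<dots> \<le> c"
  proof -
    have "enn2real (\<integral>\<^sup>+x. ennreal (f x) \<partial>\<nu>) \<le> enn2real (ennreal c + (\<integral>\<^sup>+x. ennreal (- f x) \<partial>\<nu>))"
      by (rule enn2real_mono[OF le']) (use fin in \<open>simp add: ennreal_add_less_top\<close>)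
    also have "\<dots> = c + enn2real (\<integral>\<^sup>+x. ennreal (- f x) \<partial>\<nu>)"
      using fin c by (subst enn2real_plus) auto
    finally show ?thesis by simp
  qed
  finally have "KL \<nu> \<pi> \<le> ereal c"
    using i ac sets by (simp add: KL_def)
  then show ?thesis by (simp add: \<nu>_def \<pi>_def)
qed

lemma nn_integral_le_of_integral_le:
  assumes g: "integrable M g" and le: "(\<integral>x. g x \<partial>M) \<le> c" and c: "0 \<le> c"
  shows "(\<integral>\<^sup>+x. ennreal (g x) \<partial>M) \<le> ennreal c + (\<integral>\<^sup>+x. ennreal (- g x) \<partial>M)"
proof -
  have fin: "(\<integral>\<^sup>+x. ennreal (g x) \<partial>M) < top" "(\<integral>\<^sup>+x. ennreal (- g x) \<partial>M) < top"
    using g by (auto simp: real_integrable_def less_top)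
  have "(\<integral>\<^sup>+x. ennreal (g x) \<partial>M) = ennreal (enn2real (\<integral>\<^sup>+x. ennreal (g x) \<partial>M))" using fin by simp
  also have "\<dots> \<le> ennreal (c + enn2real (\<integral>\<^sup>+x. ennreal (- g x) \<partial>M))"
    using le real_lebesgue_integral_def[OF g] by (intro ennreal_leI) simp
  also have "\<dots> = ennreal c + (\<integral>\<^sup>+x. ennreal (- g x) \<partial>M)" using fin c by simp
  finally show ?thesis .
qed

text \<open>The separable minorant in \<open>lower\<close> makes exp (- V) integrable and dominates
  the conditional densities for all root values at once, whence the normalizing constant is
  continuous in the root. The majorant in \<open>dom\<close> does the same for the mean of
  \<open>V\<close> under a fixed product measure.\<close>

lemma star_approximation:
  fixes V :: "real \<times> (real^'d::finite) \<Rightarrow> real"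
  assumes Vc: "continuous_on UNIV V"
    and sc: "\<And>\<theta>. strongly_convex (\<lambda>x. V (\<theta>, vec_lambda x)) (D \<theta>) (H \<theta>) \<kappa> M S"
    and hi: "integrable lborel (\<lambda>t. exp (- h t))" and hB: "\<And>t. exp (- h t) \<le> B"
    and ki: "\<And>j. integrable lborel (\<lambda>t. exp (- k j t))"
    and lower: "\<And>\<theta> x. h \<theta> + (\<Sum>j\<in>UNIV. k j (x j)) \<le> V (\<theta>, vec_lambda x)"
    and dom: "\<And>K. \<exists>w. qgrow UNIV w \<and> (\<forall>t x. \<bar>t\<bar> \<le> K \<longrightarrow> \<bar>V (t, vec_lambda x)\<bar> \<le> w x)"
    and \<epsilon>: "0 < \<epsilon>"
  shows "\<exists>\<nu>\<in>star_family. KL \<nu> (gibbs V) \<le> ereal (S / \<kappa>\<^sup>2 + \<epsilon>)"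
proof -
  interpret sc: strongly_convex "\<lambda>x. V (\<theta>, vec_lambda x)" "D \<theta>" "H \<theta>" \<kappa> M S for \<theta> by (rule sc)
  define c where "c = S / \<kappa>\<^sup>2 + \<epsilon>"
  have "0 \<le> (\<Sum>i\<in>UNIV. \<Sum>j\<in>UNIV - {i}. (H 0 i j (\<lambda>_. 0))\<^sup>2)" by (intro sum_nonneg) auto
  then have S: "0 \<le> S" using sc.offdiag[of 0 "\<lambda>_. 0"] by linarith
  have c: "0 \<le> c" using S \<epsilon> by (simp add: c_def)
  have [measurable]: "V \<in> borel_measurable borel" using Vc by (rule borel_measurable_continuous_onI)
  interpret L: product_sigma_finite "\<lambda>_::'d. lborel :: real measure" by unfold_locales
  define L where "L = PiM (UNIV :: 'd set) (\<lambda>_. lborel :: real measure)"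
  have [measurable_cong]: "sets L = sets (PiM UNIV (\<lambda>_. borel))" by (simp add: L_def)
  define Z where "Z t = (\<integral>x. exp (- V (t, vec_lambda x)) \<partial>L)" for t
  have iZ: "integrable L (\<lambda>x. exp (- V (t, vec_lambda x)))" for t
    unfolding L_def by (rule sc.integrable_exp_U)
  have nnZ: "(\<integral>\<^sup>+x. ennreal (exp (- V (t, vec_lambda x))) \<partial>L) = ennreal (Z t)" for t
    unfolding Z_def by (rule nn_integral_eq_integral[OF iZ]) simp
  have nnZ': "(\<integral>\<^sup>+\<beta>. ennreal (exp (- V (t, \<beta>))) \<partial>lborel) = ennreal (Z t)" for t
    unfolding nnZ[symmetric] L_def by (rule nn_integral_lborel_vec) measurable
  have Zpos: "0 < Z t" for t
  proof (rule ccontr)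
    assume "\<not> 0 < Z t"
    then have "(\<integral>\<^sup>+\<beta>. ennreal (exp (- V (t, \<beta>))) \<partial>lborel) = 0" unfolding nnZ' by (simp add: ennreal_eq_0_iff)
    then have "AE \<beta> in lborel. ennreal (exp (- V (t, \<beta>))) = 0"
      by (subst (asm) nn_integral_0_iff_AE) auto
    then have "AE \<beta> in lborel::(real^'d) measure. False" by simp
    then show False by (simp add: eventually_False ae_filter_eq_bot_iff)
  qed
  define w where "w x = (\<Prod>j\<in>UNIV. exp (- k j (x j)))" for x :: "'d \<Rightarrow> real"
  have wi: "integrable L w"
    unfolding L_def w_def by (intro L.product_integrable_prod ki) auto
  have ew: "exp (- V (t, vec_lambda x)) \<le> exp (- h t) * w x" for t x
    using lower[of t x] unfolding w_def by (simp flip: exp_sum exp_add add: sum_negf)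
  have Zle: "Z t \<le> exp (- h t) * (\<integral>x. w x \<partial>L)" for t
    unfolding Z_def integral_mult_right_zero[symmetric]
    by (intro integral_mono iZ integrable_mult_right wi ew)
  have Vcont: "continuous_on UNIV (\<lambda>t. V (t, \<beta>))" for \<beta>
    by (intro continuous_on_compose2[OF Vc]) (auto intro!: continuous_intros)
  have Zc: "continuous_on UNIV Z"
    unfolding Z_def
  proof (rule continuous_on_integral_dominated)
    show "(\<lambda>x. exp (- V (t, vec_lambda x))) \<in> borel_measurable L" for t by measurable
    show "continuous_on UNIV (\<lambda>t. exp (- V (t, vec_lambda x)))" for x
      by (intro continuous_intros Vcont)
    show "\<exists>w. integrable L w \<and> (\<forall>t x. \<bar>t\<bar> \<le> K \<longrightarrow> x \<in> space L \<longrightarrow> \<bar>exp (- V (t, vec_lambda x))\<bar> \<le> w x)" for K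
    proof (intro exI conjI allI impI)
      show "integrable L (\<lambda>x. B * w x)" using wi by simp
      fix t x
      have "0 \<le> w x" by (simp add: w_def prod_nonneg)
      then show "\<bar>exp (- V (t, vec_lambda x))\<bar> \<le> B * w x"
        using ew[of t x] hB[of t] by (auto intro: order_trans mult_right_mono)
    qed
  qed
  have [measurable]: "Z \<in> borel_measurable borel" using Zc by (rule borel_measurable_continuous_onI)
  \<comment> \<open>The relative entropy of the product measure to the conditional law of the leaves
    when the root is \<open>t\<close>.\<close>
  define \<Lambda> where "\<Lambda> \<phi> t = ln (Z t) + (\<integral>x. V (t, vec_lambda x) - prod_pot \<phi> x \<partial>gibbsP \<phi> UNIV)" for \<phi> t
  have \<Lambda>c: "continuous_on UNIV (\<Lambda> \<phi>)" if pot: "\<And>i. potential \<kappa> M (\<phi> i)" for \<phi>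
    unfolding \<Lambda>_def
  proof (intro continuous_on_add continuous_on_ln Zc ballI)
    show "Z t \<noteq> 0" for t using Zpos[of t] by simp
    have m[measurable]: "prod_pot \<phi> \<in> borel_measurable (PiM UNIV (\<lambda>_. borel))"
      by (rule qgrow_measurable[OF qgrow_prod_pot[where \<phi>=\<phi>, OF pot]])
    show "continuous_on UNIV (\<lambda>t. \<integral>x. V (t, vec_lambda x) - prod_pot \<phi> x \<partial>gibbsP \<phi> UNIV)"
    proof (rule continuous_on_integral_dominated)
      show "(\<lambda>x. V (t, vec_lambda x) - prod_pot \<phi> x) \<in> borel_measurable (gibbsP \<phi> UNIV)" for t by measurable
      show "continuous_on UNIV (\<lambda>t. V (t, vec_lambda x) - prod_pot \<phi> x)" for x
        by (intro continuous_intros Vcont)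
      fix K
      obtain w where w: "qgrow UNIV w" "\<And>t x. \<bar>t\<bar> \<le> K \<Longrightarrow> \<bar>V (t, vec_lambda x)\<bar> \<le> w x" using dom by blast
      show "\<exists>w. integrable (gibbsP \<phi> UNIV) w \<and> (\<forall>t x. \<bar>t\<bar> \<le> K \<longrightarrow> x \<in> space (gibbsP \<phi> UNIV) \<longrightarrow> \<bar>V (t, vec_lambda x) - prod_pot \<phi> x\<bar> \<le> w x)"
      proof (intro exI conjI allI impI)
        show "integrable (gibbsP \<phi> UNIV) (\<lambda>x. w x + \<bar>prod_pot \<phi> x\<bar>)"
          by (intro Bochner_Integration.integrable_add integrable_abs
              qgrow_integrable[where \<phi>=\<phi>, OF pot _ w(1)] qgrow_integrable[where \<phi>=\<phi>, OF pot _ qgrow_prod_pot[where \<phi>=\<phi>, OF pot]]) auto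
        fix t x assume "\<bar>t\<bar> \<le> K"
        then show "\<bar>V (t, vec_lambda x) - prod_pot \<phi> x\<bar> \<le> w x + \<bar>prod_pot \<phi> x\<bar>"
          using w(2)[of t x] by linarith
      qed
    qed
  qed
  have "\<exists>\<phi>. (\<forall>i. potential \<kappa> M (\<phi> i)) \<and> \<Lambda> \<phi> \<theta> < c" for \<theta>
  proof -
    obtain \<phi> where pot: "\<And>i. potential \<kappa> M (\<phi> i)"
      and le: "(\<integral>\<^sup>+x. ennreal (exp (- V (\<theta>, vec_lambda x))) \<partial>PiM UNIV (\<lambda>_. lborel))
        \<le> ennreal (exp ((\<integral>x. prod_pot \<phi> x - V (\<theta>, vec_lambda x) \<partial>gibbsP \<phi> UNIV) + S / \<kappa>\<^sup>2 + \<epsilon> / 2))"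
      using sc.mean_field_bound[of "\<epsilon> / 2" \<theta>] \<epsilon> by auto
    have "Z \<theta> \<le> exp ((\<integral>x. prod_pot \<phi> x - V (\<theta>, vec_lambda x) \<partial>gibbsP \<phi> UNIV) + S / \<kappa>\<^sup>2 + \<epsilon> / 2)"
      using le nnZ[of \<theta>] unfolding L_def by simp
    then have "ln (Z \<theta>) \<le> (\<integral>x. prod_pot \<phi> x - V (\<theta>, vec_lambda x) \<partial>gibbsP \<phi> UNIV) + S / \<kappa>\<^sup>2 + \<epsilon> / 2"
      using ln_le_cancel_iff[THEN iffD2, OF Zpos exp_gt_zero] by simp
    moreover have "(\<integral>x. prod_pot \<phi> x - V (\<theta>, vec_lambda x) \<partial>gibbsP \<phi> UNIV) = - (\<integral>x. V (\<theta>, vec_lambda x) - prod_pot \<phi> x \<partial>gibbsP \<phi> UNIV)"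
      by (subst Bochner_Integration.integral_minus[symmetric]) simp
    ultimately have "\<Lambda> \<phi> \<theta> < c" using \<epsilon> by (simp add: \<Lambda>_def c_def)
    with pot show ?thesis by blast
  qed
  then obtain \<Phi> where \<Phi>: "\<And>\<theta> i. potential \<kappa> M (\<Phi> \<theta> i)" "\<And>\<theta>. \<Lambda> (\<Phi> \<theta>) \<theta> < c" by metis
  define Ob where "Ob \<theta> = {t. \<Lambda> (\<Phi> \<theta>) t < c}" for \<theta>
  have opOb: "open (Ob \<theta>)" for \<theta>
    unfolding Ob_def by (intro open_Collect_less \<Lambda>c \<Phi> continuous_on_const)
  have op: "open A" if "A \<in> range Ob" for A using opOb that by auto
  obtain F where F: "F \<subseteq> range Ob" "countable F" "\<Union>F = \<Union>(range Ob)"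
    by (rule Lindelof[of "range Ob", OF op])
  have UF: "\<Union>F = UNIV"
  proof -
    have "t \<in> Ob t" for t using \<Phi>(2)[of t] by (simp add: Ob_def)
    then show ?thesis unfolding F(3) by blast
  qed
  then have Fne: "F \<noteq> {}" by blast
  have "\<exists>\<theta>. from_nat_into F n = Ob \<theta>" for n using from_nat_into[OF Fne, of n] F(1) by blast
  then obtain T where T: "\<And>n. from_nat_into F n = Ob (T n)" by metis
  define \<phi> where "\<phi> n = \<Phi> (T n)" for n :: nat
  have pot: "potential \<kappa> M (\<phi> n i)" for n i using \<Phi>(1) by (simp add: \<phi>_def)
  have ex: "\<exists>n. \<Lambda> (\<phi> n) t < c" for t
  proof -
    obtain A where "A \<in> F" "t \<in> A" using UF by blast
    moreover obtain n where "from_nat_into F n = A" using from_nat_into_surj[OF F(2) \<open>A \<in> F\<close>] by blast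
    ultimately show ?thesis using T[of n] by (auto simp: Ob_def \<phi>_def)
  qed
  \<comment> \<open>Taking the least admissible index makes the choice measurable in
    \<open>t\<close>, since every \<open>\<Lambda> (\<phi> n)\<close> is.\<close>
  define kk where "kk t = (LEAST n. \<Lambda> (\<phi> n) t < c)" for t
  have kk: "\<Lambda> (\<phi> (kk t)) t < c" for t unfolding kk_def by (rule LeastI_ex[OF ex])
  have [measurable]: "\<Lambda> (\<phi> n) \<in> borel_measurable borel" for n
    by (rule borel_measurable_continuous_onI[OF \<Lambda>c[OF pot]])
  have kkm[measurable]: "kk \<in> measurable borel (count_space UNIV)"
    unfolding kk_def by measurable
  note [measurable] = potential_measurable[OF pot]

  define N where "N n = gibbsP (\<phi> n) UNIV" for n
  have Np: "prob_space (N n)" for n unfolding N_def by (rule prob_space_gibbsP[where \<phi>="\<phi> n", OF pot])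
  have sN[measurable_cong]: "sets (N n) = sets (PiM UNIV (\<lambda>_. borel))" for n by (simp add: N_def)
  have Nm[measurable]: "(\<lambda>t. N (kk t)) \<in> measurable borel (subprob_algebra (PiM UNIV (\<lambda>_. borel)))"
  proof (rule measurable_compose[OF kkm])
    show "N \<in> measurable (count_space UNIV) (subprob_algebra (PiM UNIV (\<lambda>_. borel)))"
      using Np sN by (auto simp: space_subprob_algebra prob_space_imp_subprob_space)
  qed
  define P where "P t = distr (N (kk t)) borel (\<lambda>b. (t, vec_lambda b :: real^'d))" for t
  have Pm[measurable]: "P \<in> measurable borel (subprob_algebra borel)"
    unfolding P_def by (rule measurable_distr2[OF _ Nm]) (simp add: borel_prod[symmetric], measurable)
  define Zt where "Zt = (\<integral>x. exp (- V x) \<partial>lborel)"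
  have tot: "(\<integral>\<^sup>+x. ennreal (exp (- V x)) \<partial>lborel) = (\<integral>\<^sup>+t. ennreal (Z t) \<partial>lborel)"
  proof -
    have "(\<integral>\<^sup>+x. ennreal (exp (- V x)) \<partial>lborel) = (\<integral>\<^sup>+x. ennreal (exp (- V x)) \<partial>(lborel \<Otimes>\<^sub>M lborel))"
      by (simp add: lborel_prod)
    also have "\<dots> = (\<integral>\<^sup>+t. \<integral>\<^sup>+\<beta>. ennreal (exp (- V (t, \<beta>))) \<partial>lborel \<partial>lborel)"
      by (rule lborel.nn_integral_fst[symmetric]) (simp add: lborel_prod)
    finally show ?thesis unfolding nnZ' .
  qed
  have "(\<integral>\<^sup>+t. ennreal (Z t) \<partial>lborel) \<le> (\<integral>\<^sup>+t. ennreal (exp (- h t) * (\<integral>x. w x \<partial>L)) \<partial>lborel)"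
    by (intro nn_integral_mono ennreal_leI Zle)
  also have "\<dots> < \<infinity>"
    using hi Zle Zpos by (subst nn_integral_eq_integral) (auto intro!: AE_I2 order_trans[OF less_imp_le[OF Zpos] Zle])
  finally have Zfin: "(\<integral>\<^sup>+t. ennreal (Z t) \<partial>lborel) < \<infinity>" .
  have iV: "integrable lborel (\<lambda>x. exp (- V x))"
    using Zfin tot by (intro integrableI_nonneg) auto
  have Zt: "(\<integral>\<^sup>+x. ennreal (exp (- V x)) \<partial>lborel) = ennreal Zt"
    unfolding Zt_def by (rule nn_integral_eq_integral[OF iV]) simp
  have Ztpos: "0 < Zt"
  proof (rule ccontr)
    assume "\<not> 0 < Zt"
    then have "(\<integral>\<^sup>+t. ennreal (Z t) \<partial>lborel) = 0" using Zt tot by (simp add: ennreal_eq_0_iff)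
    then have "AE t in lborel. ennreal (Z t) = 0"
      by (subst (asm) nn_integral_0_iff_AE) auto
    moreover have "ennreal (Z t) \<noteq> 0" for t using Zpos[of t] by (simp add: ennreal_eq_0_iff)
    ultimately have "AE t in lborel::real measure. False" by simp
    then show False by (simp add: eventually_False ae_filter_eq_bot_iff)
  qed
  define \<mu>0 where "\<mu>0 = density lborel (\<lambda>t. ennreal (Z t / Zt))"
  have divZt: "ennreal (a / Zt) = ennreal a * ennreal (1 / Zt)" if "0 \<le> a" for a
    using that Ztpos by (simp flip: ennreal_mult')
  have nd: "ennreal Zt * ennreal (1 / Zt) = 1" using Ztpos by (simp flip: ennreal_mult')
  have \<mu>0s[measurable_cong]: "sets \<mu>0 = sets borel" by (simp add: \<mu>0_def)
  interpret \<mu>0: prob_space \<mu>0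
  proof (rule prob_spaceI)
    have "emeasure \<mu>0 (space \<mu>0) = (\<integral>\<^sup>+t. ennreal (Z t) * ennreal (1 / Zt) \<partial>lborel)"
      by (simp add: \<mu>0_def emeasure_density) (intro nn_integral_cong divZt less_imp_le Zpos)
    also have "\<dots> = 1" using Zt tot nd by (simp add: nn_integral_multc)
    finally show "emeasure \<mu>0 (space \<mu>0) = 1" .
  qed
  define \<nu> where "\<nu> = Giry_Monad.bind \<mu>0 P"
  have Pm': "P \<in> measurable \<mu>0 (subprob_algebra borel)" by measurable
  have \<mu>0ne: "space \<mu>0 \<noteq> {}" by (simp add: \<mu>0_def)
  have s\<nu>: "sets \<nu> = sets borel" unfolding \<nu>_def by (rule sets_bind_measurable[OF Pm' \<mu>0ne])
  have Pint: "(\<integral>\<^sup>+z. f z \<partial>P t) = (\<integral>\<^sup>+x. f (t, vec_lambda x) \<partial>N (kk t))"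
    if f: "f \<in> borel_measurable borel" for f t
  proof -
    have "(\<lambda>b. (t, vec_lambda b :: real^'d)) \<in> measurable (N (kk t)) (borel \<Otimes>\<^sub>M borel)" by measurable
    then have "(\<lambda>b. (t, vec_lambda b :: real^'d)) \<in> measurable (N (kk t)) borel" by (simp add: borel_prod)
    then show ?thesis unfolding P_def by (rule nn_integral_distr) (simp add: f)
  qed
  have \<nu>int: "(\<integral>\<^sup>+z. f z \<partial>\<nu>) = (\<integral>\<^sup>+t. \<integral>\<^sup>+x. f (t, vec_lambda x) \<partial>N (kk t) \<partial>\<mu>0)"
    if f: "f \<in> borel_measurable borel" for f
    unfolding \<nu>_def nn_integral_bind[OF f Pm'] Pint[OF f] ..
  have prob\<nu>: "prob_space \<nu>"
  proof (rule prob_spaceI)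
    have "emeasure \<nu> (space \<nu>) = (\<integral>\<^sup>+z. 1 \<partial>\<nu>)" by simp
    also have "\<dots> = 1" by (subst \<nu>int) (simp_all add: prob_space.emeasure_space_1[OF Np] \<mu>0.emeasure_space_1)
    finally show "emeasure \<nu> (space \<nu>) = 1" .
  qed
  have star: "\<nu> \<in> star_family"
    unfolding star_family_def
  proof (intro CollectI conjI exI allI)
    show "prob_space \<nu>" "sets \<nu> = sets borel" by fact+
    show "prob_space \<mu>0" by unfold_locales
    show "sets \<mu>0 = sets (borel :: real measure)" by fact
    show "(\<lambda>t. gibbs1 (\<phi> (kk t) j)) \<in> measurable borel (prob_algebra borel)" for j
    proof (rule measurable_compose[OF kkm])
      show "(\<lambda>n. gibbs1 (\<phi> n j)) \<in> measurable (count_space UNIV) (prob_algebra borel)"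
        using prob_space_gibbs1[OF pot] by (auto simp: space_prob_algebra)
    qed
    show "\<nu> = Giry_Monad.bind \<mu>0 (\<lambda>\<theta>. distr (PiM UNIV (\<lambda>j. gibbs1 (\<phi> (kk \<theta>) j))) borel (\<lambda>b. (\<theta>, vec_lambda b)))"
      by (simp add: \<nu>_def P_def[abs_def] N_def)
  qed
  define pp where "pp z = (\<Sum>j\<in>UNIV. \<phi> (kk (fst z)) j (snd z $ j))" for z :: "real \<times> (real^'d)"
  have ppm[measurable]: "pp \<in> borel_measurable borel"
  proof -
    have kf: "(\<lambda>z::real \<times> (real^'d). kk (fst z)) \<in> measurable borel (count_space UNIV)"
      by (rule measurable_compose[OF _ kkm]) (simp add: borel_prod[symmetric])
    \<comment> \<open>For a fixed index the sum is continuous; joint measurability follows by gluing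
      over the countably many values of \<open>kk\<close>.\<close>
    have "(\<lambda>z::real \<times> (real^'d). \<Sum>j\<in>UNIV. \<phi> n j (snd z $ j)) \<in> borel_measurable borel" for n
      by (intro borel_measurable_continuous_onI continuous_intros
          continuous_on_compose2[OF sconv_continuous[OF potential_sconv[OF pot], of UNIV]]) auto
    from measurable_compose_countable[OF this kf] show ?thesis by (simp add: pp_def[abs_def])
  qed
  define p where "p z = Z (fst z) / Zt * exp (- pp z)" for z
  define r where "r z = exp (- V z) / Zt" for z
  have Zfm[measurable]: "(\<lambda>z::real \<times> (real^'d). Z (fst z)) \<in> borel_measurable borel"
    by (intro borel_measurable_continuous_onI continuous_on_compose2[OF Zc] continuous_intros) auto
  have pm[measurable]: "p \<in> borel_measurable borel" unfolding p_def by measurable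
  have rm[measurable]: "r \<in> borel_measurable borel" unfolding r_def by measurable
  have \<nu>p: "\<nu> = density lborel (\<lambda>z. ennreal (p z))"
  proof (rule measure_eqI)
    show "sets \<nu> = sets (density lborel (\<lambda>z. ennreal (p z)))" by (simp add: s\<nu>)
    fix A assume "A \<in> sets \<nu>"
    then have A[measurable]: "A \<in> sets borel" by (simp add: s\<nu>)
    have "emeasure \<nu> A = (\<integral>\<^sup>+z. indicator A z \<partial>\<nu>)" using A s\<nu> by simp
    also have "\<dots> = (\<integral>\<^sup>+t. \<integral>\<^sup>+x. indicator A (t, vec_lambda x) \<partial>N (kk t) \<partial>\<mu>0)"
      by (rule \<nu>int) measurable
    also have "\<dots> = (\<integral>\<^sup>+t. ennreal (Z t / Zt) * (\<integral>\<^sup>+x. indicator A (t, vec_lambda x) \<partial>N (kk t)) \<partial>lborel)"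
    proof -
      have "(\<lambda>t. \<integral>\<^sup>+z. indicator A z \<partial>P t) \<in> borel_measurable borel"
        by (rule measurable_compose[OF Pm nn_integral_measurable_subprob_algebra]) measurable
      then have m: "(\<lambda>t. \<integral>\<^sup>+x. indicator A (t, vec_lambda x) \<partial>N (kk t)) \<in> borel_measurable borel"
        by (simp only: Pint[OF borel_measurable_indicator[OF A]])
      show ?thesis unfolding \<mu>0_def using m by (subst nn_integral_density) auto
    qed
    also have "\<dots> = (\<integral>\<^sup>+t. \<integral>\<^sup>+\<beta>. ennreal (p (t, \<beta>)) * indicator A (t, \<beta>) \<partial>lborel \<partial>lborel)"
    proof (rule nn_integral_cong)
      fix t
      have im: "(\<lambda>\<beta>. indicator A (t, \<beta>) :: ennreal) \<in> borel_measurable borel"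
        using A by (simp add: borel_prod[symmetric])
      have pm': "(\<lambda>\<beta>. pp (t, \<beta>)) \<in> borel_measurable borel"
        by (rule measurable_compose[OF _ ppm]) (simp add: borel_prod[symmetric])
      have pm'': "prod_pot (\<phi> (kk t)) \<in> borel_measurable (PiM UNIV (\<lambda>_. borel))"
        by (rule qgrow_measurable[OF qgrow_prod_pot[where \<phi>="\<phi> (kk t)", OF pot]])
      have m1: "(\<lambda>x. indicator A (t, vec_lambda x) :: ennreal) \<in> borel_measurable (PiM UNIV (\<lambda>_. lborel))"
        using measurable_compose[OF measurable_vec_lambda im] by simp
      have "(\<integral>\<^sup>+x. indicator A (t, vec_lambda x) \<partial>N (kk t))
         = (\<integral>\<^sup>+x. ennreal (exp (- prod_pot (\<phi> (kk t)) x)) * indicator A (t, vec_lambda x) \<partial>PiM UNIV (\<lambda>_. lborel))"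
        unfolding N_def gibbsP_density[where \<phi>="\<phi> (kk t)", OF pot]
        using m1 pm'' by (subst nn_integral_density) auto
      also have "\<dots> = (\<integral>\<^sup>+x. ennreal (exp (- pp (t, vec_lambda x))) * indicator A (t, vec_lambda x) \<partial>PiM UNIV (\<lambda>_. lborel))"
        by (simp add: pp_def)
      also have "\<dots> = (\<integral>\<^sup>+\<beta>. ennreal (exp (- pp (t, \<beta>))) * indicator A (t, \<beta>) \<partial>lborel)"
        using im pm' by (intro nn_integral_lborel_vec[symmetric]) measurable
      finally have "ennreal (Z t / Zt) * (\<integral>\<^sup>+x. indicator A (t, vec_lambda x) \<partial>N (kk t))
        = (\<integral>\<^sup>+\<beta>. ennreal (Z t / Zt) * (ennreal (exp (- pp (t, \<beta>))) * indicator A (t, \<beta>)) \<partial>lborel)"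
        using im pm' by (subst nn_integral_cmult) auto
      also have "\<dots> = (\<integral>\<^sup>+\<beta>. ennreal (p (t, \<beta>)) * indicator A (t, \<beta>) \<partial>lborel)"
      proof -
        have "ennreal (p (t, \<beta>)) = ennreal (Z t / Zt) * ennreal (exp (- pp (t, \<beta>)))" for \<beta>
          unfolding p_def fst_conv using Zpos[of t] Ztpos by (intro ennreal_mult) auto
        then show ?thesis by (simp only: mult.assoc)
      qed
      finally show "ennreal (Z t / Zt) * (\<integral>\<^sup>+x. indicator A (t, vec_lambda x) \<partial>N (kk t))
        = (\<integral>\<^sup>+\<beta>. ennreal (p (t, \<beta>)) * indicator A (t, \<beta>) \<partial>lborel)" .
    qed
    also have "\<dots> = (\<integral>\<^sup>+z. ennreal (p z) * indicator A z \<partial>(lborel \<Otimes>\<^sub>M lborel))"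
      by (rule lborel.nn_integral_fst) (simp add: lborel_prod)
    also have "\<dots> = emeasure (density lborel (\<lambda>z. ennreal (p z))) A"
      by (simp add: lborel_prod emeasure_density)
    finally show "emeasure \<nu> A = emeasure (density lborel (\<lambda>z. ennreal (p z))) A" .
  qed
  have g: "gibbs V = density lborel (\<lambda>z. ennreal (r z))"
    by (simp add: gibbs_def r_def Zt_def)
  define f where "f z = ln (p z / r z)" for z
  have [measurable]: "f \<in> borel_measurable borel" unfolding f_def by measurable
  \<comment> \<open>The root densities of the two measures agree, so \<open>Zt\<close> cancels and
    the log-ratio is the conditional one, whose mean over the leaves is
    \<open>\<Lambda> (\<phi> (kk t)) t\<close>.\<close>
  have fe: "f (t, vec_lambda x) = ln (Z t) + (V (t, vec_lambda x) - prod_pot (\<phi> (kk t)) x)" for t x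
  proof -
    have "p (t, vec_lambda x) / r (t, vec_lambda x) = Z t * exp (V (t, vec_lambda x) - prod_pot (\<phi> (kk t)) x)"
      using Ztpos by (simp add: p_def r_def pp_def exp_diff exp_minus field_simps)
    then show ?thesis using Zpos[of t] by (simp add: f_def ln_mult)
  qed
  have "KL \<nu> (gibbs V) \<le> ereal c"
    unfolding \<nu>p g
  proof (rule KL_density_le[OF pm rm _ _ _ c])
    show "0 < p z" "0 < r z" for z using Zpos Ztpos by (auto simp: p_def r_def)
    have "(\<integral>\<^sup>+z. ennreal (r z) \<partial>lborel) = (\<integral>\<^sup>+z. ennreal (exp (- V z)) * ennreal (1 / Zt) \<partial>lborel)"
      unfolding r_def by (intro nn_integral_cong divZt) simp
    also have "\<dots> = 1" using Zt nd by (simp add: nn_integral_multc)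
    finally show "(\<integral>\<^sup>+z. ennreal (r z) \<partial>lborel) = 1" .
    \<comment> \<open>The bound is established for each root value in terms of positive and negative
      parts, so integrating it over the root presupposes no joint integrability.\<close>
    have inner: "(\<integral>\<^sup>+x. ennreal (f (t, vec_lambda x)) \<partial>N (kk t)) \<le> ennreal c + (\<integral>\<^sup>+x. ennreal (- f (t, vec_lambda x)) \<partial>N (kk t))" for t
    proof (rule nn_integral_le_of_integral_le[OF _ _ c])
      interpret N: prob_space "N (kk t)" by (rule Np)
      have i: "integrable (N (kk t)) (\<lambda>x. V (t, vec_lambda x) - prod_pot (\<phi> (kk t)) x)"
        unfolding N_def
        by (rule qgrow_integrable[where \<phi>="\<phi> (kk t)", OF pot _ qgrow_diff[OF sc.qgrow_U qgrow_prod_pot[where \<phi>="\<phi> (kk t)", OF pot]]]) simp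
      then show "integrable (N (kk t)) (\<lambda>x. f (t, vec_lambda x))" unfolding fe by auto
      have "(\<integral>x. f (t, vec_lambda x) \<partial>N (kk t)) = ln (Z t) + (\<integral>x. V (t, vec_lambda x) - prod_pot (\<phi> (kk t)) x \<partial>N (kk t))"
        unfolding fe using i N.prob_space by (subst Bochner_Integration.integral_add) auto
      also have "\<dots> \<le> c" using kk[of t] by (simp add: \<Lambda>_def N_def)
      finally show "(\<integral>x. f (t, vec_lambda x) \<partial>N (kk t)) \<le> c" .
    qed
    have m: "(\<lambda>t. \<integral>\<^sup>+x. ennreal (- f (t, vec_lambda x)) \<partial>N (kk t)) \<in> borel_measurable \<mu>0"
    proof -
      have "(\<lambda>t. \<integral>\<^sup>+z. ennreal (- f z) \<partial>P t) \<in> borel_measurable \<mu>0"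
        by (rule measurable_compose[OF Pm' nn_integral_measurable_subprob_algebra]) measurable
      moreover have "(\<integral>\<^sup>+z. ennreal (- f z) \<partial>P t) = (\<integral>\<^sup>+x. ennreal (- f (t, vec_lambda x)) \<partial>N (kk t))" for t
        by (rule Pint) measurable
      ultimately show ?thesis by (simp only:)
    qed
    have "(\<integral>\<^sup>+z. ennreal (f z) \<partial>\<nu>) = (\<integral>\<^sup>+t. \<integral>\<^sup>+x. ennreal (f (t, vec_lambda x)) \<partial>N (kk t) \<partial>\<mu>0)"
      by (rule \<nu>int) measurable
    also have "\<dots> \<le> (\<integral>\<^sup>+t. ennreal c + (\<integral>\<^sup>+x. ennreal (- f (t, vec_lambda x)) \<partial>N (kk t)) \<partial>\<mu>0)"
      by (intro nn_integral_mono inner)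
    also have "\<dots> = ennreal c + (\<integral>\<^sup>+t. \<integral>\<^sup>+x. ennreal (- f (t, vec_lambda x)) \<partial>N (kk t) \<partial>\<mu>0)"
      using m by (subst nn_integral_add) (auto simp: \<mu>0.emeasure_space_1)
    also have "(\<integral>\<^sup>+t. \<integral>\<^sup>+x. ennreal (- f (t, vec_lambda x)) \<partial>N (kk t) \<partial>\<mu>0) = (\<integral>\<^sup>+z. ennreal (- f z) \<partial>\<nu>)"
      by (rule \<nu>int[symmetric]) measurable
    finally show "(\<integral>\<^sup>+z. ennreal (ln (p z / r z)) \<partial>density lborel (\<lambda>z. ennreal (p z)))
       \<le> ennreal c + (\<integral>\<^sup>+z. ennreal (- ln (p z / r z)) \<partial>density lborel (\<lambda>z. ennreal (p z)))"
      unfolding f_def \<nu>p .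
  qed
  with star show ?thesis unfolding c_def by blast
qed

section \<open>The generalized linear model\<close>

lemma sconv_second_derivative:
  assumes k: "0 < \<kappa>" and d: "\<And>t. (u has_real_derivative u' t) (at t)" "\<And>t. (u' has_real_derivative u'' t) (at t)"
    and b: "\<And>t. \<kappa> \<le> u'' t \<and> u'' t \<le> M"
  shows "sconv \<kappa> M u u'"
  unfolding sconv_def
proof (intro conjI allI impI k d)
  fix s t :: real assume st: "s \<le> t"
  have "\<exists>z. u' t - u' s = (t - s) * u'' z"
  proof (cases "s = t")
    case False
    then show ?thesis using MVT2[of s t u' u''] d(2) st by force
  qed simp
  then obtain z where z: "u' t - u' s = (t - s) * u'' z" by blast
  show "\<kappa> * (t - s) \<le> u' t - u' s" "u' t - u' s \<le> M * (t - s)"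
    unfolding z using b[of z] st mult_right_mono[of _ _ "t - s"] by (auto simp: mult.commute)
qed

text \<open>\<open>sconv\<close> demands a positive modulus, while \<rho> is merely convex; adding
  \<open>t\<^sup>2 / 2\<close> supplies the modulus 1.\<close>

lemma sconv_shift:
  assumes d: "\<And>t. (u has_real_derivative u' t) (at t)" "\<And>t. (u' has_real_derivative u'' t) (at t)"
    and b: "\<And>t. 0 \<le> u'' t \<and> u'' t \<le> M"
  shows "sconv 1 (1 + M) (\<lambda>t. u t + t\<^sup>2 / 2) (\<lambda>t. u' t + t)"
proof (rule sconv_second_derivative[where u''="\<lambda>t. u'' t + 1"])
  show "((\<lambda>t. u t + t\<^sup>2 / 2) has_real_derivative u' t + t) (at t)" for t
    by (auto intro!: derivative_eq_intros d)
  show "((\<lambda>t. u' t + t) has_real_derivative u'' t + 1) (at t)" for t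
    by (auto intro!: derivative_eq_intros d)
qed (use b in auto)

lemma qgrow_abs: "qgrow I f \<Longrightarrow> qgrow I (\<lambda>x. \<bar>f x\<bar>)"
  unfolding qgrow_def by auto

lemma quadratic_form_Amat:
  "v \<bullet> (Amat n X c *v v) = (\<Sum>l<n. (X l \<bullet> v)\<^sup>2) / c"
proof -
  have "v \<bullet> (Amat n X c *v v) = (\<Sum>k\<in>UNIV. \<Sum>m\<in>UNIV. \<Sum>l<n. (X l $ k * v $ k) * (X l $ m * v $ m) / c)"
    by (simp add: inner_vec_def matrix_vector_mult_def Amat_def sum_distrib_left sum_distrib_right sum_divide_distrib mult_ac)
  also have "\<dots> = (\<Sum>k\<in>UNIV. \<Sum>l<n. \<Sum>m\<in>UNIV. (X l $ k * v $ k) * (X l $ m * v $ m) / c)"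
    by (intro sum.cong refl sum.swap)
  also have "\<dots> = (\<Sum>l<n. \<Sum>k\<in>UNIV. \<Sum>m\<in>UNIV. (X l $ k * v $ k) * (X l $ m * v $ m) / c)"
    by (rule sum.swap)
  also have "\<dots> = (\<Sum>l<n. (X l \<bullet> v)\<^sup>2) / c"
    by (simp add: inner_vec_def power2_eq_square sum_product sum_divide_distrib)
  finally show ?thesis .
qed

lemma inner_vec_lambda_upd:
  "Y \<bullet> vec_lambda (x(j := t)) = (\<Sum>k\<in>UNIV - {j}. Y $ k * x k) + Y $ j * t"
  unfolding inner_vec_def by (subst sum.remove[of UNIV j]) (auto intro!: sum.cong)

lemma sum_offdiag:
  fixes q :: "'a::{finite,linorder} \<Rightarrow> 'a \<Rightarrow> real"
  assumes "\<And>i j. q i j = q j i"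
  shows "(\<Sum>i\<in>UNIV. \<Sum>j\<in>UNIV - {i}. q i j) = 2 * (\<Sum>(i, j)\<in>{(i, j). i < j}. q i j)"
proof -
  have "(\<Sum>i\<in>UNIV. \<Sum>j\<in>UNIV - {i}. q i j) = (\<Sum>(i, j)\<in>(SIGMA i:UNIV. UNIV - {i}). q i j)"
    by (rule sum.Sigma) auto
  also have "(SIGMA i:UNIV. UNIV - {i}) = {(i, j). i < j} \<union> {(i, j). j < (i::'a)}" by auto
  also have "(\<Sum>(i, j)\<in>\<dots>. q i j) = (\<Sum>(i, j)\<in>{(i, j). i < j}. q i j) + (\<Sum>(i, j)\<in>{(i, j). j < i}. q i j)"
    by (rule sum.union_disjoint) auto
  also have "(\<Sum>(i, j)\<in>{(i, j). j < i}. q i j) = (\<Sum>(i, j)\<in>{(i, j). i < j}. q i j)"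
    by (rule sum.reindex_bij_witness[where i=prod.swap and j=prod.swap]) (auto simp: assms)
  finally show ?thesis by simp
qed

section \<open>Convexity, Hessian and growth of the star potential\<close>

locale star_model =
  fixes n :: nat and X :: "nat \<Rightarrow> real^'d::{finite,linorder}" and Y :: "nat \<Rightarrow> real"
    and c a b B R \<alpha> L :: real
    and \<psi> \<psi>1 \<psi>2 \<rho> \<rho>1 \<rho>2 g g1 g2 :: "real \<Rightarrow> real"
  assumes c_pos: "c > 0"
    and psi: "\<And>x. (\<psi> has_real_derivative \<psi>1 x) (at x)" "\<And>x. (\<psi>1 has_real_derivative \<psi>2 x) (at x)" "continuous_on UNIV \<psi>2"
    and rho: "\<And>x. (\<rho> has_real_derivative \<rho>1 x) (at x)" "\<And>x. (\<rho>1 has_real_derivative \<rho>2 x) (at x)"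
    and g: "\<And>x. (g has_real_derivative g1 x) (at x)" "\<And>x. (g1 has_real_derivative g2 x) (at x)"
    and b_pos: "b > 0"
    and psi2_bd: "\<And>x. b \<le> \<psi>2 x \<and> \<psi>2 x \<le> B"
    and rho2_bd: "\<And>x. 0 \<le> \<rho>2 x \<and> \<rho>2 x \<le> R"
    and a_pos: "a > 0"
    and A_ge: "\<And>v. v \<bullet> (Amat n X c *v v) \<ge> a * (v \<bullet> v)"
    and \<alpha>_pos: "\<alpha> > 0"
    and g2_bd: "\<And>x. \<alpha> \<le> g2 x \<and> g2 x \<le> L"
begin

abbreviation "V \<equiv> V_loc n X Y c \<psi> \<rho> g"

definition grad :: "(real, 'd) vec \<Rightarrow> (real, 'd) vec" where
  "grad \<beta> = (\<Sum>l<n. (\<psi>1 (X l \<bullet> \<beta>) / c) *\<^sub>R X l) - wvec n X Y c"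

definition F :: "(real, 'd) vec \<Rightarrow> real" where
  "F \<beta> = (\<Sum>l<n. \<psi> (X l \<bullet> \<beta>) / c) - wvec n X Y c \<bullet> \<beta>"

text \<open>Bounds both the entries of \<open>calA\<close> and the Lipschitz constant of the
  components of \<open>grad\<close> with respect to the l1 norm.\<close>

definition M0 :: real where "M0 = (\<Sum>l<n. B * (norm (X l))\<^sup>2 / c)"

definition S :: real where
  "S = (SUP \<beta>. \<Sum>(i, j)\<in>{(i, j). i < j}. (calA n X c \<psi>2 \<beta> $ i $ j)\<^sup>2)"

lemma sconv_psi: "sconv b B \<psi> \<psi>1"
  by (rule sconv_second_derivative[OF b_pos psi(1,2) psi2_bd])

lemma sconv_g: "sconv \<alpha> L g g1"
  by (rule sconv_second_derivative[OF \<alpha>_pos g g2_bd])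

lemma sconv_rho: "sconv 1 (1 + R) (\<lambda>t. \<rho> t + t\<^sup>2 / 2) (\<lambda>t. \<rho>1 t + t)"
  by (rule sconv_shift[OF rho rho2_bd])

text \<open>The remainder \<open>(t - s)\<^sup>2 / 2\<close> in the tangent bound with modulus 1
  exactly cancels the contribution of the added \<open>t\<^sup>2 / 2\<close>.\<close>

lemma rho_tangent: "\<rho> s + \<rho>1 s * (t - s) \<le> \<rho> t"
  using sconv_tangent[OF sconv_rho, of s t] by (simp add: power2_eq_square algebra_simps)

lemma B_pos: "0 < B" using b_pos psi2_bd[of 0] by linarith

lemma R_nonneg: "0 \<le> R" using rho2_bd[of 0] by linarith

lemma rho1_lipschitz: "\<bar>\<rho>1 t - \<rho>1 s\<bar> \<le> R * \<bar>t - s\<bar>"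
  using field_differentiable_bound[of UNIV \<rho>1 \<rho>2 R t s] rho(2) rho2_bd by auto

lemma M0_nonneg: "0 \<le> M0"
  unfolding M0_def using B_pos c_pos by (intro sum_nonneg) auto

lemma V_eq: "V (\<theta>, \<beta>) = g \<theta> + F \<beta> + (\<Sum>j\<in>UNIV. \<rho> (\<beta> $ j - \<theta>))"
  by (simp add: V_loc_def F_def)

lemma grad_inner: "grad \<beta> \<bullet> v = (\<Sum>l<n. \<psi>1 (X l \<bullet> \<beta>) * (X l \<bullet> v) / c) - wvec n X Y c \<bullet> v"
  by (simp add: grad_def inner_diff_left inner_sum_left)

text \<open>The origin of \<kappa> = a b: \<psi> has convexity modulus \<open>b\<close> along each
  linear form \<open>X l \<bullet> \<beta>\<close>, and the lower bound on \<open>Amat\<close> turns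
  the sum of squares of these forms into \<open>a\<close> times the squared norm.\<close>

lemma F_convex: "F \<beta> + grad \<beta> \<bullet> (\<gamma> - \<beta>) + a * b / 2 * ((\<gamma> - \<beta>) \<bullet> (\<gamma> - \<beta>)) \<le> F \<gamma>"
proof -
  let ?v = "\<gamma> - \<beta>"
  have "(\<Sum>l<n. (\<psi> (X l \<bullet> \<beta>) + \<psi>1 (X l \<bullet> \<beta>) * (X l \<bullet> ?v) + b / 2 * (X l \<bullet> ?v)\<^sup>2) / c) \<le> (\<Sum>l<n. \<psi> (X l \<bullet> \<gamma>) / c)"
    using sconv_tangent[OF sconv_psi] c_pos
    by (intro sum_mono divide_right_mono) (auto simp: inner_diff_right)
  moreover have "(\<Sum>l<n. (\<psi> (X l \<bullet> \<beta>) + \<psi>1 (X l \<bullet> \<beta>) * (X l \<bullet> ?v) + b / 2 * (X l \<bullet> ?v)\<^sup>2) / c)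
      = (\<Sum>l<n. \<psi> (X l \<bullet> \<beta>) / c) + (\<Sum>l<n. \<psi>1 (X l \<bullet> \<beta>) * (X l \<bullet> ?v) / c) + b / 2 * ((\<Sum>l<n. (X l \<bullet> ?v)\<^sup>2) / c)"
    by (simp add: add_divide_distrib sum.distrib sum_distrib_left sum_divide_distrib)
  moreover have "b / 2 * (a * (?v \<bullet> ?v)) \<le> b / 2 * ((\<Sum>l<n. (X l \<bullet> ?v)\<^sup>2) / c)"
    using A_ge[of ?v] b_pos unfolding quadratic_form_Amat by (intro mult_left_mono) auto
  moreover have "b / 2 * (a * (?v \<bullet> ?v)) = a * b / 2 * (?v \<bullet> ?v)" by simp
  moreover have "wvec n X Y c \<bullet> ?v = wvec n X Y c \<bullet> \<gamma> - wvec n X Y c \<bullet> \<beta>" by (rule inner_diff_right)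
  ultimately show ?thesis
    unfolding F_def grad_inner by linarith
qed

lemma calA_nth: "calA n X c \<psi>2 \<beta> $ i $ j = (\<Sum>l<n. X l $ i * \<psi>2 (X l \<bullet> \<beta>) * X l $ j) / c"
  by (simp add: calA_def)

lemma calA_sym: "calA n X c \<psi>2 \<beta> $ i $ j = calA n X c \<psi>2 \<beta> $ j $ i"
  by (simp add: calA_nth mult_ac)

lemma calA_bound: "\<bar>calA n X c \<psi>2 \<beta> $ i $ j\<bar> \<le> M0"
proof -
  have "\<bar>calA n X c \<psi>2 \<beta> $ i $ j\<bar> = \<bar>\<Sum>l<n. X l $ i * \<psi>2 (X l \<bullet> \<beta>) * X l $ j / c\<bar>"
    by (simp add: calA_nth sum_divide_distrib)
  also have "\<dots> \<le> (\<Sum>l<n. \<bar>X l $ i * \<psi>2 (X l \<bullet> \<beta>) * X l $ j / c\<bar>)" by (rule sum_abs)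
  also have "\<dots> \<le> M0"
    unfolding M0_def
  proof (rule sum_mono)
    fix l
    have "\<bar>\<psi>2 (X l \<bullet> \<beta>)\<bar> \<le> B" using psi2_bd[of "X l \<bullet> \<beta>"] b_pos by auto
    then have "\<bar>X l $ i\<bar> * \<bar>\<psi>2 (X l \<bullet> \<beta>)\<bar> * \<bar>X l $ j\<bar> \<le> norm (X l) * B * norm (X l)"
      using component_le_norm_cart B_pos by (intro mult_mono) auto
    then show "\<bar>X l $ i * \<psi>2 (X l \<bullet> \<beta>) * X l $ j / c\<bar> \<le> B * (norm (X l))\<^sup>2 / c"
      using c_pos by (simp add: abs_mult power2_eq_square divide_right_mono mult_ac)
  qed
  finally show ?thesis .
qed

lemma offdiag_le_S: "(\<Sum>i\<in>UNIV. \<Sum>j\<in>UNIV - {i}. (calA n X c \<psi>2 \<beta> $ i $ j)\<^sup>2) \<le> 2 * S"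
proof -
  have "(\<Sum>(i, j)\<in>{(i, j). i < j}. (calA n X c \<psi>2 \<beta> $ i $ j)\<^sup>2) \<le> S"
    unfolding S_def
  \<comment> \<open>The supremum ranges over all \<beta>, yet it is a genuine real supremum, because
    the entries of \<open>calA\<close> are bounded by \<open>M0\<close>.\<close>
  proof (rule cSUP_upper[OF UNIV_I], rule bdd_aboveI, clarsimp)
    fix \<beta>
    show "(\<Sum>(i, j)\<in>{(i, j). i < j}. (calA n X c \<psi>2 \<beta> $ i $ j)\<^sup>2) \<le> (\<Sum>(i, j)\<in>{(i::'d, j). i < j}. M0\<^sup>2)"
      using calA_bound M0_nonneg by (intro sum_mono) (auto intro!: abs_le_square_iff[THEN iffD1])
  qed
  moreover have "(\<Sum>i\<in>UNIV. \<Sum>j\<in>UNIV - {i}. (calA n X c \<psi>2 \<beta> $ i $ j)\<^sup>2)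
     = 2 * (\<Sum>(i, j)\<in>{(i, j). i < j}. (calA n X c \<psi>2 \<beta> $ i $ j)\<^sup>2)"
    by (rule sum_offdiag) (simp add: calA_sym)
  ultimately show ?thesis by simp
qed

lemma grad_lipschitz: "\<bar>grad \<beta> $ i - grad \<gamma> $ i\<bar> \<le> M0 * (\<Sum>j\<in>UNIV. \<bar>\<beta> $ j - \<gamma> $ j\<bar>)"
proof -
  let ?s = "\<Sum>j\<in>UNIV. \<bar>\<beta> $ j - \<gamma> $ j\<bar>"
  have "grad \<beta> $ i - grad \<gamma> $ i = (\<Sum>l<n. (\<psi>1 (X l \<bullet> \<beta>) - \<psi>1 (X l \<bullet> \<gamma>)) / c * X l $ i)"
    by (simp add: grad_def sum_subtractf diff_divide_distrib left_diff_distrib)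
  also have "\<bar>\<dots>\<bar> \<le> (\<Sum>l<n. \<bar>(\<psi>1 (X l \<bullet> \<beta>) - \<psi>1 (X l \<bullet> \<gamma>)) / c * X l $ i\<bar>)" by (rule sum_abs)
  also have "\<dots> \<le> (\<Sum>l<n. B * (norm (X l))\<^sup>2 / c * ?s)"
  proof (rule sum_mono)
    fix l
    have "norm (\<beta> - \<gamma>) \<le> ?s" using norm_le_l1_cart[of "\<beta> - \<gamma>"] by simp
    then have n: "\<bar>X l \<bullet> (\<beta> - \<gamma>)\<bar> \<le> norm (X l) * ?s"
      by (intro order_trans[OF Cauchy_Schwarz_ineq2] mult_left_mono) auto
    have "\<bar>\<psi>1 (X l \<bullet> \<beta>) - \<psi>1 (X l \<bullet> \<gamma>)\<bar> \<le> B * \<bar>X l \<bullet> (\<beta> - \<gamma>)\<bar>"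
      using sconv_lipschitz[OF sconv_psi, of "X l \<bullet> \<beta>" "X l \<bullet> \<gamma>"] by (simp add: inner_diff_right)
    also have "\<dots> \<le> B * (norm (X l) * ?s)" using n B_pos by (intro mult_left_mono) auto
    finally have "\<bar>\<psi>1 (X l \<bullet> \<beta>) - \<psi>1 (X l \<bullet> \<gamma>)\<bar> * \<bar>X l $ i\<bar> \<le> B * (norm (X l) * ?s) * norm (X l)"
      using component_le_norm_cart[of "X l" i] B_pos by (intro mult_mono mult_nonneg_nonneg sum_nonneg) auto
    then have "\<bar>\<psi>1 (X l \<bullet> \<beta>) - \<psi>1 (X l \<bullet> \<gamma>)\<bar> * \<bar>X l $ i\<bar> / c \<le> B * (norm (X l) * ?s) * norm (X l) / c"
      using c_pos by (intro divide_right_mono) auto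
    then show "\<bar>(\<psi>1 (X l \<bullet> \<beta>) - \<psi>1 (X l \<bullet> \<gamma>)) / c * X l $ i\<bar> \<le> B * (norm (X l))\<^sup>2 / c * ?s"
      using c_pos by (simp add: abs_mult power2_eq_square mult_ac)
  qed
  also have "\<dots> = M0 * ?s" by (simp add: M0_def sum_distrib_right)
  finally show ?thesis .
qed

lemma continuous_psi: "continuous_on A \<psi>"
  by (intro continuous_at_imp_continuous_on ballI DERIV_isCont[OF psi(1)])

lemma continuous_psi1: "continuous_on A \<psi>1"
  by (intro continuous_at_imp_continuous_on ballI DERIV_isCont[OF psi(2)])

lemma continuous_rho: "continuous_on A \<rho>"
  by (intro continuous_at_imp_continuous_on ballI DERIV_isCont[OF rho(1)])

lemma continuous_rho1: "continuous_on A \<rho>1"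
  by (intro continuous_at_imp_continuous_on ballI DERIV_isCont[OF rho(2)])

lemma continuous_g: "continuous_on A g"
  by (intro continuous_at_imp_continuous_on ballI DERIV_isCont[OF g(1)])

lemma continuous_V: "continuous_on UNIV V"
  unfolding V_loc_def case_prod_beta'
  by (intro continuous_intros continuous_on_compose2[OF continuous_psi[of UNIV]]
      continuous_on_compose2[OF continuous_rho[of UNIV]] continuous_on_compose2[OF continuous_g[of UNIV]])
     (use c_pos in auto)

text \<open>Each \<rho> term involves a single leaf, so it leaves the mixed second derivatives equal
  to those of \<open>F\<close>; being convex, it does not lower the modulus. All constants are
  independent of the root value.\<close>

lemma V_strongly_convex:
  "strongly_convex (\<lambda>x. V (\<theta>, vec_lambda x)) (\<lambda>i x. grad (vec_lambda x) $ i + \<rho>1 (x i - \<theta>))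
     (\<lambda>i j x. calA n X c \<psi>2 (vec_lambda x) $ i $ j) (a * b) (M0 + R) S"
proof
  show "0 < a * b" using a_pos b_pos by simp
  fix x y :: "'d \<Rightarrow> real" and i j t
  have s0: "0 \<le> (\<Sum>j\<in>UNIV. \<bar>x j - y j\<bar>)" by (intro sum_nonneg) auto
  show "V (\<theta>, vec_lambda x) + (\<Sum>i\<in>UNIV. (grad (vec_lambda x) $ i + \<rho>1 (x i - \<theta>)) * (y i - x i))
      + a * b / 2 * (\<Sum>i\<in>UNIV. (y i - x i)\<^sup>2) \<le> V (\<theta>, vec_lambda y)"
  proof -
    have "(\<Sum>j\<in>UNIV. \<rho> (x j - \<theta>) + \<rho>1 (x j - \<theta>) * (y j - x j)) \<le> (\<Sum>j\<in>UNIV. \<rho> (y j - \<theta>))"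
      using rho_tangent[of "x _ - \<theta>" "y _ - \<theta>"] by (intro sum_mono) simp
    moreover have "grad (vec_lambda x) \<bullet> (vec_lambda y - vec_lambda x) = (\<Sum>i\<in>UNIV. grad (vec_lambda x) $ i * (y i - x i))"
      by (simp add: inner_vec_def)
    moreover have "(vec_lambda y - vec_lambda x) \<bullet> (vec_lambda y - vec_lambda x :: (real, 'd) vec) = (\<Sum>i\<in>UNIV. (y i - x i)\<^sup>2)"
      by (simp add: inner_vec_def power2_eq_square)
    ultimately show ?thesis
      using F_convex[of "vec_lambda x" "vec_lambda y"]
      unfolding V_eq by (simp add: sum.distrib distrib_right)
  qed
  show "\<bar>grad (vec_lambda x) $ i + \<rho>1 (x i - \<theta>) - (grad (vec_lambda y) $ i + \<rho>1 (y i - \<theta>))\<bar>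
      \<le> (M0 + R) * (\<Sum>j\<in>UNIV. \<bar>x j - y j\<bar>)"
  proof -
    have "\<bar>\<rho>1 (x i - \<theta>) - \<rho>1 (y i - \<theta>)\<bar> \<le> R * \<bar>x i - y i\<bar>"
      using rho1_lipschitz[of "x i - \<theta>" "y i - \<theta>"] by simp
    also have "\<dots> \<le> R * (\<Sum>j\<in>UNIV. \<bar>x j - y j\<bar>)"
      using R_nonneg member_le_sum[of i UNIV "\<lambda>j. \<bar>x j - y j\<bar>"] by (intro mult_left_mono) auto
    finally show ?thesis
      using grad_lipschitz[of "vec_lambda x" i "vec_lambda y"] unfolding distrib_right by simp
  qed
  show "(\<Sum>i\<in>UNIV. \<Sum>j\<in>UNIV - {i}. (calA n X c \<psi>2 (vec_lambda x) $ i $ j)\<^sup>2) \<le> 2 * S"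
    by (rule offdiag_le_S)
  show "\<bar>calA n X c \<psi>2 (vec_lambda x) $ i $ j\<bar> \<le> M0 + R"
    using calA_bound[of "vec_lambda x" i j] R_nonneg by linarith
  have V: "continuous_on UNIV (\<lambda>\<beta>. V (\<theta>, \<beta>))"
    by (intro continuous_on_compose2[OF continuous_V]) (auto intro!: continuous_intros)
  show "(\<lambda>x. V (\<theta>, vec_lambda x)) \<in> borel_measurable (PiM UNIV (\<lambda>_. borel))"
    by (rule measurable_compose[OF measurable_vec_lambda borel_measurable_continuous_onI[OF V]])
  have "continuous_on UNIV (\<lambda>\<beta>. grad \<beta> $ i)"
    unfolding grad_def
    by (intro continuous_intros continuous_on_compose2[OF continuous_psi1[of UNIV]]) (use c_pos in auto)
  from measurable_compose[OF measurable_vec_lambda borel_measurable_continuous_onI[OF this]]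
  have [measurable]: "(\<lambda>x. grad (vec_lambda x) $ i) \<in> borel_measurable (PiM UNIV (\<lambda>_. borel))" .
  have [measurable]: "\<rho>1 \<in> borel_measurable borel" by (rule borel_measurable_continuous_onI[OF continuous_rho1])
  show "(\<lambda>x. grad (vec_lambda x) $ i + \<rho>1 (x i - \<theta>)) \<in> borel_measurable (PiM UNIV (\<lambda>_. borel))"
    by measurable
  have "continuous_on UNIV (\<lambda>\<beta>. calA n X c \<psi>2 \<beta> $ i $ j)"
    unfolding calA_nth
    by (intro continuous_intros continuous_on_compose2[OF psi(3)]) (use c_pos in auto)
  from measurable_compose[OF measurable_vec_lambda borel_measurable_continuous_onI[OF this]]
  show "(\<lambda>x. calA n X c \<psi>2 (vec_lambda x) $ i $ j) \<in> borel_measurable (PiM UNIV (\<lambda>_. borel))" .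
  show "continuous_on UNIV (\<lambda>t. calA n X c \<psi>2 (vec_lambda (x(j := t))) $ i $ j)"
    unfolding calA_nth inner_vec_lambda_upd
    by (intro continuous_intros continuous_on_compose2[OF psi(3)]) (use c_pos in auto)
  assume ij: "i \<noteq> j"
  have dX: "((\<lambda>t. \<psi>1 (X l \<bullet> vec_lambda (x(j := t)))) has_real_derivative \<psi>2 (X l \<bullet> vec_lambda (x(j := t))) * X l $ j) (at t)" for l
    unfolding inner_vec_lambda_upd
    by (rule DERIV_chain2[OF psi(2)]) (auto intro!: derivative_eq_intros)
  have "((\<lambda>t. (\<Sum>l<n. \<psi>1 (X l \<bullet> vec_lambda (x(j := t))) / c * X l $ i) - wvec n X Y c $ i + \<rho>1 (x i - \<theta>))
      has_real_derivative (\<Sum>l<n. \<psi>2 (X l \<bullet> vec_lambda (x(j := t))) * X l $ j / c * X l $ i) - 0 + 0) (at t)"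
    by (intro DERIV_add DERIV_diff DERIV_sum DERIV_const DERIV_cmult_right DERIV_cdivide dX)
  then show "((\<lambda>t. grad (vec_lambda (x(j := t))) $ i + \<rho>1 ((x(j := t)) i - \<theta>)) has_real_derivative
      calA n X c \<psi>2 (vec_lambda (x(j := t))) $ i $ j) (at t)"
    using ij by (simp add: grad_def calA_nth sum_divide_distrib mult_ac)
qed

lemma rho_growth: "\<exists>C. \<forall>t. \<bar>\<rho> t\<bar> \<le> C * (1 + t\<^sup>2)"
proof -
  let ?C = "\<bar>\<rho> 0\<bar> + 3 * (\<bar>\<rho>1 0\<bar> + (1 + R))"
  have "\<bar>\<rho> t\<bar> \<le> (?C + 1) * (1 + t\<^sup>2)" for t
  proof -
    define y where "y = ?C * (1 + t\<^sup>2)"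
    have "\<bar>\<rho> t + t\<^sup>2 / 2\<bar> \<le> y" using sconv_growth[OF sconv_rho, of t] by (simp add: y_def)
    moreover have "0 \<le> t\<^sup>2" by simp
    ultimately have "\<bar>\<rho> t\<bar> \<le> y + (1 + t\<^sup>2)" by linarith
    then show ?thesis unfolding y_def distrib_right[of ?C 1] by simp
  qed
  then show ?thesis by blast
qed

text \<open>At root value 0 the potential has quadratic growth by strong convexity. Moving the root
  within \<open>\<bar>t\<bar> \<le> K\<close> changes only \<open>g\<close> and the shifts of
  \<rho>.\<close>

lemma V_dominated: "\<exists>w. qgrow UNIV w \<and> (\<forall>t x. \<bar>t\<bar> \<le> K \<longrightarrow> \<bar>V (t, vec_lambda x)\<bar> \<le> w x)"
proof -
  interpret sc: strongly_convex "\<lambda>x. V (0, vec_lambda x)" "\<lambda>i x. grad (vec_lambda x) $ i + \<rho>1 (x i - 0)"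
    "\<lambda>i j x. calA n X c \<psi>2 (vec_lambda x) $ i $ j" "a * b" "M0 + R" S
    by (rule V_strongly_convex)
  obtain C where C: "\<And>t. \<bar>\<rho> t\<bar> \<le> C * (1 + t\<^sup>2)" using rho_growth by blast
  have C0: "0 \<le> C" using C[of 0] by simp
  let ?G = "\<bar>g 0\<bar> + 3 * (\<bar>g1 0\<bar> + L)"
  have G0: "0 \<le> ?G" using sconv_growth[OF sconv_g, of 0] by simp
  \<comment> \<open>Adds the growth bounds of \<rho> at \<open>x j - t\<close> and at
    \<open>x j\<close>, with
    \<open>(x j - t)\<^sup>2 \<le> 2 * (x j)\<^sup>2 + 2 * K\<^sup>2\<close>.\<close>
  define e where "e t = C * (2 + 2 * K\<^sup>2 + 3 * t\<^sup>2)" for t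
  define w where "w x = \<bar>V (0, vec_lambda x)\<bar> + (?G * (1 + K\<^sup>2) + \<bar>g 0\<bar>) + (\<Sum>j\<in>UNIV. e (x j))" for x
  have "qgrow UNIV w"
    unfolding w_def
  proof (intro qgrow_add qgrow_abs sc.qgrow_U qgrow_const qgrow_sum qgrow_component)
    show "e \<in> borel_measurable borel" unfolding e_def by measurable
    fix t
    have "2 + 2 * K\<^sup>2 + 3 * t\<^sup>2 \<le> (3 + 2 * K\<^sup>2) * (1 + t\<^sup>2)" by (simp add: algebra_simps)
    then have "C * (2 + 2 * K\<^sup>2 + 3 * t\<^sup>2) \<le> C * ((3 + 2 * K\<^sup>2) * (1 + t\<^sup>2))" using C0 by (rule mult_left_mono)
    then show "\<bar>e t\<bar> \<le> (C * (3 + 2 * K\<^sup>2)) * (1 + t\<^sup>2)"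
      using C0 unfolding e_def by (subst abs_of_nonneg) (auto simp: mult.assoc)
  qed auto
  moreover have "\<bar>V (t, vec_lambda x)\<bar> \<le> w x" if t: "\<bar>t\<bar> \<le> K" for t x
  proof -
    have tK: "t\<^sup>2 \<le> K\<^sup>2" using power_mono[OF t, of 2] by simp
    have "\<bar>g t\<bar> \<le> ?G * (1 + t\<^sup>2)" by (rule sconv_growth[OF sconv_g])
    also have "\<dots> \<le> ?G * (1 + K\<^sup>2)" using tK G0 by (intro mult_left_mono) auto
    finally have gt: "\<bar>g t\<bar> \<le> ?G * (1 + K\<^sup>2)" .
    have r: "\<bar>\<rho> (x j - t) - \<rho> (x j)\<bar> \<le> e (x j)" for j
    proof -
      have "(x j - t)\<^sup>2 \<le> 2 * (x j)\<^sup>2 + 2 * t\<^sup>2"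
        using zero_le_power2[of "x j + t"] by (simp add: power2_eq_square algebra_simps)
      then have "C * (1 + (x j - t)\<^sup>2) \<le> C * (1 + (2 * (x j)\<^sup>2 + 2 * K\<^sup>2))"
        using tK C0 by (intro mult_left_mono) auto
      then show ?thesis using C[of "x j - t"] C[of "x j"] by (simp add: e_def algebra_simps)
    qed
    have "V (t, vec_lambda x) = V (0, vec_lambda x) + (g t - g 0) + (\<Sum>j\<in>UNIV. \<rho> (x j - t) - \<rho> (x j))"
      by (simp add: V_eq sum_subtractf)
    moreover have "\<bar>\<Sum>j\<in>UNIV. \<rho> (x j - t) - \<rho> (x j)\<bar> \<le> (\<Sum>j\<in>UNIV. e (x j))"
      by (intro order_trans[OF sum_abs] sum_mono r)
    ultimately show ?thesis unfolding w_def using gt by linarith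
  qed
  ultimately show ?thesis by blast
qed

text \<open>Together with \<open>k\<close>, a minorant of \<open>V\<close> that separates the root
  from the leaves: \<open>F\<close> is bounded below by its quadratic tangent at 0 and each \<rho>
  by its tangent at 0. The latter is affine in \<open>x j - \<theta>\<close> and therefore
  splits.\<close>

definition h :: "real \<Rightarrow> real" where
  "h t = g t - real CARD('d) * \<rho>1 0 * t + (F 0 + real CARD('d) * \<rho> 0)"

definition k :: "'d \<Rightarrow> real \<Rightarrow> real" where
  "k j t = (grad 0 $ j + \<rho>1 0) * t + a * b / 2 * t\<^sup>2"

lemma sconv_h: "sconv \<alpha> L h (\<lambda>t. g1 t - real CARD('d) * \<rho>1 0)"
proof (rule sconv_second_derivative[OF \<alpha>_pos _ _ g2_bd])
  show "(h has_real_derivative g1 t - real CARD('d) * \<rho>1 0) (at t)" for t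
    unfolding h_def by (auto intro!: derivative_eq_intros g)
  show "((\<lambda>t. g1 t - real CARD('d) * \<rho>1 0) has_real_derivative g2 t) (at t)" for t
    by (auto intro!: derivative_eq_intros g)
qed

lemma sconv_k: "sconv (a * b) (a * b) (k j) (\<lambda>t. (grad 0 $ j + \<rho>1 0) + a * b * t)"
proof (rule sconv_second_derivative)
  show "0 < a * b" using a_pos b_pos by simp
  show "(k j has_real_derivative (grad 0 $ j + \<rho>1 0) + a * b * t) (at t)" for t
    unfolding k_def by (auto intro!: derivative_eq_intros)
  show "((\<lambda>t. (grad 0 $ j + \<rho>1 0) + a * b * t) has_real_derivative a * b) (at t)" for t
    by (auto intro!: derivative_eq_intros)
qed simp

lemma V_lower: "h \<theta> + (\<Sum>j\<in>UNIV. k j (x j)) \<le> V (\<theta>, vec_lambda x)"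
proof -
  have "F 0 + grad 0 \<bullet> vec_lambda x + a * b / 2 * (vec_lambda x \<bullet> vec_lambda x) \<le> F (vec_lambda x)"
    using F_convex[of 0 "vec_lambda x"] by simp
  moreover have "grad 0 \<bullet> vec_lambda x = (\<Sum>j\<in>UNIV. grad 0 $ j * x j)" by (simp add: inner_vec_def)
  moreover have "vec_lambda x \<bullet> (vec_lambda x :: (real, 'd) vec) = (\<Sum>j\<in>UNIV. (x j)\<^sup>2)"
    by (simp add: inner_vec_def power2_eq_square)
  moreover have "(\<Sum>j\<in>UNIV. \<rho> 0 + \<rho>1 0 * (x j - \<theta>)) \<le> (\<Sum>j\<in>UNIV. \<rho> (x j - \<theta>))"
    using rho_tangent[of 0] by (intro sum_mono) simp
  moreover have "(\<Sum>j\<in>UNIV. \<rho> 0 + \<rho>1 0 * (x j - \<theta>)) = real CARD('d) * \<rho> 0 + (\<Sum>j\<in>UNIV. \<rho>1 0 * x j) - real CARD('d) * \<rho>1 0 * \<theta>"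
    by (simp add: sum.distrib right_diff_distrib sum_subtractf)
  moreover have "(\<Sum>j\<in>UNIV. k j (x j)) = (\<Sum>j\<in>UNIV. grad 0 $ j * x j) + (\<Sum>j\<in>UNIV. \<rho>1 0 * x j) + a * b / 2 * (\<Sum>j\<in>UNIV. (x j)\<^sup>2)"
    by (simp add: k_def distrib_right sum.distrib sum_distrib_left)
  ultimately show ?thesis by (simp add: V_eq h_def)
qed

lemma exists_star_approximation:
  assumes "0 < \<epsilon>"
  shows "\<exists>\<nu>\<in>star_family. KL \<nu> (gibbs V) \<le> ereal (S / (a * b)\<^sup>2 + \<epsilon>)"
proof (rule star_approximation[OF continuous_V V_strongly_convex _ _ _ V_lower V_dominated assms])
  show "integrable lborel (\<lambda>t. exp (- h t))"
    using sconv_integrable[OF sconv_h, of "\<lambda>_. 1" 1] by simp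
  show "integrable lborel (\<lambda>t. exp (- k j t))" for j
    using sconv_integrable[OF sconv_k, of "\<lambda>_. 1" 1] by simp
  \<comment> \<open>The slope of \<open>h\<close> at 0. The bound on exp (- h) is the minimum of the
    tangent parabola, \<open>h 0 - p\<^sup>2 / (2 * \<alpha>)\<close>.\<close>
  define p where "p = g1 0 - real CARD('d) * \<rho>1 0"
  show "exp (- h t) \<le> exp (p\<^sup>2 / (2 * \<alpha>) - h 0)" for t
  proof -
    have "h 0 + p * t + \<alpha> / 2 * t\<^sup>2 \<le> h t" using sconv_tangent[OF sconv_h, of 0 t] by (simp add: p_def)
    moreover have "0 \<le> (p + \<alpha> * t)\<^sup>2 / (2 * \<alpha>)" using \<alpha>_pos by simp
    moreover have "(p + \<alpha> * t)\<^sup>2 / (2 * \<alpha>) = p\<^sup>2 / (2 * \<alpha>) + p * t + \<alpha> / 2 * t\<^sup>2"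
      using \<alpha>_pos by (simp add: field_simps power2_eq_square)
    ultimately show ?thesis by simp
  qed
qed

end

theorem mainTheorem9:
  fixes n :: nat and X :: "nat \<Rightarrow> real^'d::{finite,linorder}" and Y :: "nat \<Rightarrow> real"
    and c a b B R \<alpha> L :: real
    and \<psi> \<psi>1 \<psi>2 \<rho> \<rho>1 \<rho>2 g g1 g2 :: "real \<Rightarrow> real"
    and \<mu> :: "(real \<times> (real^'d::{finite,linorder})) measure"
  assumes c_pos: "c > 0"
    and psi_C2: "\<And>x. (\<psi> has_real_derivative \<psi>1 x) (at x)"
                "\<And>x. (\<psi>1 has_real_derivative \<psi>2 x) (at x)" "continuous_on UNIV \<psi>2"
    and rho_C2: "\<And>x. (\<rho> has_real_derivative \<rho>1 x) (at x)"
                "\<And>x. (\<rho>1 has_real_derivative \<rho>2 x) (at x)" "continuous_on UNIV \<rho>2"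
    and g_C2: "\<And>x. (g has_real_derivative g1 x) (at x)"
              "\<And>x. (g1 has_real_derivative g2 x) (at x)" "continuous_on UNIV g2"
    and b_pos: "b > 0" and bB: "B \<ge> b"
    and psi2_bd: "\<And>x. b \<le> \<psi>2 x \<and> \<psi>2 x \<le> B"
    and rho2_bd: "\<And>x. 0 \<le> \<rho>2 x \<and> \<rho>2 x \<le> R"
    and a_pos: "a > 0"
    and A_ge: "\<And>v. v \<bullet> (Amat n X c *v v) \<ge> a * (v \<bullet> v)"
    and g2_bd: "\<And>x. \<alpha> \<le> g2 x \<and> g2 x \<le> L"
    and ellV_pos: "\<alpha> - real CARD('d::{finite,linorder}) * R\<^sup>2 / (a * b) > 0"
    and star: "\<mu> \<in> star_family"
    and minimizer: "\<forall>\<nu>\<in>star_family.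
                      KL \<mu> (gibbs (V_loc n X Y c \<psi> \<rho> g)) \<le> KL \<nu> (gibbs (V_loc n X Y c \<psi> \<rho> g))"
    and diff_density: "\<exists>p. (\<forall>x. p differentiable at x) \<and> \<mu> = density lborel (\<lambda>x. ennreal (p x))"
  shows "KL \<mu> (gibbs (V_loc n X Y c \<psi> \<rho> g))
           \<le> ereal ((real CARD('d::{finite,linorder}) * R + L)
                     / (a\<^sup>2 * b\<^sup>2 * (\<alpha> - real CARD('d::{finite,linorder}) * R\<^sup>2 / (a * b)))
                     * (SUP \<beta>. \<Sum>(i, j) \<in> {(i, j). i < j}. (calA n X c \<psi>2 \<beta> $ i $ j)\<^sup>2))"
proof -
  define m where "m = real CARD('d)"
  define l where "l = \<alpha> - m * R\<^sup>2 / (a * b)"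
  have l: "0 < l" using ellV_pos by (simp add: l_def m_def)
  have mR: "0 \<le> m * R\<^sup>2 / (a * b)" using a_pos b_pos by (simp add: m_def)
  \<comment> \<open>\<open>l\<close> is \<alpha> minus a nonnegative quantity. Positivity of
    \<alpha> makes the root potential strongly convex, and
    \<open>l \<le> \<alpha> \<le> L \<le> m * R + L\<close> later shows that the prefactor is at
    least 1.\<close>
  then have \<alpha>: "0 < \<alpha>" "l \<le> \<alpha>" using l by (auto simp: l_def)
  interpret star_model n X Y c a b B R \<alpha> L \<psi> \<psi>1 \<psi>2 \<rho> \<rho>1 \<rho>2 g g1 g2
    using assms \<alpha>(1) by unfold_locales auto
  have "KL \<mu> (gibbs V) \<le> ereal (S / (a * b)\<^sup>2) + ereal \<epsilon>" if "0 < \<epsilon>" for \<epsilon>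
    using exists_star_approximation[OF that] minimizer by (auto intro: order_trans)
  then have le: "KL \<mu> (gibbs V) \<le> ereal (S / (a * b)\<^sup>2)"
    by (rule ereal_le_epsilon2[rule_format]) auto
  have "0 \<le> (\<Sum>i\<in>UNIV. \<Sum>j\<in>UNIV - {i}. (calA n X c \<psi>2 0 $ i $ j)\<^sup>2)" by (intro sum_nonneg) auto
  then have S0: "0 \<le> S" using offdiag_le_S[of 0] by linarith
  have "0 \<le> m * R" using R_nonneg by (simp add: m_def)
  then have "l \<le> m * R + L" using \<alpha>(2) g2_bd[of 0] by linarith
  then have "1 \<le> (m * R + L) / l" using l by simp
  then have "S / (a * b)\<^sup>2 * 1 \<le> S / (a * b)\<^sup>2 * ((m * R + L) / l)"
    using S0 by (intro mult_left_mono) auto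
  also have "\<dots> = (m * R + L) / (a\<^sup>2 * b\<^sup>2 * l) * S" by (simp add: power_mult_distrib mult_ac)
  finally have "S / (a * b)\<^sup>2 \<le> (m * R + L) / (a\<^sup>2 * b\<^sup>2 * l) * S" by simp
  then have "ereal (S / (a * b)\<^sup>2) \<le> ereal ((m * R + L) / (a\<^sup>2 * b\<^sup>2 * l) * S)" by simp
  from order_trans[OF le this] show ?thesis unfolding m_def l_def S_def .
qed

end
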